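(* Let $m \in \mathbb{N} \setminus \{1\}$ be given. Assume that $f \in L^2(\mathbb{R}) \cap C(\mathbb{R})$ is bandlimited with bandwidth $\delta \in \big(0, \frac{m-1}{m}\pi\big]$. Further let $\varphi_{\sinh}$ be the $\sinh$-type window function $$\varphi_{\sinh}(t) := \begin{cases} \frac{1}{\sinh\beta}\, \sinh\Big(\beta \sqrt{1 - \tfrac{t^2}{m^2}}\Big) & t \in [-m,m], \\ 0 & t \in \mathbb{R} \setminus [-m,m], \end{cases}$$ with shape parameter $\beta = m(\pi - \delta)$. Then the $\sinh$-type regularized Shannon sampling formula $R_{\sinh,m} f := R_{\varphi_{\sinh},m} f$ satisfies the error estimate $$\big\| f - R_{\sinh,m} f \big\|_{C_0(\mathbb{R})} \le \big( 4 + 9 \sqrt{m(\pi-\delta)} \big)\, \mathrm{e}^{-m(\pi-\delta)}\, \| f \|_{L^2(\mathbb{R})}.$$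
   Context: $\mathbb{N} = \{1,2,3,\ldots\}$. The Fourier transform is $\hat{g}(\omega) := \frac{1}{\sqrt{2\pi}} \int_{\mathbb{R}} g(t)\, \mathrm{e}^{-\mathrm{i} t\omega}\, \mathrm{d}t$, $\omega \in \mathbb{R}$ (extended to $L^2(\mathbb{R})$ in the usual way). A function $f \in L^2(\mathbb{R}) \cap C(\mathbb{R})$ is called bandlimited with bandwidth $\delta > 0$ if $\hat{f}(\omega) = 0$ for all $|\omega| \ge \delta$. The cardinal sine function is $\mathrm{sinc}(t) := \frac{\sin(\pi t)}{\pi t}$ for $t \ne 0$ and $\mathrm{sinc}(0) := 1$. Let $\mathbf{1}_{[-m,m]}$ denote the characteristic function of $[-m,m]$. For a window function $\varphi : \mathbb{R} \to [0,1]$, the $\varphi$-regularized Shannon sampling formula with truncation parameter $m \in \mathbb{N} \setminus \{1\}$ is $$(R_{\varphi,m} f)(t) := \sum_{k \in \mathbb{Z}} f(k)\, \mathrm{sinc}(t-k)\, \varphi(t-k)\, \mathbf{1}_{[-m,m]}(t-k), \quad t \in \mathbb{R}.$$ $C_0(\mathbb{R})$ is the Banach space of continuous functions $g : \mathbb{R} \to \mathbb{C}$ vanishing as $|t| \to \infty$, with norm $\|g\|_{C_0(\mathbb{R})} := \max_{t \in \mathbb{R}} |g(t)|$. *)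

theory Defs
  imports "HOL-Analysis.Analysis"
begin

text \<open>Elements of \<open>L\<^sup>2(\<real>)\<close> are represented by Borel functions; two of them are the same
  element if they agree almost everywhere.\<close>

definition L2 :: "(real \<Rightarrow> complex) set" where
  "L2 = {f. f \<in> borel_measurable lborel \<and> integrable lborel (\<lambda>t. (cmod (f t))\<^sup>2)}"

definition L2_norm :: "(real \<Rightarrow> complex) \<Rightarrow> real" where
  "L2_norm f = sqrt (LINT t|lborel. (cmod (f t))\<^sup>2)"

text \<open>Membership in \<open>L\<^sup>2\<close> is part of convergence, because \<^const>\<open>L2_norm\<close> is \<open>0\<close> on functions
  that are not square-integrable.\<close>

definition L2_converges :: "(nat \<Rightarrow> real \<Rightarrow> complex) \<Rightarrow> (real \<Rightarrow> complex) \<Rightarrow> bool" where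
  "L2_converges h f \<longleftrightarrow>
     (\<forall>n. h n \<in> L2) \<and> f \<in> L2 \<and> (\<lambda>n. L2_norm (\<lambda>t. h n t - f t)) \<longlonglongrightarrow> 0"

definition fourier :: "(real \<Rightarrow> complex) \<Rightarrow> real \<Rightarrow> complex" where
  "fourier g \<omega> =
     complex_of_real (1 / sqrt (2 * pi)) *
     (LINT t|lborel. g t * exp (- \<i> * complex_of_real t * complex_of_real \<omega>))"

text \<open>The Fourier transform on \<open>L\<^sup>2\<close> is the continuous extension of \<^const>\<open>fourier\<close> from the
  dense subspace \<open>L\<^sup>1 \<inter> L\<^sup>2\<close>. By Plancherel's theorem every \<open>f\<close> in \<open>L\<^sup>2\<close> has such a \<open>g\<close>,
  unique up to null sets, hence a relation between \<open>f\<close> and the representatives \<open>g\<close> of its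
  transform.\<close>

definition has_fourier_L2 :: "(real \<Rightarrow> complex) \<Rightarrow> (real \<Rightarrow> complex) \<Rightarrow> bool" where
  "has_fourier_L2 f g \<longleftrightarrow>
     (\<exists>h. (\<forall>n. integrable lborel (h n)) \<and> L2_converges h f \<and>
          L2_converges (\<lambda>n. fourier (h n)) g)"

text \<open>Since the transform is only determined up to null sets, vanishing for \<open>\<bar>\<omega>\<bar> \<ge> \<delta>\<close>
  means that some representative vanishes there.\<close>

definition bandlimited :: "real \<Rightarrow> (real \<Rightarrow> complex) \<Rightarrow> bool" where
  "bandlimited \<delta> f \<longleftrightarrow>
     f \<in> L2 \<and> continuous_on UNIV f \<and> \<delta> > 0 \<and>
     (\<exists>g. has_fourier_L2 f g \<and> (\<forall>\<omega>. \<bar>\<omega>\<bar> \<ge> \<delta> \<longrightarrow> g \<omega> = 0))"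

definition cardinal_sine :: "real \<Rightarrow> real" where
  "cardinal_sine t = (if t = 0 then 1 else sin (pi * t) / (pi * t))"

definition regularized_shannon ::
  "(real \<Rightarrow> real) \<Rightarrow> nat \<Rightarrow> (real \<Rightarrow> complex) \<Rightarrow> real \<Rightarrow> complex" where
  "regularized_shannon \<phi> m f t =
     (\<Sum>\<^sub>\<infinity>k::int. f (of_int k) *
        complex_of_real (cardinal_sine (t - of_int k) * \<phi> (t - of_int k) *
                         indicator {- real m..real m} (t - of_int k)))"

definition sinh_window :: "nat \<Rightarrow> real \<Rightarrow> real \<Rightarrow> real" where
  "sinh_window m \<beta> t =
     (if t \<in> {- real m..real m}
      then 1 / sinh \<beta> * sinh (\<beta> * sqrt (1 - t\<^sup>2 / (real m)\<^sup>2)) else 0)"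

definition C0 :: "(real \<Rightarrow> complex) set" where
  "C0 = {g. continuous_on UNIV g \<and> (g \<longlongrightarrow> 0) at_infinity}"

text \<open>On \<^const>\<open>C0\<close> the supremum is a maximum; outside it may be unspecified.\<close>

definition C0_norm :: "(real \<Rightarrow> complex) \<Rightarrow> real" where
  "C0_norm g = (SUP t. cmod (g t))"

end

theory Submission
  imports Defs "HOL-Probability.Probability" "HOL-Complex_Analysis.Complex_Analysis"
    "HOL-Real_Asymp.Real_Asymp"
begin

text \<open>Let \<open>g\<close> be the Fourier transform of \<open>f\<close>, supported in \<open>[-\<delta>, \<delta>]\<close>. By Fourier inversion
  \<open>f t = (2 \<pi>)\<^bsup>-1/2\<^esup> \<integral> g \<omega> e\<^bsup>i\<omega>t\<^esup> d\<omega>\<close> at every \<open>t\<close>. The sampling formula is linear and, at a fixed \<open>t\<close>,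
  involves finitely many samples, so the error of \<open>f\<close> at \<open>t\<close> is the integral of \<open>g\<close> against the
  errors of the exponentials \<open>e\<^bsup>i\<omega>t\<^esup>\<close> with \<open>\<bar>\<omega>\<bar> \<le> \<delta>\<close>. Cauchy--Schwarz together with \<open>\<parallel>g\<parallel> \<le> \<parallel>f\<parallel>\<close> and
  \<open>(2 \<pi>)\<^bsup>-1/2\<^esup> \<cdot> (2 \<delta>)\<^bsup>1/2\<^esup> \<le> 1\<close> reduces the estimate to a bound for exponentials that is uniform in
  \<open>\<omega>\<close> and \<open>t\<close>; this is \<open>exponential_localized_sampling_error\<close>, with bound \<open>9 \<surd>\<beta> e\<^bsup>-\<beta>\<^esup>\<close>.

  The sinh window \<open>\<phi>\<close> is not bandlimited, and the heart of the proof is to replace it by an entire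
  function. Put \<open>r = s / m\<close> and \<open>W r = cosh (\<beta> \<surd>(1 - r\<^sup>2)) - cos (\<beta> r)\<close>. Since \<open>cosh (\<surd>w)\<close> is entire,
  so is \<open>W\<close>, and as a function of \<open>s\<close> it has exponential type \<open>\<beta> / m = \<pi> - \<delta>\<close>. Writing
  \<open>W = cosh a - cosh b\<close> with \<open>a\<^sup>2 - b\<^sup>2 = \<beta>\<^sup>2\<close> shows that subtracting the cosine makes \<open>W\<close> decay like
  \<open>1 / \<bar>r\<bar>\<close>. An exponential \<open>e\<^bsup>i\<omega>z\<^esup>\<close> times \<open>W ((t - z) / m)\<close> therefore has type at most \<open>\<pi>\<close> and decays
  relative to \<open>e\<^bsup>\<pi>\<bar>Im z\<bar>\<^esup>\<close>, so that the classical cardinal series reproduces it exactly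
  (\<open>cardinal_series\<close>, by residues). As \<open>W 0 = cosh \<beta> - 1\<close>, the error of the localized formula is
  the series of \<open>e\<^bsup>i\<omega>k\<^esup> sinc s \<cdot> (W (s / m) / (cosh \<beta> - 1) - \<phi> s)\<close> over \<open>s = t - k\<close>.

  Inside the support of the window the hyperbolic identity \<open>cosh_minus_scaled_sinh\<close> turns
  \<open>W r - (cosh \<beta> - 1) \<phi> s\<close> into a difference of two bounded quantities, and outside it is the
  difference of two cosines. Both are at most \<open>\<surd>(2 \<beta>) min (\<surd>\<bar>r\<bar>) (1 / \<surd>\<bar>r\<bar>)\<close>
  (\<open>entire_window_minus_sinh_window\<close>). Summing this weight against \<open>\<bar>sinc\<bar>\<close> over a shifted
  integer lattice costs at most \<open>1 + 6 / \<pi>\<close> for all \<open>m \<ge> 2\<close> and non-integer \<open>t\<close>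
  (\<open>sum_weighted_sinc\<close>; at integers \<open>t\<close> the sampling formula is exact), and the
  division by \<open>cosh \<beta> - 1\<close>, which is about \<open>e\<^bsup>\<beta>\<^esup> / 2\<close>, produces the factor \<open>e\<^bsup>-\<beta>\<^esup>\<close>.\<close>

section \<open>An entire function close to the window\<close>

lemma exp_mean_le:
  fixes a b c :: real
  assumes "a \<le> c" "b \<le> c"
  shows "(exp a + exp b) / 2 \<le> exp c"
proof -
  have "exp a \<le> exp c" "exp b \<le> exp c" using assms by auto
  then have "exp a + exp b \<le> exp c + exp c" by (rule add_mono)
  then show ?thesis by simp
qed

lemma norm_sinh_le_exp_Re: "cmod (sinh z) \<le> exp \<bar>Re z\<bar>"
proof -
  have "cmod (sinh z) \<le> (exp (Re z) + exp (- Re z)) / 2"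
    using norm_triangle_ineq4[of "exp z" "exp (-z)"] by (simp add: sinh_def)
  also have "\<dots> \<le> exp \<bar>Re z\<bar>" by (rule exp_mean_le) auto
  finally show ?thesis .
qed

lemma norm_sinh_le_norm: "cmod (sinh z) \<le> cmod z * exp (cmod z)"
proof -
  have "cmod (sinh z - sinh 0) \<le> exp (cmod z) * cmod (z - 0)"
  proof (rule field_differentiable_bound[where S = "cball 0 (cmod z)"])
    show "(sinh has_field_derivative cosh w) (at w within cball 0 (cmod z))" for w :: complex
      by (auto intro!: derivative_eq_intros)
    fix w :: complex assume w: "w \<in> cball 0 (cmod z)"
    have "cmod (cosh w) \<le> (exp (Re w) + exp (- Re w)) / 2"
      using norm_triangle_ineq[of "exp w" "exp (-w)"] by (simp add: cosh_def)
    also have "\<dots> \<le> exp (cmod z)"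
      using w abs_Re_le_cmod[of w] by (intro exp_mean_le) auto
    finally show "cmod (cosh w) \<le> exp (cmod z)" .
  qed auto
  then show ?thesis by (simp add: mult.commute)
qed

lemma cosh_minus_cosh: "cosh a - cosh b = 2 * sinh ((a + b) / 2) * sinh ((a - b) / 2)"
  for a b :: complex
proof -
  have "cosh ((a+b)/2 + (a-b)/2) - cosh ((a+b)/2 - (a-b)/2) = 2 * sinh ((a + b) / 2) * sinh ((a - b) / 2)"
    by (simp add: cosh_add cosh_diff)
  moreover have "(a+b)/2 + (a-b)/2 = a" "(a+b)/2 - (a-b)/2 = b"
    by (simp_all add: field_simps)
  ultimately show ?thesis by simp
qed

text \<open>The product \<open>(a + b) (a - b)\<close> is the constant \<open>\<beta>\<^sup>2\<close>, so if \<open>b\<close> is large then one of the two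
  factors is large and the other small; replacing \<open>b\<close> by \<open>-b\<close> decides which. The product formula
  for \<open>cosh a - cosh b\<close> then gains a factor \<open>1 / \<bar>b\<bar>\<close> over the growth of \<open>cosh b\<close>.\<close>

lemma norm_cosh_minus_cosh_le:
  fixes a b :: complex and \<beta> :: real
  assumes eq: "a\<^sup>2 - b\<^sup>2 = of_real (\<beta>\<^sup>2)" and \<beta>: "\<beta> > 0" and b: "cmod b \<ge> \<beta>"
  shows "cmod (cosh a - cosh b) \<le> \<beta>\<^sup>2 * exp \<beta> * exp \<bar>Re b\<bar> / cmod b"
proof -
  have main: "cmod (cosh a - cosh c) \<le> \<beta>\<^sup>2 * exp \<beta> * exp \<bar>Re c\<bar> / cmod c"
    if eqc: "a\<^sup>2 - c\<^sup>2 = of_real (\<beta>\<^sup>2)" and c: "cmod c \<ge> \<beta>" and le: "cmod (a - c) \<le> cmod (a + c)" for c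
  proof -
    have "2 * cmod c = cmod ((a + c) - (a - c))" by (simp add: norm_mult)
    also have "\<dots> \<le> 2 * cmod (a + c)" using norm_triangle_ineq4[of "a + c" "a - c"] le by simp
    finally have ac: "cmod c \<le> cmod (a + c)" by simp
    have "(a + c) * (a - c) = of_real (\<beta>\<^sup>2)" using eqc by (simp add: power2_eq_square algebra_simps)
    then have prod: "cmod (a + c) * cmod (a - c) = \<beta>\<^sup>2"
      by (metis abs_of_nonneg norm_mult norm_of_real zero_le_power2)
    have c0: "cmod c > 0" using c \<beta> by linarith
    have "cmod c * cmod (a - c) \<le> \<beta>\<^sup>2" using prod ac by (metis mult_right_mono norm_ge_zero)
    then have d: "cmod (a - c) \<le> \<beta>\<^sup>2 / cmod c" using c0 by (simp add: field_simps)
    also have "\<dots> \<le> \<beta>\<^sup>2 / \<beta>" using c c0 \<beta> by (intro divide_left_mono mult_pos_pos) auto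
    finally have d': "cmod (a - c) \<le> \<beta>" using \<beta> by (simp add: power2_eq_square)
    have re: "\<bar>Re ((a + c) / 2)\<bar> \<le> \<bar>Re c\<bar> + \<beta> / 2"
    proof -
      have "\<bar>Re (a - c)\<bar> \<le> \<beta>" using abs_Re_le_cmod[of "a - c"] d' by linarith
      moreover have "Re ((a + c) / 2) = Re c + Re (a - c) / 2" by (simp add: field_simps)
      ultimately show ?thesis by linarith
    qed
    have "cmod (cosh a - cosh c) = 2 * cmod (sinh ((a + c) / 2)) * cmod (sinh ((a - c) / 2))"
      by (simp add: cosh_minus_cosh norm_mult)
    also have "\<dots> \<le> 2 * exp (\<bar>Re c\<bar> + \<beta> / 2) * (\<beta>\<^sup>2 / cmod c / 2 * exp (\<beta> / 2))"
    proof (intro mult_mono)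
      show "cmod (sinh ((a + c) / 2)) \<le> exp (\<bar>Re c\<bar> + \<beta> / 2)"
        using norm_sinh_le_exp_Re[of "(a + c)/2"] re by (meson exp_le_cancel_iff order_trans)
      have "cmod (sinh ((a - c) / 2)) \<le> cmod (a - c) / 2 * exp (cmod (a - c) / 2)"
        using norm_sinh_le_norm[of "(a - c)/2"] by (simp add: norm_divide)
      also have "\<dots> \<le> \<beta>\<^sup>2 / cmod c / 2 * exp (\<beta> / 2)"
        using d d' by (intro mult_mono) (auto simp: norm_ge_zero)
      finally show "cmod (sinh ((a - c) / 2)) \<le> \<beta>\<^sup>2 / cmod c / 2 * exp (\<beta> / 2)" .
    qed (use \<beta> in auto)
    also have "\<dots> = \<beta>\<^sup>2 * exp \<beta> * exp \<bar>Re c\<bar> / cmod c"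
    proof -
      have "exp \<beta> = exp (\<beta>/2) * exp (\<beta>/2)" by (simp flip: exp_add)
      then show ?thesis by (simp add: exp_add)
    qed
    finally show ?thesis .
  qed
  show ?thesis
  proof (cases "cmod (a - b) \<le> cmod (a + b)")
    case True then show ?thesis using main[OF eq b] by simp
  next
    case False
    then show ?thesis using main[of "- b"] eq b by simp
  qed
qed

text \<open>Only even powers of the square root occur in the power series of \<open>cosh\<close>, so the branch cut of
  \<^const>\<open>csqrt\<close> leaves no trace.\<close>

lemma cosh_csqrt_holomorphic: "(\<lambda>w. cosh (csqrt w)) holomorphic_on UNIV"
proof -
  have *: "(\<lambda>n. (1 / fact (2 * n)) * (w - 0) ^ n) sums cosh (csqrt w)" for w :: complex
  proof -
    let ?f = "\<lambda>n. if even n then csqrt w ^ n /\<^sub>R fact n else 0"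
    have "?f sums cosh (csqrt w)" by (rule cosh_converges)
    then have "(\<lambda>n. ?f (2 * n)) sums cosh (csqrt w)"
      by (subst sums_mono_reindex) (auto simp: strict_mono_def elim!: evenE)
    moreover have "?f (2 * n) = (1 / fact (2 * n)) * (w - 0) ^ n" for n
    proof -
      have "csqrt w ^ (2 * n) = w ^ n" by (simp only: power_mult power2_csqrt)
      moreover have "x /\<^sub>R fact k = (1 / fact k) * x" for x :: complex and k
        by (simp add: scaleR_conv_of_real divide_inverse mult.commute)
      ultimately show ?thesis by (simp only: diff_zero even_mult_iff even_numeral simp_thms if_True)
    qed
    ultimately show ?thesis by simp
  qed
  have "(\<lambda>w. cosh (csqrt w)) holomorphic_on ball 0 r" for r
    by (rule power_series_holomorphic[OF *])
  then have "(\<lambda>w. cosh (csqrt w)) field_differentiable at w" for w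
    using holomorphic_on_imp_differentiable_at[of _ "ball 0 (cmod w + 1)" w] by simp
  then show ?thesis
    by (simp add: holomorphic_on_def field_differentiable_at_within)
qed

text \<open>The entire substitute for the window, in the variable \<open>r = s / m\<close> and without normalization;
  its value at \<open>0\<close> is \<open>cosh \<beta> - 1\<close>.\<close>

definition entire_window :: "real \<Rightarrow> complex \<Rightarrow> complex" where
  "entire_window \<beta> r = cosh (csqrt ((of_real \<beta>)\<^sup>2 - (of_real \<beta> * r)\<^sup>2)) - cos (of_real \<beta> * r)"

lemma entire_window_holomorphic: "entire_window \<beta> holomorphic_on UNIV"
proof -
  have "((\<lambda>w. cosh (csqrt w)) \<circ> (\<lambda>r. (of_real \<beta>)\<^sup>2 - (of_real \<beta> * r)\<^sup>2)) holomorphic_on UNIV"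
    by (rule holomorphic_on_compose_gen[OF _ cosh_csqrt_holomorphic]) (auto intro!: holomorphic_intros)
  then show ?thesis
    unfolding entire_window_def[abs_def] by (auto intro!: holomorphic_intros simp: o_def)
qed

text \<open>Apply \<open>norm_cosh_minus_cosh_le\<close> with \<open>b = i \<beta> r\<close>, for which \<open>cosh b = cos (\<beta> r)\<close>.\<close>

lemma norm_entire_window_le:
  assumes "\<beta> > 0" "cmod r \<ge> 1"
  shows "cmod (entire_window \<beta> r) \<le> \<beta> * exp \<beta> * exp (\<beta> * \<bar>Im r\<bar>) / cmod r"
proof -
  let ?b = "\<i> * (of_real \<beta> * r)" 
  let ?a = "csqrt ((of_real \<beta>)\<^sup>2 - (of_real \<beta> * r)\<^sup>2)"
  have "cmod (cosh ?a - cosh ?b) \<le> \<beta>\<^sup>2 * exp \<beta> * exp \<bar>Re ?b\<bar> / cmod ?b"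
    by (rule norm_cosh_minus_cosh_le) (use assms in \<open>auto simp: norm_mult power_mult_distrib\<close>)
  moreover have "cosh ?b = cos (of_real \<beta> * r)"
    by (simp add: cosh_conv_cos flip: mult.assoc)
  moreover have "\<beta>\<^sup>2 * exp \<beta> * exp \<bar>Re ?b\<bar> / cmod ?b = \<beta> * exp \<beta> * exp (\<beta> * \<bar>Im r\<bar>) / cmod r"
    using assms by (simp add: norm_mult abs_mult power2_eq_square)
  ultimately show ?thesis by (simp add: entire_window_def)
qed

section \<open>The cardinal series by residues\<close>

text \<open>On the circle of radius \<open>N + 1/2\<close> either \<open>\<bar>Im z\<bar> \<ge> 1/2\<close>, where \<open>sin (\<pi> z)\<close> has
  its full exponential size, or the real part is within \<open>1/4\<close> of \<open>\<plusminus>(N + 1/2)\<close>, far from the zeros.\<close>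

lemma norm_sin_pi_ge:
  fixes z :: complex and N :: nat
  assumes z: "cmod z = real N + 1 / 2" and N: "N \<ge> 1"
  shows "exp (pi * \<bar>Im z\<bar>) / 4 \<le> cmod (sin (of_real pi * z))"
proof -
  define x y where "x = \<bar>Re z\<bar>" and "y = \<bar>Im z\<bar>"
  define E where "E = exp (pi * y)"
  have xy: "x\<^sup>2 + y\<^sup>2 = (real N + 1/2)\<^sup>2" using z by (simp add: x_def y_def flip: cmod_power2)
  have E1: "E \<ge> 1" unfolding E_def y_def by simp
  have nrm: "4 * (cmod (sin (of_real pi * z)))\<^sup>2 = E\<^sup>2 + inverse (E\<^sup>2) - 2 * cos (2 * pi * x)"
  proof -
    have "4 * (cmod (sin (of_real pi * z)))\<^sup>2 = exp (2 * (pi * Im z)) + inverse (exp (2 * (pi * Im z))) - 2 * cos (2 * (pi * Re z))"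
      by (subst norm_sin_squared) simp
    moreover have "cos (2 * (pi * Re z)) = cos (2 * pi * x)" by (simp add: x_def abs_if mult.assoc)
    moreover have "exp (2 * (pi * Im z)) + inverse (exp (2 * (pi * Im z))) = E\<^sup>2 + inverse (E\<^sup>2)"
    proof -
      have "E\<^sup>2 = exp (2 * (pi * y))" by (simp add: E_def exp_double)
      then show ?thesis by (cases "Im z \<ge> 0") (simp_all add: y_def exp_minus)
    qed
    ultimately show ?thesis by simp
  qed
  have "E\<^sup>2 / 4 \<le> 4 * (cmod (sin (of_real pi * z)))\<^sup>2"
  proof (cases "y \<ge> 1 / 2")
    case True
    have "4 \<le> 1 + pi" using pi_gt3 by simp
    also have "\<dots> \<le> exp pi" by (rule exp_ge_add_one_self)
    also have "\<dots> \<le> exp (2 * (pi * y))" using True by simp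
    also have "\<dots> = E\<^sup>2" by (simp add: E_def exp_double)
    finally have "E\<^sup>2 \<ge> 4" .
    moreover have "cos (2 * pi * x) \<le> 1" "inverse (E\<^sup>2) \<ge> 0" by auto
    ultimately show ?thesis unfolding nrm by linarith
  next
    case False
    have y0: "y \<ge> 0" by (simp add: y_def)
    then have y2: "y\<^sup>2 \<le> (1/2)\<^sup>2" using False by (intro power_mono) auto
    have "(real N + 1/4)\<^sup>2 \<le> x\<^sup>2" using xy y2 N by (simp add: power2_eq_square algebra_simps)
    then have xl: "real N + 1/4 \<le> x" by (rule power2_le_imp_le) (simp add: x_def)
    have "x\<^sup>2 \<le> (real N + 1/2)\<^sup>2" using xy by (smt (verit) zero_le_power2)
    then have xu: "x \<le> real N + 1/2" by (rule power2_le_imp_le) simp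
    \<comment> \<open>the phase by which \<open>2 \<pi> x\<close> falls short of an odd multiple of \<open>\<pi>\<close>\<close>
    define h where "h = 2 * pi * (real N + 1/2 - x)"
    have "cos (2 * pi * x) = cos (pi - h + 2 * pi * real N)" by (simp add: h_def algebra_simps)
    also have "\<dots> = cos (pi - h)" by (metis Ints_of_nat cos_add cos_int_2pin mult.commute mult_cancel_left2 of_int_of_nat_eq sin_int_2pin mult_zero_right diff_zero mult.right_neutral)
    also have "\<dots> = - cos h" by simp
    finally have c: "cos (2 * pi * x) = - cos h" .
    have "0 \<le> h" using xu unfolding h_def by (intro mult_nonneg_nonneg) auto
    moreover have "2 * pi * (real N + 1/2 - x) \<le> 2 * pi * (1 / 4)"
      using xl by (intro mult_left_mono) auto
    then have "h \<le> pi / 2" by (simp add: h_def)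
    ultimately have "0 \<le> h" "h \<le> pi / 2" by auto
    then have "cos h \<ge> 0" by (intro cos_ge_zero) auto
    then have "4 * (cmod (sin (of_real pi * z)))\<^sup>2 \<ge> E\<^sup>2 + inverse (E\<^sup>2)" unfolding nrm c by simp
    moreover have "inverse (E\<^sup>2) \<ge> 0" "E\<^sup>2 \<ge> 0" by auto
    ultimately show ?thesis by linarith
  qed
  then have "(E / 4)\<^sup>2 \<le> (cmod (sin (of_real pi * z)))\<^sup>2" by (simp add: power2_eq_square)
  then have "E / 4 \<le> cmod (sin (of_real pi * z))" by (rule power2_le_imp_le) simp
  then show ?thesis by (simp add: E_def y_def)
qed

lemma sin_pi_mult_eq_0_iff:
  fixes z :: complex
  shows "sin (of_real pi * z) = 0 \<longleftrightarrow> (\<exists>k::int. z = of_int k)"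
proof -
  have "sin (of_real pi * z) = 0 \<longleftrightarrow> (\<exists>k::int. of_real pi * z = of_real (of_int k * pi))"
    by (rule sin_eq_0)
  also have "\<dots> \<longleftrightarrow> (\<exists>k::int. z = of_int k)"
    by (simp add: mult.commute)
  finally show ?thesis .
qed

text \<open>The limit form of the residue is used because \<open>P\<close> may vanish at the node, in which case the
  singularity is removable instead of a simple pole.\<close>

lemma residue_cardinal_kernel_node:
  fixes P :: "complex \<Rightarrow> complex" and t :: real and k :: int
  assumes holo: "P holomorphic_on UNIV" and t: "t \<notin> \<int>"
  shows "residue (\<lambda>z. P z * of_real (sin (pi * t)) / ((z - of_real t) * sin (of_real pi * z))) (of_int k)
         = - (P (of_int k) * of_real (cardinal_sine (t - of_int k)))"
proof (rule residue_simple'[where s = "ball (of_int k) (min 1 \<bar>t - of_int k\<bar>)"])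
  let ?F = "\<lambda>z. P z * of_real (sin (pi * t)) / ((z - of_real t) * sin (of_real pi * z))"
  have tk: "t - of_int k \<noteq> 0" using t by (metis Ints_of_int eq_iff_diff_eq_0)
  then have tkc: "of_int k - complex_of_real t \<noteq> 0" by (simp add: complex_eq_iff)
  show "of_int k \<in> ball (of_int k :: complex) (min 1 \<bar>t - of_int k\<bar>)" using tk by auto
  show "?F holomorphic_on ball (of_int k) (min 1 \<bar>t - of_int k\<bar>) - {of_int k}"
  proof (intro holomorphic_intros holomorphic_on_subset[OF holo])
    fix z :: complex assume z: "z \<in> ball (of_int k) (min 1 \<bar>t - of_int k\<bar>) - {of_int k}"
    have "z \<noteq> of_real t"
    proof
      assume "z = of_real t"
      then have "dist (of_int k) z = \<bar>t - of_int k\<bar>"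
        by (metis dist_commute dist_norm norm_of_real of_real_diff of_real_of_int_eq)
      then show False using z by auto
    qed
    moreover have "sin (of_real pi * z) \<noteq> 0"
    proof
      assume "sin (of_real pi * z) = 0"
      then obtain j :: int where j: "z = of_int j" by (auto simp: sin_pi_mult_eq_0_iff)
      then have "dist (of_int k) z = \<bar>of_int (k - j)\<bar>"
        by (metis dist_norm norm_of_int of_int_diff)
      then have "\<bar>of_int (k - j)\<bar> < (1::real)" using z by auto
      then have "k = j" by linarith
      then show False using z j by auto
    qed
    ultimately show "(z - of_real t) * sin (of_real pi * z) \<noteq> 0" by simp
  qed auto
  let ?q = "\<lambda>z::complex. (z - of_int k) / sin (of_real pi * z)"
  have "((\<lambda>z::complex. sin (of_real pi * z)) has_field_derivative of_real pi * cos (of_real pi * of_int k)) (at (of_int k))"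
    by (auto intro!: derivative_eq_intros)
  then have "((\<lambda>z::complex. (sin (of_real pi * z) - sin (of_real pi * of_int k)) / (z - of_int k)) \<longlongrightarrow>
      of_real pi * cos (of_real pi * of_int k)) (at (of_int k))"
    by (simp add: has_field_derivative_iff)
  moreover have s0: "sin (of_real pi * of_int k :: complex) = 0"
    using sin_pi_mult_eq_0_iff by blast
  ultimately have lim: "((\<lambda>z::complex. sin (of_real pi * z) / (z - of_int k)) \<longlongrightarrow>
      of_real pi * cos (of_real pi * of_int k)) (at (of_int k))" by simp
  have c2: "(cos (of_real pi * of_int k :: complex))\<^sup>2 = 1"
    using sin_cos_squared_add[of "of_real pi * of_int k :: complex"] s0 by simp
  then have c0: "cos (of_real pi * of_int k :: complex) \<noteq> 0" by auto
  from tendsto_inverse[OF lim] have q: "(?q \<longlongrightarrow> inverse (of_real pi * cos (of_real pi * of_int k))) (at (of_int k))"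
    using c0 by simp
  have "isCont P (of_int k)"
    using holomorphic_on_imp_continuous_on[OF holo] by (simp add: continuous_on_eq_continuous_at)
  then have P: "(P \<longlongrightarrow> P (of_int k)) (at (of_int k))" by (simp add: isCont_def)
  have "((\<lambda>z. P z * of_real (sin (pi * t)) / (z - of_real t) * ?q z) \<longlongrightarrow>
      P (of_int k) * of_real (sin (pi * t)) / (of_int k - of_real t) *
        inverse (of_real pi * cos (of_real pi * of_int k))) (at (of_int k))"
    using tkc by (intro tendsto_intros P q)
  moreover have "P (of_int k) * of_real (sin (pi * t)) / (of_int k - of_real t) *
        inverse (of_real pi * cos (of_real pi * of_int k)) = 
      - (P (of_int k) * of_real (cardinal_sine (t - of_int k)))"
  proof -
    have "cardinal_sine (t - of_int k) = sin (pi * t) * cos (pi * of_int k) / (pi * (t - of_int k))"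
      using tk sin_int_2pin[of k] by (simp add: cardinal_sine_def right_diff_distrib sin_diff sin_npi_int mult.commute)
    then have cs: "complex_of_real (cardinal_sine (t - of_int k)) = of_real (sin (pi * t)) *
        of_real (cos (pi * of_int k)) / (of_real pi * (of_real t - of_int k))"
      by (simp only: of_real_mult of_real_divide of_real_diff of_real_of_int_eq)
    have cc: "complex_of_real (cos (pi * of_int k)) = cos (of_real pi * of_int k)"
      by (metis cos_of_real of_real_mult of_real_of_int_eq)
    have inv: "inverse (cos (of_real pi * of_int k :: complex)) = cos (of_real pi * of_int k)"
      using c2 by (metis inverse_unique power2_eq_square)
    have neg: "of_int k - complex_of_real t = - (complex_of_real t - of_int k)" by simp
    have aux: "p * s / - d * inverse (q * c) = - (p * (s * c / (q * d)))"
      if "inverse c = c" for p s c d q :: complex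
      using that by (simp add: divide_inverse mult_ac)
    show ?thesis unfolding cs cc neg by (rule aux[OF inv])
  qed
  moreover have "(\<lambda>z. ?F z * (z - of_int k)) = (\<lambda>z. P z * of_real (sin (pi * t)) / (z - of_real t) * ?q z)"
    by (rule ext) (simp only: divide_inverse inverse_mult_distrib mult_ac)
  ultimately show "((\<lambda>z. ?F z * (z - of_int k)) \<longlongrightarrow> - (P (of_int k) * of_real (cardinal_sine (t - of_int k)))) (at (of_int k))"
    by simp
qed auto

lemma residue_cardinal_kernel_centre:
  fixes P :: "complex \<Rightarrow> complex" and t :: real
  assumes holo: "P holomorphic_on UNIV" and t: "t \<notin> \<int>"
  shows "residue (\<lambda>z. P z * of_real (sin (pi * t)) / ((z - of_real t) * sin (of_real pi * z))) (of_real t) = P (of_real t)"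
proof -
  let ?S = "- (range of_int) :: complex set"
  have "closed (range of_int :: complex set)" using closed_Ints[where 'a=complex] by (simp add: Ints_def)
  then have op: "open ?S" by auto
  have tS: "of_real t \<in> ?S"
    using t by (auto simp: complex_eq_iff Ints_def)
  then have nz: "sin (of_real pi * of_real t :: complex) \<noteq> 0"
    by (auto simp: sin_pi_mult_eq_0_iff)
  have "(\<lambda>z. P z * of_real (sin (pi * t)) / sin (of_real pi * z)) holomorphic_on ?S"
    by (intro holomorphic_intros holomorphic_on_subset[OF holo]) (auto simp: sin_pi_mult_eq_0_iff)
  from residue_simple[OF op tS this]
  have "residue (\<lambda>z. P z * of_real (sin (pi * t)) / sin (of_real pi * z) / (z - of_real t)) (of_real t)
      = P (of_real t) * of_real (sin (pi * t)) / sin (of_real pi * of_real t)" .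
  also have "\<dots> = P (of_real t)" using nz by (simp flip: sin_of_real)
  finally show ?thesis by (simp add: mult.commute)
qed

text \<open>Integrate \<open>P z sin (\<pi> t) / ((z - t) sin (\<pi> z))\<close> over the circle of radius \<open>R = N + 1/2\<close>: the residue at
  \<open>t\<close> is \<open>P t\<close> and the residues at the integers are the terms of the series with opposite sign. The
  integrand is \<open>O(1 / R\<^sup>2)\<close>, because \<open>P\<close> gains one power of \<open>R\<close> over \<open>sin (\<pi> z)\<close> and \<open>z - t\<close> another.\<close>

lemma cardinal_series:
  fixes P :: "complex \<Rightarrow> complex" and t C R0 :: real
  assumes holo: "P holomorphic_on UNIV" and t: "t \<notin> \<int>"
    and bound: "\<And>z. cmod z \<ge> R0 \<Longrightarrow> cmod (P z) \<le> C * exp (pi * \<bar>Im z\<bar>) / cmod z"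
  shows "(\<lambda>N. \<Sum>k=-int N..int N. P (of_int k) * of_real (cardinal_sine (t - of_int k))) \<longlonglongrightarrow> P (of_real t)"
proof -
  define F where "F = (\<lambda>z. P z * of_real (sin (pi * t)) / ((z - of_real t) * sin (of_real pi * z)))"
  define \<Sigma> where "\<Sigma> N = (\<Sum>k=-int N..int N. P (of_int k) * of_real (cardinal_sine (t - of_int k)))" for N
  have est: "cmod (\<Sigma> N - P (of_real t)) \<le> 8 * \<bar>C\<bar> / (real N + 1/2)"
    if N1: "N \<ge> 1" and N2: "real N \<ge> R0" and N3: "real N \<ge> 2 * \<bar>t\<bar>" for N :: nat
  proof -
    define R where "R = real N + 1 / 2"
    have R: "R > 0" "R \<ge> R0" "R \<ge> 2 * \<bar>t\<bar>" "R < real N + 1" using N1 N2 N3 by (auto simp: R_def)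
    define nodes where "nodes = (of_int ` {-int N..int N} :: complex set)"
    define pts where "pts = insert (of_real t) nodes"
    have norm_pts: "cmod p < R" if p: "p \<in> pts" for p
    proof (cases "p = of_real t")
      case True
      then show ?thesis using R N3 N1 by (simp add: R_def)
    next
      case False
      then obtain k where k: "p = of_int k" "\<bar>k\<bar> \<le> int N" using p by (auto simp: pts_def nodes_def)
      have "cmod p = of_int \<bar>k\<bar>" using k by simp
      also have "\<dots> \<le> of_int (int N)" using k(2) by (simp only: of_int_le_iff)
      finally show ?thesis by (simp add: R_def)
    qed
    have nz: "(z - of_real t) * sin (of_real pi * z) \<noteq> 0" if z: "z \<in> ball 0 (real N + 1) - pts" for z
    proof -
      have "z \<noteq> of_int k" for k
      proof
        assume k: "z = of_int k"
        then have "real_of_int \<bar>k\<bar> < real N + 1" using z by simp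
        then have "\<bar>k\<bar> \<le> int N" by linarith
        then have "k \<in> {-int N..int N}" by auto
        then have "z \<in> pts" by (simp add: pts_def nodes_def k)
        then show False using z by simp
      qed
      then show ?thesis using z by (auto simp: sin_pi_mult_eq_0_iff pts_def)
    qed
    have Fholo: "F holomorphic_on ball 0 (real N + 1) - pts"
      unfolding F_def using nz by (intro holomorphic_intros holomorphic_on_subset[OF holo]) auto
    have fin: "finite pts" by (simp add: pts_def nodes_def)
    have img: "path_image (circlepath 0 R) \<subseteq> ball 0 (real N + 1) - pts"
      using R norm_pts by force
    have "contour_integral (circlepath 0 R) F = 2 * pi * \<i> * (\<Sum>p\<in>pts. winding_number (circlepath 0 R) p * residue F p)"
    proof (rule Residue_theorem[OF _ _ fin Fholo _ _ img])
      show "\<forall>z. z \<notin> ball 0 (real N + 1) \<longrightarrow> winding_number (circlepath 0 R) z = 0"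
      proof (intro allI impI)
        fix z :: complex assume "z \<notin> ball 0 (real N + 1)"
        then show "winding_number (circlepath 0 R) z = 0"
          using R by (intro winding_number_zero_outside[where s = "cball 0 R"]) auto
      qed
    qed auto
    also have "(\<Sum>p\<in>pts. winding_number (circlepath 0 R) p * residue F p) = (\<Sum>p\<in>pts. residue F p)"
      using norm_pts by (intro sum.cong refl) (simp add: winding_number_circlepath)
    also have "\<dots> = residue F (of_real t) + (\<Sum>p\<in>nodes. residue F p)"
      unfolding pts_def
    proof (rule sum.insert)
      show "complex_of_real t \<notin> nodes" using t by (auto simp: nodes_def complex_eq_iff Ints_def)
    qed (simp add: nodes_def)
    also have "(\<Sum>p\<in>nodes. residue F p) = (\<Sum>k=-int N..int N. residue F (of_int k))"
      unfolding nodes_def by (subst sum.reindex) (auto simp: inj_on_def)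
    also have "\<dots> = - \<Sigma> N"
      unfolding F_def residue_cardinal_kernel_node[OF holo t] by (simp add: \<Sigma>_def sum_negf)
    also have "residue F (of_real t) = P (of_real t)"
      unfolding F_def by (rule residue_cardinal_kernel_centre[OF holo t])
    finally have ci: "contour_integral (circlepath 0 R) F = 2 * pi * \<i> * (P (of_real t) - \<Sigma> N)" by simp
    have "F contour_integrable_on circlepath 0 R"
      by (rule contour_integrable_continuous_circlepath)
         (rule holomorphic_on_imp_continuous_on[OF holomorphic_on_subset[OF Fholo img]])
    then have hci: "(F has_contour_integral (2 * pi * \<i> * (P (of_real t) - \<Sigma> N))) (circlepath 0 R)"
      using ci has_contour_integral_integral by fastforce
    have "cmod (2 * pi * \<i> * (P (of_real t) - \<Sigma> N)) \<le> (8 * \<bar>C\<bar> / R\<^sup>2) * (2 * pi * R)"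
    proof (rule has_contour_integral_bound_circlepath[OF hci])
      fix z :: complex assume "cmod (z - 0) = R"
      then have z: "cmod z = R" by simp
      define E where "E = exp (pi * \<bar>Im z\<bar>)"
      have E: "E > 0" by (simp add: E_def)
      have 1: "cmod (P z) \<le> \<bar>C\<bar> * E / R"
      proof -
        have "cmod (P z) \<le> C * E / R" using bound[of z] z R by (simp add: E_def)
        also have "\<dots> \<le> \<bar>C\<bar> * E / R" using E R by (intro divide_right_mono mult_right_mono) auto
        finally show ?thesis .
      qed
      have 2: "cmod (z - of_real t) \<ge> R / 2"
        using norm_triangle_ineq2[of z "of_real t"] z R by simp
      have 3: "cmod (sin (of_real pi * z)) \<ge> E / 4"
        unfolding E_def using z N1 by (intro norm_sin_pi_ge) (auto simp: R_def)
      have "cmod (F z) = cmod (P z) * \<bar>sin (pi * t)\<bar> / (cmod (z - of_real t) * cmod (sin (of_real pi * z)))"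
        by (simp add: F_def norm_mult norm_divide)
      also have "\<dots> \<le> (\<bar>C\<bar> * E / R * 1) / (R / 2 * (E / 4))"
        using 1 2 3 R E by (intro frac_le mult_mono mult_pos_pos) auto
      also have "\<dots> = 8 * \<bar>C\<bar> / R\<^sup>2" using E R by (simp add: power2_eq_square)
      finally show "cmod (F z) \<le> 8 * \<bar>C\<bar> / R\<^sup>2" .
    qed (use R in auto)
    also have "\<dots> = 2 * pi * (8 * \<bar>C\<bar> / R)" using R by (simp add: power2_eq_square)
    finally have "2 * pi * cmod (P (of_real t) - \<Sigma> N) \<le> 2 * pi * (8 * \<bar>C\<bar> / R)"
      by (simp only: norm_mult norm_of_real norm_ii) simp
    then have "cmod (P (of_real t) - \<Sigma> N) \<le> 8 * \<bar>C\<bar> / R"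
      by (simp only: mult_le_cancel_left_pos pi_gt_zero zero_less_mult_iff zero_less_numeral simp_thms)
    then show ?thesis by (simp add: norm_minus_commute R_def)
  qed
  have "(\<lambda>N. \<Sigma> N - P (of_real t)) \<longlonglongrightarrow> 0"
  proof (rule Lim_null_comparison)
    have "eventually (\<lambda>N. N \<ge> 1 \<and> real N \<ge> R0 \<and> real N \<ge> 2 * \<bar>t\<bar>) sequentially"
      by (intro eventually_conj eventually_ge_at_top filterlim_real_sequentially[unfolded filterlim_at_top, rule_format])
    then show "eventually (\<lambda>N. cmod (\<Sigma> N - P (of_real t)) \<le> 8 * \<bar>C\<bar> / (real N + 1/2)) sequentially"
      by eventually_elim (use est in auto)
    show "(\<lambda>N. 8 * \<bar>C\<bar> / (real N + 1/2)) \<longlonglongrightarrow> 0" by real_asymp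
  qed
  then show ?thesis unfolding \<Sigma>_def by (simp add: LIM_zero_iff)
qed

section \<open>Distance between the window and the entire function\<close>

text \<open>A weakening of \<open>min 2 (x\<^sup>2 / 2)\<close> to the power \<open>1/2\<close> of \<open>x\<close>: this power is what makes the weighted sums
  over the lattice converge uniformly in \<open>m\<close> and gives the \<open>\<surd>\<beta>\<close> of the final bound.\<close>

lemma le_sqrt_if_le_two:
  fixes x y :: real
  assumes "0 \<le> x" "y \<le> 2" "y \<le> x\<^sup>2 / 2"
  shows "y \<le> sqrt (2 * x)"
proof (cases "x \<ge> 2")
  case True
  then have "sqrt 4 \<le> sqrt (2 * x)" by (subst real_sqrt_le_iff) simp
  then show ?thesis using assms by simp
next
  case False
  have "x ^ 3 \<le> 2 ^ 3" using False assms by (intro power_mono) auto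
  then have "x ^ 3 * x \<le> 8 * x" using assms(1) by (intro mult_right_mono) auto
  then have "(x\<^sup>2 / 2)\<^sup>2 \<le> 2 * x" by (simp add: power2_eq_square power3_eq_cube)
  then have "x\<^sup>2 / 2 \<le> sqrt (2 * x)" by (rule real_le_rsqrt)
  then show ?thesis using assms by simp
qed

lemma one_minus_cos_le: "1 - cos x \<le> x\<^sup>2 / 2" for x :: real
proof -
  have "\<bar>sin (x / 2)\<bar> \<le> \<bar>x / 2\<bar>" by (rule abs_sin_x_le_abs_x)
  then have "(sin (x / 2))\<^sup>2 \<le> (x / 2)\<^sup>2" by (rule abs_le_square_iff[THEN iffD1])
  moreover have "cos x = 1 - 2 * (sin (x / 2))\<^sup>2" using cos_double_sin[of "x / 2"] by simp
  ultimately show ?thesis by (simp add: power2_eq_square)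
qed

lemma abs_cos_diff_le: "\<bar>cos x - cos y\<bar> \<le> \<bar>x - y\<bar>" for x y :: real
proof -
  have "\<bar>cos x - cos y\<bar> = 2 * \<bar>sin ((x + y) / 2)\<bar> * \<bar>sin ((y - x) / 2)\<bar>"
    by (simp add: cos_diff_cos abs_mult)
  also have "\<dots> \<le> 2 * 1 * \<bar>(y - x) / 2\<bar>"
    by (intro mult_mono abs_sin_x_le_abs_x) auto
  finally show ?thesis by simp
qed

text \<open>Here \<open>(cosh \<beta> - 1) / sinh \<beta> = tanh (\<beta> / 2)\<close>, and the left side is the addition theorem for
  \<open>cosh (\<beta> / 2 - x)\<close> divided by \<open>cosh (\<beta> / 2)\<close>. All exponentially large terms cancel.\<close>

lemma cosh_minus_scaled_sinh:
  fixes \<beta> x :: real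
  assumes "\<beta> > 0"
  shows "cosh x - (cosh \<beta> - 1) * (sinh x / sinh \<beta>) = cosh (\<beta> / 2 - x) / cosh (\<beta> / 2)"
proof -
  define c s where "c = cosh (\<beta> / 2)" and "s = sinh (\<beta> / 2)"
  have c: "c > 0" by (simp add: c_def)
  have s: "s > 0" using assms by (simp add: s_def)
  have "cosh (\<beta> / 2 + \<beta> / 2) = c * c + s * s" by (simp only: cosh_add c_def s_def)
  moreover have "c * c - s * s = 1" unfolding c_def s_def
    using hyperbolic_pythagoras[of "\<beta> / 2"] by (simp add: power2_eq_square)
  ultimately have ch: "cosh \<beta> - 1 = 2 * (s * s)" by simp
  have "sinh (\<beta> / 2 + \<beta> / 2) = s * c + c * s" by (simp only: sinh_add c_def s_def)
  then have sh: "sinh \<beta> = 2 * (s * c)" by simp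
  have cd: "cosh (\<beta> / 2 - x) = c * cosh x - s * sinh x" by (simp add: cosh_diff c_def s_def)
  show ?thesis
    unfolding ch sh cd c_def[symmetric] using c s by (simp add: field_simps)
qed

lemma cosh_shifted_quotient_bounds:
  fixes y x :: real
  assumes "0 \<le> x" "x \<le> 2 * y"
  shows "cosh (y - x) / cosh y \<le> 1" "exp (- x) \<le> cosh (y - x) / cosh y"
proof -
  have "cosh \<bar>y - x\<bar> \<le> cosh y" using assms by (subst cosh_real_nonneg_le_iff) auto
  then show "cosh (y - x) / cosh y \<le> 1" by (simp add: divide_le_eq_1)
  have "exp (- x) * (exp y + exp (- y)) \<le> exp (y - x) + exp (- (y - x))"
    using assms by (simp add: distrib_left flip: exp_add)
  then have "exp (- x) * cosh y \<le> cosh (y - x)" by (simp add: cosh_field_def)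
  then show "exp (- x) \<le> cosh (y - x) / cosh y" by (simp add: pos_le_divide_eq)
qed

lemma cosh_complex_of_real: "cosh (complex_of_real x) = of_real (cosh x)"
  by (simp add: cosh_field_def flip: exp_of_real)

lemma entire_window_inside:
  fixes r \<beta> :: real
  assumes "\<bar>r\<bar> \<le> 1" "\<beta> > 0"
  shows "entire_window \<beta> (of_real r) = of_real (cosh (\<beta> * sqrt (1 - r\<^sup>2)) - cos (\<beta> * r))"
proof -
  have r: "0 \<le> 1 - r\<^sup>2" using assms by (simp add: abs_square_le_1)
  have "(of_real \<beta>)\<^sup>2 - (of_real \<beta> * of_real r)\<^sup>2 = complex_of_real (\<beta>\<^sup>2 * (1 - r\<^sup>2))"
    by (simp add: power_mult_distrib right_diff_distrib)
  also have "csqrt \<dots> = of_real (sqrt (\<beta>\<^sup>2 * (1 - r\<^sup>2)))"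
    using r by (intro of_real_sqrt[symmetric]) simp
  also have "sqrt (\<beta>\<^sup>2 * (1 - r\<^sup>2)) = \<beta> * sqrt (1 - r\<^sup>2)"
    using assms by (simp add: real_sqrt_mult)
  finally have csq: "csqrt ((of_real \<beta>)\<^sup>2 - (of_real \<beta> * of_real r)\<^sup>2) = of_real (\<beta> * sqrt (1 - r\<^sup>2))" .
  have "cos (complex_of_real \<beta> * of_real r) = of_real (cos (\<beta> * r))" by (metis cos_of_real of_real_mult)
  then show ?thesis
    by (simp only: entire_window_def csq cosh_complex_of_real of_real_diff)
qed

lemma entire_window_outside:
  fixes r \<beta> :: real
  assumes "\<bar>r\<bar> \<ge> 1" "\<beta> > 0"
  shows "entire_window \<beta> (of_real r) = of_real (cos (\<beta> * sqrt (r\<^sup>2 - 1)) - cos (\<beta> * r))"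
proof -
  have r: "0 \<le> r\<^sup>2 - 1" using assms by (simp add: abs_le_square_iff[of 1, simplified])
  have "(of_real \<beta>)\<^sup>2 - (of_real \<beta> * of_real r)\<^sup>2 = complex_of_real (- (\<beta>\<^sup>2 * (r\<^sup>2 - 1)))"
    by (simp add: power_mult_distrib algebra_simps)
  also have "csqrt \<dots> = \<i> * of_real (sqrt \<bar>- (\<beta>\<^sup>2 * (r\<^sup>2 - 1))\<bar>)"
    using r by (subst csqrt_of_real_nonpos) (auto simp: mult_nonneg_nonneg)
  also have "\<bar>- (\<beta>\<^sup>2 * (r\<^sup>2 - 1))\<bar> = \<beta>\<^sup>2 * (r\<^sup>2 - 1)"
    using r by (simp add: abs_mult)
  also have "sqrt (\<beta>\<^sup>2 * (r\<^sup>2 - 1)) = \<beta> * sqrt (r\<^sup>2 - 1)"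
    using assms by (simp add: real_sqrt_mult)
  finally have csq: "csqrt ((of_real \<beta>)\<^sup>2 - (of_real \<beta> * of_real r)\<^sup>2) = \<i> * of_real (\<beta> * sqrt (r\<^sup>2 - 1))" .
  have ch: "cosh (\<i> * complex_of_real x) = of_real (cos x)" for x
  proof -
    have "\<i> * (\<i> * complex_of_real x) = - of_real x" by (simp flip: mult.assoc)
    then show ?thesis by (simp add: cosh_conv_cos cos_of_real)
  qed
  have "cos (complex_of_real \<beta> * of_real r) = of_real (cos (\<beta> * r))" by (metis cos_of_real of_real_mult)
  then show ?thesis
    by (simp only: entire_window_def csq ch of_real_diff)
qed

text \<open>Write the left side as \<open>\<bar>q - cos (\<beta> r)\<bar>\<close> with \<open>q\<close> the quotient from \<open>cosh_minus_scaled_sinh\<close>. Both terms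
  are at most \<open>1\<close> in size, and both differ from \<open>1\<close> by at most \<open>(\<beta> r)\<^sup>2 / 2\<close>: for the cosine this is
  standard, for \<open>q\<close> it follows from \<open>q \<ge> e\<^bsup>-\<beta>(1 - S)\<^esup>\<close> with \<open>S = \<surd>(1 - r\<^sup>2)\<close> and \<open>1 - S \<le> r\<^sup>2\<close>.\<close>

lemma window_error_inside:
  fixes r \<beta> :: real
  assumes r: "\<bar>r\<bar> \<le> 1" and \<beta>: "\<beta> \<ge> 2"
  shows "\<bar>cosh (\<beta> * sqrt (1 - r\<^sup>2)) - cos (\<beta> * r)
           - (cosh \<beta> - 1) * (sinh (\<beta> * sqrt (1 - r\<^sup>2)) / sinh \<beta>)\<bar> \<le> sqrt (2 * (\<beta> * \<bar>r\<bar>))"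
proof -
  define S where "S = sqrt (1 - r\<^sup>2)"
  define q where "q = cosh (\<beta> / 2 - \<beta> * S) / cosh (\<beta> / 2)"
  define \<eta> where "\<eta> = \<beta> * (1 - S)"
  have r2: "0 \<le> 1 - r\<^sup>2" "r\<^sup>2 \<ge> 0" using r by (auto simp: abs_square_le_1)
  have S: "0 \<le> S" "S \<le> 1" using r2 by (auto simp: S_def)
  have "S\<^sup>2 = 1 - r\<^sup>2" using r2 by (simp add: S_def)
  moreover have "S * S \<le> S" using S by (simp add: mult_left_le)
  ultimately have S1: "1 - S \<le> r\<^sup>2" by (simp add: power2_eq_square)
  have \<eta>: "0 \<le> \<eta>" "\<eta> \<le> 2 * (\<beta> / 2)" "\<eta> \<le> \<beta> * r\<^sup>2"
    using S S1 \<beta> by (auto simp: \<eta>_def mult_left_le)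
  have q': "q = cosh (\<beta> / 2 - \<eta>) / cosh (\<beta> / 2)"
  proof -
    have "\<beta> / 2 - \<eta> = - (\<beta> / 2 - \<beta> * S)" by (simp add: \<eta>_def algebra_simps)
    then show ?thesis unfolding q_def by (metis cosh_minus)
  qed
  have q1: "q \<le> 1" "exp (- \<eta>) \<le> q"
    unfolding q' using cosh_shifted_quotient_bounds[of \<eta> "\<beta> / 2"] \<eta> by auto
  have "1 - \<beta> * r\<^sup>2 \<le> 1 + (- \<eta>)" using \<eta> by simp
  also have "\<dots> \<le> exp (- \<eta>)" by (rule exp_ge_add_one_self)
  finally have q2: "1 - \<beta> * r\<^sup>2 \<le> q" using q1 by linarith
  have q0: "q \<ge> 0" by (simp add: q_def)
  \<comment> \<open>the hypothesis \<open>\<beta> \<ge> 2\<close> makes the quadratic bound for \<open>q\<close> at least as good as that for the cosine\<close>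
  have "2 * (\<beta> * r\<^sup>2) \<le> \<beta> * (\<beta> * r\<^sup>2)"
    using \<beta> r2 by (intro mult_right_mono) auto
  then have sq: "\<beta> * r\<^sup>2 \<le> (\<beta> * \<bar>r\<bar>)\<^sup>2 / 2" by (simp add: power2_eq_square mult_ac)
  have "\<bar>q - cos (\<beta> * r)\<bar> \<le> sqrt (2 * (\<beta> * \<bar>r\<bar>))"
  proof (rule le_sqrt_if_le_two)
    show "\<bar>q - cos (\<beta> * r)\<bar> \<le> 2"
      using q0 q1 cos_le_one[of "\<beta> * r"] cos_ge_minus_one[of "\<beta> * r"] by linarith
    have "cos (\<beta> * \<bar>r\<bar>) = cos (\<beta> * r)" by (simp add: abs_if)
    then have "1 - cos (\<beta> * r) \<le> (\<beta> * \<bar>r\<bar>)\<^sup>2 / 2"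
      using one_minus_cos_le[of "\<beta> * \<bar>r\<bar>"] by simp
    then show "\<bar>q - cos (\<beta> * r)\<bar> \<le> (\<beta> * \<bar>r\<bar>)\<^sup>2 / 2"
      using q1 q2 sq cos_le_one[of "\<beta> * r"] by linarith
  qed (use \<beta> in auto)
  moreover have "cosh (\<beta> * S) - cos (\<beta> * r) - (cosh \<beta> - 1) * (sinh (\<beta> * S) / sinh \<beta>) = q - cos (\<beta> * r)"
    using cosh_minus_scaled_sinh[of \<beta> "\<beta> * S"] \<beta> unfolding q_def by linarith
  ultimately show ?thesis by (simp add: S_def)
qed

text \<open>The arguments of the two cosines approach each other: \<open>\<rho> - \<surd>(\<rho>\<^sup>2 - 1) \<le> 1 / \<rho>\<close> for \<open>\<rho> = \<bar>r\<bar>\<close>. The difference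
  is thus at most both \<open>2\<close> and \<open>\<beta> / \<rho>\<close>, hence at most the geometric mean.\<close>

lemma window_error_outside:
  fixes r \<beta> :: real
  assumes r: "\<bar>r\<bar> \<ge> 1" and \<beta>: "\<beta> \<ge> 0"
  shows "\<bar>cos (\<beta> * sqrt (r\<^sup>2 - 1)) - cos (\<beta> * r)\<bar> \<le> sqrt (2 * (\<beta> / \<bar>r\<bar>))"
proof -
  define \<rho> where "\<rho> = \<bar>r\<bar>"
  have \<rho>: "\<rho> \<ge> 1" "r\<^sup>2 = \<rho>\<^sup>2" using r by (auto simp: \<rho>_def)
  define T where "T = sqrt (\<rho>\<^sup>2 - 1)"
  have T: "T \<le> \<rho>" unfolding T_def using \<rho> by (intro real_le_lsqrt) auto
  have "1 / \<rho> \<le> 1" using \<rho> by simp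
  then have "(1 / \<rho>)\<^sup>2 \<le> 1" using \<rho> by (intro power_le_one) auto
  then have "(\<rho> - 1 / \<rho>)\<^sup>2 \<le> \<rho>\<^sup>2 - 1"
    using \<rho> by (simp add: power2_diff) 
  then have "\<rho> - 1 / \<rho> \<le> T" unfolding T_def by (rule real_le_rsqrt)
  then have "\<rho> - T \<le> 1 / \<rho>" by simp
  then have "\<beta> * (\<rho> - T) \<le> \<beta> * (1 / \<rho>)" using \<beta> by (rule mult_left_mono)
  then have d: "\<bar>\<beta> * T - \<beta> * \<rho>\<bar> \<le> \<beta> / \<rho>"
    using T \<beta> mult_left_mono[OF T \<beta>] by (simp add: right_diff_distrib)
  define y where "y = \<bar>cos (\<beta> * T) - cos (\<beta> * \<rho>)\<bar>"
  have y: "0 \<le> y" "y \<le> 2" "y \<le> \<beta> / \<rho>"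
    using abs_cos_diff_le[of "\<beta> * T" "\<beta> * \<rho>"] d cos_le_one[of "\<beta> * T"] cos_ge_minus_one[of "\<beta> * T"]
      cos_le_one[of "\<beta> * \<rho>"] cos_ge_minus_one[of "\<beta> * \<rho>"] unfolding y_def by linarith+
  then have "y * y \<le> 2 * (\<beta> / \<rho>)" by (intro mult_mono) auto
  then have "y \<le> sqrt (2 * (\<beta> / \<rho>))" by (intro real_le_rsqrt) (simp add: power2_eq_square)
  moreover have "cos (\<beta> * \<rho>) = cos (\<beta> * r)" by (simp add: \<rho>_def abs_if)
  ultimately show ?thesis by (simp add: y_def T_def \<rho>(2) flip: \<rho>_def)
qed

text \<open>The two regimes \<open>\<bar>t\<bar> \<le> m\<close> and \<open>\<bar>t\<bar> > m\<close> combined; in each of them the minimum picks the square root that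
  the corresponding lemma provides.\<close>

lemma entire_window_minus_sinh_window:
  fixes t \<beta> :: real and m :: nat
  assumes m: "m \<ge> 1" and \<beta>: "\<beta> \<ge> 2" and t: "t \<noteq> 0"
  shows "cmod (entire_window \<beta> (of_real (t / real m)) - of_real ((cosh \<beta> - 1) * sinh_window m \<beta> t))
         \<le> sqrt (2 * \<beta>) * min (sqrt (\<bar>t\<bar> / real m)) (sqrt (real m / \<bar>t\<bar>))"
proof -
  define r where "r = t / real m"
  have ar: "\<bar>r\<bar> = \<bar>t\<bar> / real m" "real m / \<bar>t\<bar> = 1 / \<bar>r\<bar>" using m t by (auto simp: r_def abs_divide)
  have r2: "t\<^sup>2 / (real m)\<^sup>2 = r\<^sup>2" by (simp add: r_def power_divide)
  have r0: "\<bar>r\<bar> > 0" using m t by (simp add: r_def)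
  have in_iff: "t \<in> {- real m..real m} \<longleftrightarrow> \<bar>r\<bar> \<le> 1" using m by (auto simp: ar field_simps abs_le_iff)
  consider "\<bar>r\<bar> \<le> 1" | "\<bar>r\<bar> > 1" by linarith
  then show ?thesis
  proof cases
    case 1
    have "\<bar>r\<bar> * \<bar>r\<bar> \<le> 1" using 1 by (intro mult_le_one) auto
    then have "\<bar>r\<bar> \<le> 1 / \<bar>r\<bar>" using r0 by (simp only: pos_le_divide_eq)
    then have "sqrt \<bar>r\<bar> \<le> sqrt (1 / \<bar>r\<bar>)" by (rule real_sqrt_le_mono)
    then have min: "min (sqrt (\<bar>t\<bar> / real m)) (sqrt (real m / \<bar>t\<bar>)) = sqrt \<bar>r\<bar>" by (simp only: ar min_absorb1 min_absorb2)
    have "sinh_window m \<beta> t = sinh (\<beta> * sqrt (1 - r\<^sup>2)) / sinh \<beta>"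
      using 1 in_iff by (simp add: sinh_window_def r2)
    then have "cmod (entire_window \<beta> (of_real r) - of_real ((cosh \<beta> - 1) * sinh_window m \<beta> t))
       = \<bar>cosh (\<beta> * sqrt (1 - r\<^sup>2)) - cos (\<beta> * r)
           - (cosh \<beta> - 1) * (sinh (\<beta> * sqrt (1 - r\<^sup>2)) / sinh \<beta>)\<bar>"
      using 1 \<beta> by (simp only: entire_window_inside flip: of_real_diff) (simp only: norm_of_real)
    also have "\<dots> \<le> sqrt (2 * (\<beta> * \<bar>r\<bar>))" by (rule window_error_inside[OF 1 \<beta>])
    finally show ?thesis unfolding min r_def[symmetric] by (simp add: real_sqrt_mult)
  next
    case 2
    have "1 * 1 \<le> \<bar>r\<bar> * \<bar>r\<bar>" using 2 by (intro mult_mono) auto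
    then have "1 / \<bar>r\<bar> \<le> \<bar>r\<bar>" using r0 by (simp only: pos_divide_le_eq mult_1)
    then have "sqrt (1 / \<bar>r\<bar>) \<le> sqrt \<bar>r\<bar>" by (rule real_sqrt_le_mono)
    then have min: "min (sqrt (\<bar>t\<bar> / real m)) (sqrt (real m / \<bar>t\<bar>)) = sqrt (1 / \<bar>r\<bar>)" by (simp only: ar min_absorb1 min_absorb2)
    have "sinh_window m \<beta> t = 0"
    proof -
      have "t \<notin> {- real m..real m}" using 2 in_iff by linarith
      then show ?thesis by (simp only: sinh_window_def if_False)
    qed
    moreover have W: "entire_window \<beta> (of_real r) = of_real (cos (\<beta> * sqrt (r\<^sup>2 - 1)) - cos (\<beta> * r))"
      by (rule entire_window_outside) (use 2 \<beta> in auto)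
    ultimately have "cmod (entire_window \<beta> (of_real r) - of_real ((cosh \<beta> - 1) * sinh_window m \<beta> t))
       = \<bar>cos (\<beta> * sqrt (r\<^sup>2 - 1)) - cos (\<beta> * r)\<bar>"
      by (simp only: mult_zero_right of_real_0 diff_zero norm_of_real)
    also have "\<dots> \<le> sqrt (2 * (\<beta> / \<bar>r\<bar>))" using 2 \<beta> by (intro window_error_outside) auto
    also have "\<dots> = sqrt (2 * \<beta>) * sqrt (1 / \<bar>r\<bar>)" by (simp add: real_sqrt_mult real_sqrt_divide)
    finally show ?thesis unfolding min r_def[symmetric] .
  qed
qed

section \<open>Weighted sums of the cardinal sine\<close>

text \<open>An antiderivative of \<open>s \<mapsto> min (\<surd>(s / m)) (\<surd>(m / s)) / s\<close> on the positive half-line, vanishing at \<open>0\<close>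
  and tending to \<open>4\<close>.\<close>

definition decay_sum :: "real \<Rightarrow> real \<Rightarrow> real" where
  "decay_sum m s = (if s \<le> m then 2 * sqrt (s / m) else 4 - 2 * sqrt (m / s))"

lemma decay_sum_lower_branch:
  fixes a b m :: real
  assumes "0 < m" "0 < a" "a \<le> b"
  shows "(b - a) * (1 / sqrt (m * b)) \<le> 2 * sqrt (b / m) - 2 * sqrt (a / m)"
proof -
  define A B Q where "A = sqrt a" and "B = sqrt b" and "Q = sqrt m"
  have pos: "A > 0" "B > 0" "Q > 0" "A \<le> B" using assms by (auto simp: A_def B_def Q_def)
  have ab: "a = A * A" "b = B * B" using assms by (auto simp: A_def B_def)
  have "(B * B - A * A) * (1 / (Q * B)) = (B - A) * (B + A) / (Q * B)"
    by (simp add: square_diff_square_factored mult.commute)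
  also have "\<dots> \<le> (B - A) * (2 * B) / (Q * B)"
    using pos by (intro divide_right_mono mult_left_mono) auto
  also have "\<dots> = 2 * (B / Q) - 2 * (A / Q)" using pos by (simp add: field_simps)
  finally have "(B * B - A * A) * (1 / (Q * B)) \<le> 2 * (B / Q) - 2 * (A / Q)" .
  then show ?thesis
    by (simp add: real_sqrt_mult real_sqrt_divide flip: ab A_def B_def Q_def)
qed

lemma decay_sum_upper_branch:
  fixes a b m :: real
  assumes "0 < m" "0 < a" "a \<le> b"
  shows "(b - a) * (sqrt m / (b * sqrt b)) \<le> 2 * sqrt (m / a) - 2 * sqrt (m / b)"
proof -
  define A B Q where "A = sqrt a" and "B = sqrt b" and "Q = sqrt m"
  have pos: "A > 0" "B > 0" "Q > 0" "A \<le> B" using assms by (auto simp: A_def B_def Q_def)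
  have ab: "a = A * A" "b = B * B" using assms by (auto simp: A_def B_def)
  have "A * A \<le> B * B" "A * B \<le> B * B" using pos by (auto intro: mult_mono)
  then have "(A + B) * A \<le> 2 * (B * B)" by (simp add: algebra_simps)
  then have "(A + B) * A / (A * B * (B * B)) \<le> 2 * (B * B) / (A * B * (B * B))"
    using pos by (intro divide_right_mono) auto
  then have 1: "(A + B) / (B * B * B) \<le> 2 / (A * B)"
    using pos by (simp add: mult_ac)
  have "(B * B - A * A) * (Q / (B * B * B)) = (B - A) * Q * ((A + B) / (B * B * B))" 
    by (simp add: square_diff_square_factored mult_ac)
  also have "\<dots> \<le> (B - A) * Q * (2 / (A * B))"
    using pos by (intro mult_left_mono 1) auto
  also have "\<dots> = 2 * (Q / A) - 2 * (Q / B)" using pos by (simp add: field_simps)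
  finally have "(B * B - A * A) * (Q / (B * B * B)) \<le> 2 * (Q / A) - 2 * (Q / B)" .
  then show ?thesis
    by (simp add: real_sqrt_divide flip: ab A_def B_def Q_def)
qed

text \<open>The left side is the value at \<open>a + 1\<close> of the decreasing function \<open>u\<close>, and \<^const>\<open>decay_sum\<close> is an
  antiderivative of \<open>u\<close>, so this is the comparison of a sum with an integral, done algebraically.
  When the unit step crosses \<open>m\<close>, both branches are applied to their part of the step.\<close>

lemma decay_sum_step:
  fixes a m :: real
  assumes m: "0 < m" and a: "0 < a"
  shows "min (sqrt ((a + 1) / m)) (sqrt (m / (a + 1))) / (a + 1) \<le> decay_sum m (a + 1) - decay_sum m a"
proof -
  define b where "b = a + 1"
  have b: "b > 0" "a \<le> b" "b - a = 1" using a by (auto simp: b_def)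
  define u where "u = min (sqrt (b / m)) (sqrt (m / b)) / b"
  have u0: "u \<ge> 0" using b m by (simp add: u_def)
  have u1: "u \<le> 1 / sqrt (m * b)"
  proof -
    have "u \<le> sqrt (b / m) / b" using b by (simp add: u_def divide_right_mono)
    also have "\<dots> = sqrt b / (sqrt b * sqrt b) / sqrt m" using b(1) by (simp add: real_sqrt_divide)
    also have "\<dots> = 1 / (sqrt b * sqrt m)" using b(1) m by (simp del: real_sqrt_mult_self)
    also have "\<dots> = 1 / sqrt (m * b)" by (simp add: real_sqrt_mult mult.commute)
    finally show ?thesis .
  qed
  have u2: "u \<le> sqrt m / (b * sqrt b)"
  proof -
    have "u \<le> sqrt (m / b) / b" using b by (simp add: u_def divide_right_mono)
    also have "\<dots> = sqrt m / (b * sqrt b)" using b(1) by (simp add: real_sqrt_divide mult.commute)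
    finally show ?thesis .
  qed
  have "u \<le> decay_sum m b - decay_sum m a"
  proof -
    \<comment> \<open>the branches of the antiderivative change at \<open>m\<close>\<close>
    consider "b \<le> m" | "m < a" | "a \<le> m" "m < b" by linarith
    then show ?thesis
    proof cases
      case 1
      then show ?thesis using decay_sum_lower_branch[OF m a b(2)] u1 b by (simp add: decay_sum_def)
    next
      case 2
      then show ?thesis using decay_sum_upper_branch[OF m a b(2)] u2 b by (simp add: decay_sum_def)
    next
      case 3
      have u3: "u \<le> 1 / sqrt (m * m)"
      proof -
        have "sqrt (m * m) \<le> sqrt (m * b)" using 3 m by (intro real_sqrt_le_mono mult_left_mono) auto
        then have "1 / sqrt (m * b) \<le> 1 / sqrt (m * m)" using b(1) m by (intro divide_left_mono) simp_all
        then show ?thesis using u1 by linarith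
      qed
      have "(m - a) * u \<le> (m - a) * (1 / sqrt (m * m))" using 3 u3 by (intro mult_left_mono) auto
      also have "\<dots> \<le> 2 * sqrt (m / m) - 2 * sqrt (a / m)"
        using decay_sum_lower_branch[OF m a, of m] 3 by simp
      finally have p1: "(m - a) * u \<le> 2 - 2 * sqrt (a / m)" using m by simp
      have "(b - m) * u \<le> (b - m) * (sqrt m / (b * sqrt b))" using 3 u2 by (intro mult_left_mono) auto
      also have "\<dots> \<le> 2 * sqrt (m / m) - 2 * sqrt (m / b)"
        using decay_sum_upper_branch[OF m m, of b] 3 by simp
      finally have p2: "(b - m) * u \<le> 2 - 2 * sqrt (m / b)" using m by simp
      have "u = (b - a) * u" using b by simp
      also have "\<dots> = (m - a) * u + (b - m) * u" by (simp add: algebra_simps)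
      finally show ?thesis using p1 p2 3 by (simp add: decay_sum_def)
    qed
  qed
  then show ?thesis by (simp add: u_def b_def)
qed

lemma decay_sum_le_4:
  assumes "0 < m" "0 < s"
  shows "decay_sum m s \<le> 4"
proof (cases "s \<le> m")
  case True
  then have "s / m \<le> 1" using assms by simp
  then have "sqrt (s / m) \<le> sqrt 1" by (rule real_sqrt_le_mono)
  then have "sqrt (s / m) \<le> 2" using real_sqrt_one by linarith
  then show ?thesis using True by (simp add: decay_sum_def)
qed (use assms in \<open>simp add: decay_sum_def\<close>)

text \<open>The cardinal sine with the weight that bounds the distance between the window and its entire
  substitute.\<close>

definition weighted_sinc :: "real \<Rightarrow> real \<Rightarrow> real" where
  "weighted_sinc m s = \<bar>cardinal_sine s\<bar> * min (sqrt (\<bar>s\<bar> / m)) (sqrt (m / \<bar>s\<bar>))"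

lemma weighted_sinc_minus: "weighted_sinc m (- s) = weighted_sinc m s"
  by (simp add: weighted_sinc_def cardinal_sine_def)

lemma weighted_sinc_nonneg: "m > 0 \<Longrightarrow> weighted_sinc m s \<ge> 0"
  by (simp add: weighted_sinc_def)

lemma abs_cardinal_sine_le_1: "\<bar>cardinal_sine s\<bar> \<le> 1"
  using abs_sin_x_le_abs_x[of "pi * s"] by (simp add: cardinal_sine_def abs_mult divide_le_eq_1)

lemma abs_cardinal_sine_le: "s > 0 \<Longrightarrow> \<bar>cardinal_sine s\<bar> \<le> 1 / (pi * s)"
  using abs_sin_le_one[of "pi * s"] by (simp add: cardinal_sine_def abs_mult divide_right_mono)

text \<open>The term nearest to the origin is bounded with \<open>\<bar>sinc\<bar> \<le> 1\<close>, the others with \<open>\<bar>sinc s\<bar> \<le> 1 / (\<pi> s)\<close> and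
  telescoping. The part of the total mass \<open>4\<close> below \<open>s\<close> is kept, since it compensates the first
  term; without it the final constant would exceed \<open>9\<close>.\<close>

lemma sum_weighted_sinc_one_side:
  fixes m s :: real
  assumes m: "m \<ge> 1" and s: "0 < s" "s < 1"
  shows "(\<Sum>j<Suc n. weighted_sinc m (s + real j)) \<le> 4 / pi + (1 - 2 / pi) * sqrt (s / m)"
proof -
  have step: "weighted_sinc m (s + real (Suc j)) \<le> (decay_sum m (s + real (Suc j)) - decay_sum m (s + real j)) / pi" for j
  proof -
    define a where "a = s + real j"
    have a: "a > 0" using s by (simp add: a_def)
    have sj: "s + real (Suc j) = a + 1" by (simp add: a_def)
    have "weighted_sinc m (a + 1) \<le> 1 / (pi * (a + 1)) * min (sqrt ((a + 1) / m)) (sqrt (m / (a + 1)))"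
      unfolding weighted_sinc_def using a m
      by (intro mult_mono[OF abs_cardinal_sine_le]) auto
    also have "\<dots> = (min (sqrt ((a + 1) / m)) (sqrt (m / (a + 1))) / (a + 1)) / pi" by simp
    also have "\<dots> \<le> (decay_sum m (a + 1) - decay_sum m a) / pi"
      using m a by (intro divide_right_mono decay_sum_step) auto
    finally show ?thesis unfolding sj by (simp add: a_def)
  qed
  have "(\<Sum>j<n. weighted_sinc m (s + real (Suc j))) \<le> (\<Sum>j<n. (decay_sum m (s + real (Suc j)) - decay_sum m (s + real j)) / pi)"
    by (intro sum_mono step)
  also have "\<dots> = (decay_sum m (s + real n) - decay_sum m s) / pi"
    unfolding sum_divide_distrib[symmetric] by (subst sum_lessThan_telescope) simp
  also have "\<dots> \<le> (4 - 2 * sqrt (s / m)) / pi"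
    using decay_sum_le_4[of m "s + real n"] m s by (intro divide_right_mono) (auto simp: decay_sum_def)
  finally have tail: "(\<Sum>j<n. weighted_sinc m (s + real (Suc j))) \<le> (4 - 2 * sqrt (s / m)) / pi" .
  have head: "weighted_sinc m s \<le> 1 * sqrt (s / m)"
    unfolding weighted_sinc_def using s m by (intro mult_mono abs_cardinal_sine_le_1) auto
  have "(\<Sum>j<Suc n. weighted_sinc m (s + real j)) = weighted_sinc m s + (\<Sum>j<n. weighted_sinc m (s + real (Suc j)))"
    by (subst sum.lessThan_Suc_shift) simp
  also have "\<dots> \<le> sqrt (s / m) + (4 - 2 * sqrt (s / m)) / pi" using head tail by simp
  also have "\<dots> = 4 / pi + (1 - 2 / pi) * sqrt (s / m)" by (simp add: field_simps)
  finally show ?thesis .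
qed

text \<open>The lattice points to the left and to the right of \<open>t\<close> have distances \<open>s + j\<close> and \<open>(1 - s) + j\<close> with
  \<open>s\<close> the fractional part. The two boundary terms satisfy \<open>\<surd>s + \<surd>(1 - s) \<le> \<surd>2 \<le> \<surd>m\<close>.\<close>

lemma sum_weighted_sinc:
  fixes m t :: real and A :: "int set"
  assumes m: "m \<ge> 2" and t: "t \<notin> \<int>" and A: "finite A"
  shows "(\<Sum>k\<in>A. weighted_sinc m (t - of_int k)) \<le> 1 + 6 / pi"
proof -
  define k0 s where "k0 = \<lfloor>t\<rfloor>" and "s = t - of_int k0"
  have s: "0 < s" "s < 1"
    using t of_int_floor_le[of t] floor_correct[of t] unfolding s_def k0_def
    by (metis Ints_of_int diff_gt_0_iff_gt order_less_le, linarith)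
  obtain n where n: "\<And>k. k \<in> A \<Longrightarrow> \<bar>k - k0\<bar> \<le> int n"
  proof -
    define n where "n = nat (Max (insert 0 ((\<lambda>k. \<bar>k - k0\<bar>) ` A)))"
    have "\<bar>k - k0\<bar> \<le> int n" if "k \<in> A" for k
    proof -
      have "\<bar>k - k0\<bar> \<le> Max (insert 0 ((\<lambda>k. \<bar>k - k0\<bar>) ` A))" using that A by (intro Max_ge) auto
      moreover have "0 \<le> Max (insert 0 ((\<lambda>k. \<bar>k - k0\<bar>) ` A))" using A by (intro Max_ge) auto
      ultimately show ?thesis by (simp add: n_def)
    qed
    then show thesis by (rule that)
  qed
  let ?L = "(\<lambda>j. k0 - int j) ` {..<Suc n}" and ?R = "(\<lambda>j. k0 + 1 + int j) ` {..<Suc n}"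
  have sub: "A \<subseteq> ?L \<union> ?R"
  proof
    fix k assume k: "k \<in> A"
    show "k \<in> ?L \<union> ?R"
    proof (cases "k \<le> k0")
      case True
      then have "k = k0 - int (nat (k0 - k))" "nat (k0 - k) \<in> {..<Suc n}" using n[OF k] by auto
      then show ?thesis by (intro UnI1 image_eqI)
    next
      case False
      then have "k = k0 + 1 + int (nat (k - k0 - 1))" "nat (k - k0 - 1) \<in> {..<Suc n}" using n[OF k] by auto
      then show ?thesis by (intro UnI2 image_eqI)
    qed
  qed
  have "(\<Sum>k\<in>A. weighted_sinc m (t - of_int k)) \<le> (\<Sum>k\<in>?L \<union> ?R. weighted_sinc m (t - of_int k))"
    using m by (intro sum_mono2 sub) (auto simp: weighted_sinc_nonneg)
  also have "\<dots> = (\<Sum>k\<in>?L. weighted_sinc m (t - of_int k)) + (\<Sum>k\<in>?R. weighted_sinc m (t - of_int k))"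
    by (rule sum.union_disjoint) auto
  also have "(\<Sum>k\<in>?L. weighted_sinc m (t - of_int k)) = (\<Sum>j<Suc n. weighted_sinc m (s + real j))"
    by (subst sum.reindex) (auto simp: inj_on_def s_def algebra_simps simp del: sum.lessThan_Suc)
  also have "(\<Sum>k\<in>?R. weighted_sinc m (t - of_int k)) = (\<Sum>j<Suc n. weighted_sinc m ((1 - s) + real j))"
  proof -
    have "weighted_sinc m (t - of_int (k0 + 1 + int j)) = weighted_sinc m ((1 - s) + real j)" for j
    proof -
      have "(1 - s) + real j = - (t - of_int (k0 + 1 + int j))" by (simp add: s_def)
      then show ?thesis by (simp only: weighted_sinc_minus)
    qed
    then show ?thesis by (subst sum.reindex) (auto simp: inj_on_def simp del: sum.lessThan_Suc)
  qed
  also have "(\<Sum>j<Suc n. weighted_sinc m (s + real j)) + (\<Sum>j<Suc n. weighted_sinc m ((1 - s) + real j))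
      \<le> (4 / pi + (1 - 2 / pi) * sqrt (s / m)) + (4 / pi + (1 - 2 / pi) * sqrt ((1 - s) / m))"
    using m s by (intro add_mono sum_weighted_sinc_one_side) auto
  also have "\<dots> = 8 / pi + (1 - 2 / pi) * ((sqrt s + sqrt (1 - s)) / sqrt m)"
    by (simp add: real_sqrt_divide algebra_simps add_divide_distrib)
  also have "\<dots> \<le> 8 / pi + (1 - 2 / pi) * 1"
  proof -
    have "(sqrt s + sqrt (1 - s))\<^sup>2 \<le> 2 * ((sqrt s)\<^sup>2 + (sqrt (1 - s))\<^sup>2)"
      using zero_le_power2[of "sqrt s - sqrt (1 - s)"] by (simp add: power2_eq_square algebra_simps)
    also have "\<dots> \<le> (sqrt m)\<^sup>2" using s m by simp
    finally have "sqrt s + sqrt (1 - s) \<le> sqrt m" by (rule power2_le_imp_le) (use m in simp)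
    then have "(sqrt s + sqrt (1 - s)) / sqrt m \<le> 1" using m by simp
    then show ?thesis using pi_gt3 by (intro add_left_mono mult_left_mono) (auto simp: field_simps)
  qed
  also have "\<dots> = 1 + 6 / pi" by (simp add: field_simps)
  finally show ?thesis .
qed

text \<open>The inequality is tight to about one part in a thousand at \<open>\<beta> = \<pi>\<close>, where the left side is
  \<open>8.99 \<surd>\<beta> e\<^bsup>-\<beta>\<^esup>\<close>; hence the care with \<open>e\<^bsup>\<pi>\<^esup> \<ge> 23\<close>, \<open>\<surd>2 \<le> 1.41422\<close> and \<open>\<pi> \<ge> 3.1415\<close>.\<close>

lemma error_constant_le:
  fixes \<beta> :: real
  assumes "\<beta> \<ge> pi"
  shows "sqrt (2 * \<beta>) * (1 + 6 / pi) / (cosh \<beta> - 1) \<le> 9 * sqrt \<beta> * exp (- \<beta>)"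
proof -
  have \<beta>0: "\<beta> \<ge> 0" using assms pi_gt_zero by linarith
  have "exp (1::real) \<ge> 5837465777 / 2147483648 - inverse (2 ^ 32)"
    using e_approx_32 by linarith
  then have e1: "exp 1 \<ge> (2.718 :: real)" by (rule order_trans[rotated]) simp
  have "(2.718::real) ^ 3 * (1 + 0.14 + 0.14\<^sup>2 / 2) \<le> exp 1 ^ 3 * exp 0.14"
    using e1 exp_lower_Taylor_quadratic[of "0.14::real"] by (intro mult_mono power_mono) auto
  also have "\<dots> = exp (3.14 :: real)" by (simp flip: exp_of_nat_mult exp_add)
  also have "\<dots> \<le> exp \<beta>" using assms pi_approx by simp
  finally have E: "exp \<beta> \<ge> 23" by (simp add: power2_eq_square power3_eq_cube)
  define \<epsilon> where "\<epsilon> = exp (- \<beta>)"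
  have "1 / exp \<beta> \<le> 1 / 23" using E by (intro divide_left_mono) auto
  then have \<epsilon>: "0 < \<epsilon>" "\<epsilon> \<le> 1 / 23" by (simp_all add: \<epsilon>_def exp_minus inverse_eq_divide)
  have "cosh \<beta> = (1 / \<epsilon> + \<epsilon>) / 2"
  proof -
    have "1 / \<epsilon> = exp \<beta>" by (simp add: \<epsilon>_def exp_minus inverse_eq_divide)
    then show ?thesis by (simp only:) (simp add: \<epsilon>_def cosh_field_def)
  qed
  moreover have "(1 / \<epsilon> + \<epsilon>) / 2 - 1 = (1 - \<epsilon>)\<^sup>2 / (2 * \<epsilon>)"
    using \<epsilon>(1) by (simp add: power2_eq_square field_simps)
  ultimately have "cosh \<beta> - 1 = (1 - \<epsilon>)\<^sup>2 / (2 * \<epsilon>)" by (simp only:)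
  moreover have "(1 - 1 / 23)\<^sup>2 \<le> (1 - \<epsilon>)\<^sup>2" using \<epsilon> by (intro power_mono) auto
  then have "0.9149 / (2 * \<epsilon>) \<le> (1 - \<epsilon>)\<^sup>2 / (2 * \<epsilon>)"
    using \<epsilon> by (intro divide_right_mono) (auto simp: power2_eq_square)
  ultimately have C: "0.9149 / (2 * \<epsilon>) \<le> cosh \<beta> - 1" by simp
  have "sqrt 2 \<le> 1.41422" by (rule real_le_lsqrt) (auto simp: power2_eq_square)
  moreover have "6 / pi \<le> 6 / 3.1415" using pi_approx by (intro divide_left_mono) auto
  ultimately have "sqrt 2 * (1 + 6 / pi) \<le> 1.41422 * (1 + 6 / 3.1415)"
    by (intro mult_mono) auto
  also have "\<dots> \<le> 4.1155" by simp
  finally have "sqrt 2 * (1 + 6 / pi) * sqrt \<beta> \<le> 4.1155 * sqrt \<beta>"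
    using \<beta>0 by (intro mult_right_mono) auto
  then have "sqrt (2 * \<beta>) * (1 + 6 / pi) \<le> 4.1155 * sqrt \<beta>" by (simp add: real_sqrt_mult mult_ac)
  then have "sqrt (2 * \<beta>) * (1 + 6 / pi) / (cosh \<beta> - 1) \<le> 4.1155 * sqrt \<beta> / (0.9149 / (2 * \<epsilon>))"
    using C \<epsilon> \<beta>0 by (intro frac_le) auto
  also have "\<dots> \<le> 9 * sqrt \<beta> * \<epsilon>"
  proof -
    have "4.1155 * sqrt \<beta> / (0.9149 / (2 * \<epsilon>)) = 8.231 / 0.9149 * (sqrt \<beta> * \<epsilon>)" by simp
    also have "\<dots> \<le> 9 * (sqrt \<beta> * \<epsilon>)"
      using \<epsilon> \<beta>0 by (intro mult_right_mono) auto
    finally show ?thesis by simp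
  qed
  finally show ?thesis by (simp add: \<epsilon>_def)
qed

section \<open>Localized sampling of exponentials\<close>

lemma entire_window_0: "entire_window \<beta> 0 = of_real (cosh \<beta> - 1)" if "\<beta> > 0"
  using entire_window_inside[of 0 \<beta>] that by simp

text \<open>At an integer \<open>t\<close> the formula interpolates and the error is zero. Otherwise the cardinal series of
  \<open>P z = e\<^bsup>i\<omega>z\<^esup> W ((t - z) / m) / (cosh \<beta> - 1)\<close> converges to \<open>P t = e\<^bsup>i\<omega>t\<^esup>\<close>, and subtracting the localized
  sum from its partial sums leaves the weighted sums bounded above. The frequency band is used
  exactly here: \<open>\<delta> + \<beta> / m = \<pi>\<close>.\<close>

lemma exponential_localized_sampling_error:
  fixes m :: nat and \<delta> \<beta> \<omega> t :: real
  assumes m: "m \<ge> 2" and \<delta>: "\<bar>\<omega>\<bar> \<le> \<delta>" and \<beta>: "\<beta> = real m * (pi - \<delta>)" "\<beta> \<ge> pi"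
    and A: "finite A" "\<And>k. \<bar>t - of_int k\<bar> \<le> real m \<Longrightarrow> k \<in> A"
  shows "cmod (exp (\<i> * of_real \<omega> * of_real t)
           - (\<Sum>k\<in>A. exp (\<i> * of_real \<omega> * of_int k) *
                of_real (cardinal_sine (t - of_int k) * sinh_window m \<beta> (t - of_int k))))
         \<le> 9 * sqrt \<beta> * exp (- \<beta>)"
proof (cases "t \<in> \<int>")
  case True
  then obtain j where j: "t = of_int j" by (auto elim: Ints_cases)
  have jA: "j \<in> A" using A(2)[of j] j by simp
  have s0: "cardinal_sine (t - of_int k) = 0" if "k \<noteq> j" for k
    using that sin_npi_int[of "j - k"] by (simp add: cardinal_sine_def j mult.commute)
  have "\<beta> > 0" using \<beta>(2) pi_gt_zero by linarith
  then have "sinh \<beta> > 0" and \<beta>0: "\<beta> \<ge> 0" by simp_all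
  then have w0: "sinh_window m \<beta> 0 = 1" by (simp add: sinh_window_def)
  have "(\<Sum>k\<in>A. exp (\<i> * of_real \<omega> * of_int k) *
                of_real (cardinal_sine (t - of_int k) * sinh_window m \<beta> (t - of_int k)))
     = (\<Sum>k\<in>A. if k = j then exp (\<i> * of_real \<omega> * of_real t) else 0)"
    using s0 w0 by (intro sum.cong) (auto simp: j cardinal_sine_def)
  also have "\<dots> = exp (\<i> * of_real \<omega> * of_real t)" using A(1) jA by simp
  finally show ?thesis using \<beta>0 by simp
next
  case t: False
  define K where "K = cosh \<beta> - 1"
  have \<beta>0: "\<beta> > 0" "\<beta> \<ge> 2" using \<beta>(2) pi_gt3 by auto
  have K: "K > 0" using \<beta>0 cosh_real_strict_mono[of 0 \<beta>] by (simp add: K_def)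
  have m0: "real m > 0" "m \<ge> 1" using m by auto
  define P where "P = (\<lambda>z. exp (\<i> * of_real \<omega> * z) * entire_window \<beta> ((of_real t - z) / of_nat m) / of_real K)"
  have "(entire_window \<beta> \<circ> (\<lambda>z. (of_real t - z) / of_nat m)) holomorphic_on UNIV"
    by (rule holomorphic_on_compose_gen[OF _ entire_window_holomorphic])
       (use m in \<open>auto intro!: holomorphic_intros\<close>)
  then have holo: "P holomorphic_on UNIV"
    unfolding P_def using K by (auto intro!: holomorphic_intros simp: o_def)
  have bound: "cmod (P z) \<le> (2 * real m * \<beta> * exp \<beta> / K) * exp (pi * \<bar>Im z\<bar>) / cmod z"
    if z: "cmod z \<ge> 2 * \<bar>t\<bar> + 2 * real m" for z
  proof -
    define r where "r = (of_real t - z) / of_nat m"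
    have z0: "cmod z > 0" using z m0 by linarith
    have dist: "cmod z / 2 \<le> cmod (of_real t - z)"
      using norm_triangle_ineq3[of "of_real t" z] z by simp
    have nr: "cmod r = cmod (of_real t - z) / real m" by (simp add: r_def norm_divide)
    have nr1: "cmod r \<ge> cmod z / (2 * real m)" unfolding nr using dist m0 by (simp add: field_simps)
    have "cmod z / (2 * real m) \<ge> 1" using z m0 by (simp add: field_simps)
    then have nr2: "cmod r \<ge> 1" using nr1 by linarith
    have "Im r = - (Im z / real m)"
      by (simp add: r_def complex_eq_iff Im_divide_of_nat)
    then have Im: "\<beta> * \<bar>Im r\<bar> = (pi - \<delta>) * \<bar>Im z\<bar>" using m0 by (simp add: \<beta>(1) abs_divide)
    have e: "cmod (exp (\<i> * of_real \<omega> * z)) \<le> exp (\<delta> * \<bar>Im z\<bar>)"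
    proof -
      have "- (\<omega> * Im z) \<le> \<bar>\<omega>\<bar> * \<bar>Im z\<bar>" by (metis abs_ge_minus_self abs_mult)
      also have "\<dots> \<le> \<delta> * \<bar>Im z\<bar>" using \<delta> by (intro mult_right_mono) auto
      finally show ?thesis by simp
    qed
    have w: "cmod (entire_window \<beta> r) \<le> \<beta> * exp \<beta> * exp ((pi - \<delta>) * \<bar>Im z\<bar>) / (cmod z / (2 * real m))"
    proof -
      have "cmod (entire_window \<beta> r) \<le> \<beta> * exp \<beta> * exp ((pi - \<delta>) * \<bar>Im z\<bar>) / cmod r"
        using norm_entire_window_le[OF \<beta>0(1) nr2] by (simp only: Im)
      also have "\<dots> \<le> \<beta> * exp \<beta> * exp ((pi - \<delta>) * \<bar>Im z\<bar>) / (cmod z / (2 * real m))"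
        using nr1 nr2 z0 m0 \<beta>0 by (intro divide_left_mono mult_pos_pos divide_pos_pos mult_nonneg_nonneg) auto
      finally show ?thesis .
    qed
    have "cmod (P z) = cmod (exp (\<i> * of_real \<omega> * z)) * cmod (entire_window \<beta> r) / K"
      using K by (simp add: P_def r_def norm_mult norm_divide del: norm_exp_eq_Re)
    also have "\<dots> \<le> exp (\<delta> * \<bar>Im z\<bar>) * (\<beta> * exp \<beta> * exp ((pi - \<delta>) * \<bar>Im z\<bar>) / (cmod z / (2 * real m))) / K"
      using K by (intro divide_right_mono mult_mono e w) auto
    also have "\<dots> = (2 * real m * \<beta> * exp \<beta> / K) * (exp (\<delta> * \<bar>Im z\<bar>) * exp ((pi - \<delta>) * \<bar>Im z\<bar>)) / cmod z"
      by (simp add: mult_ac)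
    also have "exp (\<delta> * \<bar>Im z\<bar>) * exp ((pi - \<delta>) * \<bar>Im z\<bar>) = exp (pi * \<bar>Im z\<bar>)"
      by (simp add: algebra_simps flip: exp_add)
    finally show ?thesis .
  qed
  let ?\<phi> = "\<lambda>k. sinh_window m \<beta> (t - of_int k)"
  let ?e = "\<lambda>k::int. exp (\<i> * of_real \<omega> * of_int k) :: complex"
  define S where "S = (\<Sum>k\<in>A. ?e k * of_real (cardinal_sine (t - of_int k) * ?\<phi> k))"
  have lim: "(\<lambda>N. (\<Sum>k=-int N..int N. P (of_int k) * of_real (cardinal_sine (t - of_int k))) - S)
      \<longlonglongrightarrow> P (of_real t) - S"
    by (intro tendsto_diff cardinal_series[OF holo t bound] tendsto_const)
  have Pt: "P (of_real t) = exp (\<i> * of_real \<omega> * of_real t)"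
    using K \<beta>0 by (simp add: P_def entire_window_0 K_def)
  obtain N0 where N0: "\<And>k. k \<in> A \<Longrightarrow> \<bar>k\<bar> \<le> int N0"
  proof -
    have "\<bar>k\<bar> \<le> int (nat (\<Sum>k\<in>A. \<bar>k\<bar>))" if "k \<in> A" for k
      using member_le_sum[OF that, of abs] A(1) by simp
    then show thesis by (rule that)
  qed
  have "cmod ((\<Sum>k=-int N..int N. P (of_int k) * of_real (cardinal_sine (t - of_int k))) - S)
      \<le> 9 * sqrt \<beta> * exp (- \<beta>)" if N: "N \<ge> N0" for N
  proof -
    let ?I = "{-int N..int N}"
    have "S = (\<Sum>k\<in>?I. ?e k * of_real (cardinal_sine (t - of_int k) * ?\<phi> k))"
      unfolding S_def
    proof (rule sum.mono_neutral_left)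
      show "A \<subseteq> ?I" using N0 N by force
      show "\<forall>k\<in>?I - A. ?e k * of_real (cardinal_sine (t - of_int k) * ?\<phi> k) = 0"
      proof
        fix k assume "k \<in> ?I - A"
        then have "\<not> \<bar>t - of_int k\<bar> \<le> real m" using A(2) by blast
        then have "t - of_int k \<notin> {- real m..real m}" by auto
        then have "?\<phi> k = 0" by (simp only: sinh_window_def if_False)
        then show "?e k * of_real (cardinal_sine (t - of_int k) * ?\<phi> k) = 0" by simp
      qed
    qed simp
    then have "(\<Sum>k\<in>?I. P (of_int k) * of_real (cardinal_sine (t - of_int k))) - S
       = (\<Sum>k\<in>?I. P (of_int k) * of_real (cardinal_sine (t - of_int k)) -
            ?e k * of_real (cardinal_sine (t - of_int k) * ?\<phi> k))"
      by (simp add: sum_subtractf)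
    also have "cmod \<dots> \<le> (\<Sum>k\<in>?I. sqrt (2 * \<beta>) / K * weighted_sinc (real m) (t - of_int k))"
    proof (rule sum_norm_le)
      fix k assume "k \<in> ?I"
      define x where "x = t - of_int k"
      have x: "x \<noteq> 0" using t by (auto simp: x_def)
      have arg: "(of_real t - of_int k) / of_nat m = complex_of_real (x / real m)"
        by (simp add: x_def)
      have "P (of_int k) * of_real (cardinal_sine x) - ?e k * of_real (cardinal_sine x * sinh_window m \<beta> x)
         = ?e k * of_real (cardinal_sine x) * 
           (entire_window \<beta> (of_real (x / real m)) - of_real (K * sinh_window m \<beta> x)) / of_real K"
        using K unfolding P_def arg by (simp add: field_simps)
      also have "cmod \<dots> = \<bar>cardinal_sine x\<bar> *
           cmod (entire_window \<beta> (of_real (x / real m)) - of_real (K * sinh_window m \<beta> x)) / K"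
        using K by (simp add: norm_mult norm_divide)
      also have "\<dots> \<le> \<bar>cardinal_sine x\<bar> *
           (sqrt (2 * \<beta>) * min (sqrt (\<bar>x\<bar> / real m)) (sqrt (real m / \<bar>x\<bar>))) / K"
        unfolding K_def using K entire_window_minus_sinh_window[OF m0(2) \<beta>0(2) x]
        by (intro divide_right_mono mult_left_mono) (auto simp: K_def)
      also have "\<dots> = sqrt (2 * \<beta>) / K * weighted_sinc (real m) x"
        by (simp add: weighted_sinc_def)
      finally show "cmod (P (of_int k) * of_real (cardinal_sine (t - of_int k)) -
            ?e k * of_real (cardinal_sine (t - of_int k) * ?\<phi> k))
          \<le> sqrt (2 * \<beta>) / K * weighted_sinc (real m) (t - of_int k)"
        unfolding x_def .
    qed
    also have "\<dots> = sqrt (2 * \<beta>) / K * (\<Sum>k\<in>?I. weighted_sinc (real m) (t - of_int k))"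
      by (simp add: sum_distrib_left)
    also have "\<dots> \<le> sqrt (2 * \<beta>) / K * (1 + 6 / pi)"
      using K \<beta>0 m t by (intro mult_left_mono sum_weighted_sinc) auto
    also have "\<dots> = sqrt (2 * \<beta>) * (1 + 6 / pi) / (cosh \<beta> - 1)" by (simp add: K_def)
    also have "\<dots> \<le> 9 * sqrt \<beta> * exp (- \<beta>)" by (rule error_constant_le[OF \<beta>(2)])
    finally show ?thesis .
  qed
  then have "cmod (P (of_real t) - S) \<le> 9 * sqrt \<beta> * exp (- \<beta>)"
    by (intro Lim_bounded[OF tendsto_norm[OF lim], of N0]) auto
  then show ?thesis by (simp only: Pt S_def)
qed

section \<open>Square-integrable functions and Gaussians\<close>

lemma L2_measurable: "f \<in> L2 \<Longrightarrow> f \<in> borel_measurable borel"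
  by (simp add: L2_def)

lemma L2_square_integrable: "f \<in> L2 \<Longrightarrow> integrable lborel (\<lambda>t. (cmod (f t))\<^sup>2)"
  by (simp add: L2_def)

lemma L2_norm_nonneg: "0 \<le> L2_norm f"
  by (simp add: L2_norm_def)

lemma L2_norm_squared: "(L2_norm f)\<^sup>2 = (LINT t|lborel. (cmod (f t))\<^sup>2)"
  by (simp add: L2_norm_def)

lemma two_mult_le_sum_squares: "2 * (a * b) \<le> a\<^sup>2 + b\<^sup>2" for a b :: real
  using zero_le_power2[of "a - b"] by (simp add: power2_diff)

lemma L2_mult_integrable:
  assumes f: "f \<in> L2" and g: "g \<in> L2"
  shows "integrable lborel (\<lambda>t. f t * g t)"
proof (rule Bochner_Integration.integrable_bound)
  show "integrable lborel (\<lambda>t. (cmod (f t))\<^sup>2 + (cmod (g t))\<^sup>2)"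
    by (intro Bochner_Integration.integrable_add L2_square_integrable f g)
  show "(\<lambda>t. f t * g t) \<in> borel_measurable lborel"
    using L2_measurable[OF f] L2_measurable[OF g] by simp
  show "AE t in lborel. norm (f t * g t) \<le> norm ((cmod (f t))\<^sup>2 + (cmod (g t))\<^sup>2)"
  proof (intro AE_I2)
    fix t
    have "cmod (f t) * cmod (g t) \<le> 2 * (cmod (f t) * cmod (g t))" by simp
    then have "cmod (f t) * cmod (g t) \<le> (cmod (f t))\<^sup>2 + (cmod (g t))\<^sup>2"
      using two_mult_le_sum_squares[of "cmod (f t)" "cmod (g t)"] by linarith
    then show "norm (f t * g t) \<le> norm ((cmod (f t))\<^sup>2 + (cmod (g t))\<^sup>2)"
      by (simp add: norm_mult)
  qed
qed

lemma L2_norm_mult_integrable: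
  assumes "f \<in> L2" "g \<in> L2"
  shows "integrable lborel (\<lambda>t. cmod (f t) * cmod (g t))"
  using integrable_norm[OF L2_mult_integrable[OF assms]] by (simp add: norm_mult)

lemma L2_diff:
  assumes f: "f \<in> L2" and g: "g \<in> L2"
  shows "(\<lambda>t. f t - g t) \<in> L2"
proof -
  have m: "(\<lambda>t. f t - g t) \<in> borel_measurable borel"
    using L2_measurable[OF f] L2_measurable[OF g] by simp
  have "integrable lborel (\<lambda>t. (cmod (f t - g t))\<^sup>2)"
  proof (rule Bochner_Integration.integrable_bound)
    show "integrable lborel (\<lambda>t. 2 * (cmod (f t))\<^sup>2 + 2 * (cmod (g t))\<^sup>2)"
      by (intro Bochner_Integration.integrable_add integrable_mult_right L2_square_integrable f g)
    show "AE t in lborel. norm ((cmod (f t - g t))\<^sup>2) \<le> norm (2 * (cmod (f t))\<^sup>2 + 2 * (cmod (g t))\<^sup>2)"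
    proof (intro AE_I2)
      fix t
      have "(cmod (f t - g t))\<^sup>2 \<le> (cmod (f t) + cmod (g t))\<^sup>2"
        by (intro power_mono norm_triangle_ineq4) simp
      also have "\<dots> \<le> 2 * (cmod (f t))\<^sup>2 + 2 * (cmod (g t))\<^sup>2"
        using two_mult_le_sum_squares[of "cmod (f t)" "cmod (g t)"] by (simp add: power2_sum)
      finally show "norm ((cmod (f t - g t))\<^sup>2) \<le> norm (2 * (cmod (f t))\<^sup>2 + 2 * (cmod (g t))\<^sup>2)"
        by simp
    qed
  qed (use m in simp)
  then show ?thesis using m by (simp add: L2_def)
qed

text \<open>The quadratic polynomial \<open>s \<mapsto> \<integral> (\<bar>f\<bar> - s \<bar>g\<bar>)\<^sup>2\<close> is nonnegative, so its discriminant is not positive.\<close>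

lemma L2_cauchy_schwarz:
  assumes f: "f \<in> L2" and g: "g \<in> L2"
  shows "(LINT t|lborel. cmod (f t) * cmod (g t)) \<le> L2_norm f * L2_norm g"
proof -
  define a b i where "a = (LINT t|lborel. (cmod (f t))\<^sup>2)" and "b = (LINT t|lborel. (cmod (g t))\<^sup>2)"
    and "i = (LINT t|lborel. cmod (f t) * cmod (g t))"
  have quad: "0 \<le> a - 2 * s * i + s\<^sup>2 * b" for s
  proof -
    have "0 \<le> (LINT t|lborel. (cmod (f t) - s * cmod (g t))\<^sup>2)" by simp
    also have "\<dots> = (LINT t|lborel. (cmod (f t))\<^sup>2 - 2 * s * (cmod (f t) * cmod (g t)) + s\<^sup>2 * (cmod (g t))\<^sup>2)"
      by (intro Bochner_Integration.integral_cong) (auto simp: power2_diff power_mult_distrib)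
    also have "\<dots> = a - 2 * s * i + s\<^sup>2 * b"
      unfolding a_def b_def i_def
      using L2_square_integrable[OF f] L2_square_integrable[OF g] L2_norm_mult_integrable[OF f g] by simp
    finally show ?thesis .
  qed
  have a0: "a \<ge> 0" and b0: "b \<ge> 0" and i0: "i \<ge> 0" by (simp_all add: a_def b_def i_def)
  have "i\<^sup>2 \<le> a * b"
  proof (cases "b = 0")
    case True
    have "i = 0"
    proof (rule ccontr)
      assume "i \<noteq> 0"
      then have "0 \<le> a - 2 * ((a + 1) / i) * i" using quad[of "(a + 1) / i"] True by simp
      also have "\<dots> = a - 2 * (a + 1)" using \<open>i \<noteq> 0\<close> by simp
      finally show False using a0 by simp
    qed
    then show ?thesis using True by simp
  next
    case False
    then have "b > 0" using b0 by simp
    have "0 \<le> (a - 2 * (i / b) * i + (i / b)\<^sup>2 * b) * b"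
      using quad[of "i / b"] b0 by (rule mult_nonneg_nonneg)
    also have "\<dots> = a * b - i\<^sup>2" using \<open>b > 0\<close> by (simp add: power2_eq_square field_simps)
    finally show ?thesis by simp
  qed
  then have "i \<le> sqrt (a * b)" by (rule real_le_rsqrt)
  then show ?thesis by (simp add: i_def a_def b_def L2_norm_def real_sqrt_mult)
qed

lemma L2_norm_triangle:
  assumes f: "f \<in> L2" and g: "g \<in> L2"
  shows "L2_norm f \<le> L2_norm g + L2_norm (\<lambda>t. f t - g t)"
proof (rule power2_le_imp_le)
  let ?d = "\<lambda>t. f t - g t"
  have d: "?d \<in> L2" by (rule L2_diff[OF f g])
  have "(L2_norm f)\<^sup>2 \<le> (LINT t|lborel. (cmod (g t))\<^sup>2 + 2 * (cmod (g t) * cmod (?d t)) + (cmod (?d t))\<^sup>2)"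
    unfolding L2_norm_squared
  proof (rule integral_mono)
    show "integrable lborel (\<lambda>t. (cmod (g t))\<^sup>2 + 2 * (cmod (g t) * cmod (?d t)) + (cmod (?d t))\<^sup>2)"
      by (intro Bochner_Integration.integrable_add integrable_mult_right L2_square_integrable
          L2_norm_mult_integrable g d)
    fix t
    have "cmod (f t) \<le> cmod (g t) + cmod (?d t)" using norm_triangle_ineq[of "g t" "?d t"] by simp
    then have "(cmod (f t))\<^sup>2 \<le> (cmod (g t) + cmod (?d t))\<^sup>2" by (intro power_mono) auto
    then show "(cmod (f t))\<^sup>2 \<le> (cmod (g t))\<^sup>2 + 2 * (cmod (g t) * cmod (?d t)) + (cmod (?d t))\<^sup>2"
      by (simp add: power2_sum)
  qed (rule L2_square_integrable[OF f])
  also have "\<dots> = (L2_norm g)\<^sup>2 + 2 * (LINT t|lborel. cmod (g t) * cmod (?d t)) + (L2_norm ?d)\<^sup>2"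
    unfolding L2_norm_squared
    using L2_square_integrable[OF g] L2_square_integrable[OF d] L2_norm_mult_integrable[OF g d] by simp
  also have "\<dots> \<le> (L2_norm g)\<^sup>2 + 2 * (L2_norm g * L2_norm ?d) + (L2_norm ?d)\<^sup>2"
    using L2_cauchy_schwarz[OF g d] by simp
  also have "\<dots> = (L2_norm g + L2_norm ?d)\<^sup>2" by (simp add: power2_sum)
  finally show "(L2_norm f)\<^sup>2 \<le> (L2_norm g + L2_norm ?d)\<^sup>2" .
qed (simp add: L2_norm_nonneg)

lemma L2_norm_minus_commute: "L2_norm (\<lambda>t. f t - g t) = L2_norm (\<lambda>t. g t - f t)"
  by (simp add: L2_norm_def norm_minus_commute)

lemma L2_converges_norm:
  assumes "L2_converges h f"
  shows "(\<lambda>n. L2_norm (h n)) \<longlonglongrightarrow> L2_norm f"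
proof -
  have h: "h n \<in> L2" and f: "f \<in> L2" and l: "(\<lambda>n. L2_norm (\<lambda>t. h n t - f t)) \<longlonglongrightarrow> 0" for n
    using assms by (auto simp: L2_converges_def)
  have "(\<lambda>n. L2_norm (h n) - L2_norm f) \<longlonglongrightarrow> 0"
  proof (rule Lim_null_comparison[OF _ l], intro always_eventually allI)
    fix n
    show "norm (L2_norm (h n) - L2_norm f) \<le> L2_norm (\<lambda>t. h n t - f t)"
      using L2_norm_triangle[OF h[of n] f] L2_norm_triangle[OF f h[of n]]
        L2_norm_minus_commute[of f "h n"] by (simp add: abs_le_iff)
  qed
  then show ?thesis by (simp add: LIM_zero_iff)
qed

lemma L2_converges_pairing:
  assumes "L2_converges h f" and u: "u \<in> L2"
  shows "(\<lambda>n. LINT t|lborel. h n t * u t) \<longlonglongrightarrow> (LINT t|lborel. f t * u t)"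
proof -
  have h: "h n \<in> L2" and f: "f \<in> L2" and l: "(\<lambda>n. L2_norm (\<lambda>t. h n t - f t)) \<longlonglongrightarrow> 0" for n
    using assms by (auto simp: L2_converges_def)
  have "(\<lambda>n. (LINT t|lborel. h n t * u t) - (LINT t|lborel. f t * u t)) \<longlonglongrightarrow> 0"
  proof (rule Lim_null_comparison, intro always_eventually allI)
    fix n
    have d: "(\<lambda>t. h n t - f t) \<in> L2" by (rule L2_diff[OF h f])
    have "(LINT t|lborel. h n t * u t) - (LINT t|lborel. f t * u t) = (LINT t|lborel. (h n t - f t) * u t)"
      using L2_mult_integrable[OF h u] L2_mult_integrable[OF f u] by (simp add: left_diff_distrib)
    also have "cmod \<dots> \<le> (LINT t|lborel. cmod ((h n t - f t) * u t))"
      by (rule integral_norm_bound)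
    also have "\<dots> \<le> L2_norm (\<lambda>t. h n t - f t) * L2_norm u"
      using L2_cauchy_schwarz[OF d u] by (simp add: norm_mult)
    finally show "norm ((LINT t|lborel. h n t * u t) - (LINT t|lborel. f t * u t))
        \<le> L2_norm (\<lambda>t. h n t - f t) * L2_norm u" .
    show "(\<lambda>n. L2_norm (\<lambda>t. h n t - f t) * L2_norm u) \<longlonglongrightarrow> 0"
      using tendsto_mult_right[OF l, of "L2_norm u"] by simp
  qed
  then show ?thesis by (simp add: LIM_zero_iff)
qed

text \<open>Fubini. The formula moves the transform from one factor to the other, and both sides pass to
  \<open>L\<^sup>2\<close> limits in \<open>h\<close>; this gives access to the transform of an \<open>L\<^sup>2\<close> function.\<close>

lemma fourier_multiplication_formula:
  assumes h: "integrable lborel h" and u: "integrable lborel u"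
  shows "(LINT \<omega>|lborel. fourier h \<omega> * u \<omega>) = (LINT x|lborel. h x * fourier u x)"
proof -
  let ?c = "complex_of_real (1 / sqrt (2 * pi))"
  let ?E = "\<lambda>t \<omega>. exp (- \<i> * complex_of_real t * complex_of_real \<omega>)"
  let ?F = "\<lambda>x \<omega>. h x * u \<omega> * ?E x \<omega>"
  have mh [measurable]: "h \<in> borel_measurable borel" and mu [measurable]: "u \<in> borel_measurable borel"
    using borel_measurable_integrable[OF h] borel_measurable_integrable[OF u] by auto
  have mE [measurable]: "(\<lambda>p. ?E (fst p) (snd p)) \<in> borel_measurable (lborel \<Otimes>\<^sub>M lborel)"
    by (intro borel_measurable_continuous_on[where f = exp] continuous_intros) measurable
  have nE: "cmod (?E x \<omega>) = 1" for x \<omega> by simp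
  have "integrable (lborel \<Otimes>\<^sub>M lborel) (\<lambda>p. ?F (fst p) (snd p))"
  proof (rule lborel_pair.Fubini_integrable)
    show "(\<lambda>p. ?F (fst p) (snd p)) \<in> borel_measurable (lborel \<Otimes>\<^sub>M lborel)" by measurable
    have "integrable lborel (\<lambda>x. cmod (h x) * (LINT \<omega>|lborel. cmod (u \<omega>)))"
      using h by simp
    then show "integrable lborel (\<lambda>x. LINT y|lborel. norm (?F (fst (x, y)) (snd (x, y))))"
      by (simp add: norm_mult)
    have "integrable lborel (\<lambda>\<omega>. ?F x \<omega>)" for x
    proof (rule Bochner_Integration.integrable_bound)
      show "integrable lborel (\<lambda>\<omega>. h x * u \<omega>)" using u by simp
      show "AE \<omega> in lborel. norm (?F x \<omega>) \<le> norm (h x * u \<omega>)" by (simp add: norm_mult)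
    qed measurable
    then show "AE x in lborel. integrable lborel (\<lambda>y. ?F (fst (x, y)) (snd (x, y)))" by simp
  qed
  then have int: "integrable (lborel \<Otimes>\<^sub>M lborel) (case_prod ?F)" by (simp add: case_prod_beta')
  have "(LINT \<omega>|lborel. fourier h \<omega> * u \<omega>) = (LINT \<omega>|lborel. ?c * (LINT x|lborel. ?F x \<omega>))"
  proof (intro Bochner_Integration.integral_cong refl)
    fix \<omega>
    have "(LINT x|lborel. ?F x \<omega>) = (LINT x|lborel. h x * ?E x \<omega> * u \<omega>)"
      by (simp add: mult_ac)
    also have "\<dots> = (LINT x|lborel. h x * ?E x \<omega>) * u \<omega>" by (rule integral_mult_left_zero)
    finally show "fourier h \<omega> * u \<omega> = ?c * (LINT x|lborel. ?F x \<omega>)" by (simp add: fourier_def)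
  qed
  also have "\<dots> = ?c * (LINT \<omega>|lborel. (LINT x|lborel. ?F x \<omega>))" by (rule integral_mult_right_zero)
  also have "(LINT \<omega>|lborel. (LINT x|lborel. ?F x \<omega>)) = (LINT x|lborel. (LINT \<omega>|lborel. ?F x \<omega>))"
    by (rule lborel_pair.Fubini_integral[OF int])
  also have "?c * \<dots> = (LINT x|lborel. ?c * (LINT \<omega>|lborel. ?F x \<omega>))" by (rule integral_mult_right_zero[symmetric])
  also have "\<dots> = (LINT x|lborel. h x * fourier u x)"
  proof (intro Bochner_Integration.integral_cong refl)
    fix x
    have "(LINT \<omega>|lborel. ?F x \<omega>) = (LINT \<omega>|lborel. h x * (u \<omega> * ?E \<omega> x))"
      by (simp add: mult_ac)
    also have "\<dots> = h x * (LINT \<omega>|lborel. u \<omega> * ?E \<omega> x)" by (rule integral_mult_right_zero)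
    finally show "?c * (LINT \<omega>|lborel. ?F x \<omega>) = h x * fourier u x" by (simp add: fourier_def)
  qed
  finally show ?thesis .
qed

text \<open>Test functions for the transform: integrable, square-integrable, and with explicit transform.\<close>

definition modulated_gaussian :: "real \<Rightarrow> real \<Rightarrow> real \<Rightarrow> complex" where
  "modulated_gaussian \<sigma> t \<omega> = exp (\<i> * complex_of_real (t * \<omega>)) * of_real (exp (- (\<sigma> * \<omega>)\<^sup>2 / 2))"

lemma norm_modulated_gaussian: "cmod (modulated_gaussian \<sigma> t \<omega>) = exp (- (\<sigma> * \<omega>)\<^sup>2 / 2)"
  by (simp add: modulated_gaussian_def norm_mult flip: of_real_mult)

lemma modulated_gaussian_measurable [measurable]: "modulated_gaussian \<sigma> t \<in> borel_measurable borel"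
  unfolding modulated_gaussian_def[abs_def]
  by (intro borel_measurable_continuous_onI continuous_intros) auto

lemma gaussian_integrable:
  fixes \<sigma> :: real
  assumes "\<sigma> > 0"
  shows "integrable lborel (\<lambda>\<omega>. exp (- (\<sigma> * \<omega>)\<^sup>2 / 2))"
proof -
  have "integrable lborel (\<lambda>\<omega>. normal_density 0 (1 / \<sigma>) \<omega> * (sqrt (2 * pi * (1 / \<sigma>)\<^sup>2)))"
    by (intro integrable_mult_left) (use assms in auto)
  also have "(\<lambda>\<omega>. normal_density 0 (1 / \<sigma>) \<omega> * (sqrt (2 * pi * (1 / \<sigma>)\<^sup>2))) = (\<lambda>\<omega>. exp (- (\<sigma> * \<omega>)\<^sup>2 / 2))"
    using assms by (auto simp: normal_density_def power_mult_distrib power_divide)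
  finally show ?thesis .
qed

lemma modulated_gaussian_integrable:
  assumes "\<sigma> > 0" shows "integrable lborel (modulated_gaussian \<sigma> t)"
  by (rule Bochner_Integration.integrable_bound[OF gaussian_integrable[OF assms]])
     (simp_all add: norm_modulated_gaussian)

lemma modulated_gaussian_L2:
  assumes "\<sigma> > 0" shows "modulated_gaussian \<sigma> t \<in> L2"
proof -
  have "(\<lambda>\<omega>. (cmod (modulated_gaussian \<sigma> t \<omega>))\<^sup>2) = (\<lambda>\<omega>. exp (- ((sqrt 2 * \<sigma>) * \<omega>)\<^sup>2 / 2))"
    unfolding norm_modulated_gaussian
    by (rule ext) (simp add: power_mult_distrib flip: exp_double)
  then show ?thesis using gaussian_integrable[of "sqrt 2 * \<sigma>"] assms by (simp add: L2_def)
qed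

text \<open>The characteristic function of the standard normal distribution after the substitution
  \<open>y = \<sigma> \<omega>\<close>. Pairing with a modulated Gaussian on the frequency side is thus averaging around \<open>t\<close> on
  the time side.\<close>

lemma fourier_modulated_gaussian:
  assumes \<sigma>: "\<sigma> > 0"
  shows "fourier (modulated_gaussian \<sigma> t) x = of_real (sqrt (2 * pi) * normal_density t \<sigma> x)"
proof -
  define s where "s = (t - x) / \<sigma>"
  have "of_real (exp (- s\<^sup>2 / 2)) = char std_normal_distribution s"
    by (simp add: char_std_normal_distribution)
  also have "\<dots> = (LINT y|lborel. std_normal_density y *\<^sub>R iexp (s * y))"
    unfolding char_def by (subst integral_density) auto
  also have "\<dots> = \<bar>\<sigma>\<bar> *\<^sub>R (LINT \<omega>|lborel. std_normal_density (0 + \<sigma> * \<omega>) *\<^sub>R iexp (s * (0 + \<sigma> * \<omega>)))"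
    by (rule lborel_integral_real_affine) (use \<sigma> in simp)
  also have "(LINT \<omega>|lborel. std_normal_density (0 + \<sigma> * \<omega>) *\<^sub>R iexp (s * (0 + \<sigma> * \<omega>)))
      = (LINT \<omega>|lborel. of_real (1 / sqrt (2 * pi)) *
          (modulated_gaussian \<sigma> t \<omega> * exp (- \<i> * complex_of_real \<omega> * complex_of_real x)))"
  proof (intro Bochner_Integration.integral_cong refl)
    fix \<omega>
    have s\<sigma>: "s * \<sigma> = t - x" using \<sigma> by (simp add: s_def)
    have "s * (0 + \<sigma> * \<omega>) = (s * \<sigma>) * \<omega>" by simp
    also have "\<dots> = t * \<omega> - \<omega> * x" by (simp add: s\<sigma> left_diff_distrib)
    finally have "s * (0 + \<sigma> * \<omega>) = t * \<omega> - \<omega> * x" .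
    then have "complex_of_real (s * (0 + \<sigma> * \<omega>)) = of_real (t * \<omega>) - of_real \<omega> * of_real x"
      by (simp only: of_real_diff of_real_mult)
    then have "\<i> * complex_of_real (s * (0 + \<sigma> * \<omega>)) = \<i> * of_real (t * \<omega>) + (- \<i> * of_real \<omega> * of_real x)"
      by (simp only:) (simp add: right_diff_distrib)
    then have "iexp (s * (0 + \<sigma> * \<omega>)) = exp (\<i> * complex_of_real (t * \<omega>)) * exp (- \<i> * complex_of_real \<omega> * complex_of_real x)"
      by (simp only: exp_add)
    then show "std_normal_density (0 + \<sigma> * \<omega>) *\<^sub>R iexp (s * (0 + \<sigma> * \<omega>)) = of_real (1 / sqrt (2 * pi)) *
          (modulated_gaussian \<sigma> t \<omega> * exp (- \<i> * complex_of_real \<omega> * complex_of_real x))"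
      by (simp add: std_normal_density_def modulated_gaussian_def scaleR_conv_of_real)
  qed
  also have "\<dots> = fourier (modulated_gaussian \<sigma> t) x"
    unfolding fourier_def by (rule integral_mult_right_zero)
  finally have eq: "of_real (exp (- s\<^sup>2 / 2)) = \<bar>\<sigma>\<bar> *\<^sub>R fourier (modulated_gaussian \<sigma> t) x" .
  have "s\<^sup>2 / 2 = (x - t)\<^sup>2 / (2 * \<sigma>\<^sup>2)" by (simp add: s_def power_divide power2_commute)
  then have "exp (- s\<^sup>2 / 2) = exp (- (x - t)\<^sup>2 / (2 * \<sigma>\<^sup>2))" by simp
  also have "\<dots> = \<sigma> * (sqrt (2 * pi) * normal_density t \<sigma> x)"
    using \<sigma> by (simp add: normal_density_def real_sqrt_mult)
  finally have "of_real \<sigma> * complex_of_real (sqrt (2 * pi) * normal_density t \<sigma> x) =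
      of_real \<sigma> * fourier (modulated_gaussian \<sigma> t) x"
    using eq \<sigma> by (simp add: scaleR_conv_of_real)
  then show ?thesis using \<sigma> by simp
qed

section \<open>Fourier inversion and the norm inequality\<close>

text \<open>The first bound is an integrable majorant that is the same for all \<open>n\<close>, the second tends to
  zero: at distance at least one from the centre the density decreases as it concentrates. The
  elementary inequality behind the first is \<open>n \<le> e\<^bsup>n - 1\<^esup> \<le> e\<^bsup>(n\<^sup>2 - 1) / 2\<^esup>\<close>.\<close>

lemma normal_density_le_far:
  assumes n: "n \<ge> (1::real)" and d: "\<bar>x - t\<bar> \<ge> 1"
  shows "normal_density t (1 / n) x \<le> exp (- (x - t)\<^sup>2 / 2)"
    and "normal_density t (1 / n) x \<le> n * exp (- n\<^sup>2 / 2)"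
proof -
  define q where "q = (x - t)\<^sup>2"
  have q: "q \<ge> 1" using d abs_le_square_iff[of 1 "x - t"] by (simp add: q_def)
  have n2: "n\<^sup>2 \<ge> 1" using n by simp
  have eq: "normal_density t (1 / n) x = n / sqrt (2 * pi) * exp (- (n\<^sup>2 * q) / 2)"
    using n by (simp add: normal_density_def q_def power_divide real_sqrt_divide real_sqrt_mult)
  have "1 \<le> 2 * pi" using pi_gt3 by linarith
  then have "1 \<le> sqrt (2 * pi)" by simp
  then have "n / sqrt (2 * pi) \<le> n / 1" using n by (intro divide_left_mono) auto
  then have le: "n / sqrt (2 * pi) * exp (- (n\<^sup>2 * q) / 2) \<le> n * exp (- (n\<^sup>2 * q) / 2)"
    by (intro mult_right_mono) auto
  have "n \<le> exp (n - 1)" using exp_ge_add_one_self[of "n - 1"] by simp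
  also have "\<dots> \<le> exp ((n\<^sup>2 - 1) * q / 2)"
  proof -
    have "2 * (n - 1) \<le> (n + 1) * (n - 1)" using n by (intro mult_right_mono) auto
    also have "\<dots> = (n\<^sup>2 - 1) * 1" by (simp add: power2_eq_square algebra_simps)
    also have "\<dots> \<le> (n\<^sup>2 - 1) * q" using q n2 by (intro mult_left_mono) auto
    finally show ?thesis by simp
  qed
  finally have "n * exp (- (n\<^sup>2 * q) / 2) \<le> exp ((n\<^sup>2 - 1) * q / 2) * exp (- (n\<^sup>2 * q) / 2)"
    by (intro mult_right_mono) auto
  also have "\<dots> = exp (- q / 2)"
  proof -
    have "(n\<^sup>2 - 1) * q / 2 + - (n\<^sup>2 * q) / 2 = - q / 2" by (simp add: algebra_simps diff_divide_distrib)
    then show ?thesis by (simp only: exp_add[symmetric])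
  qed
  finally show "normal_density t (1 / n) x \<le> exp (- (x - t)\<^sup>2 / 2)" using le eq by (simp add: q_def)
  have "exp (- (n\<^sup>2 * q) / 2) \<le> exp (- n\<^sup>2 / 2)" using q n2 by (simp add: mult_le_cancel_left1)
  then have "n * exp (- (n\<^sup>2 * q) / 2) \<le> n * exp (- n\<^sup>2 / 2)" using n by (intro mult_left_mono) auto
  then show "normal_density t (1 / n) x \<le> n * exp (- n\<^sup>2 / 2)" using le eq by linarith
qed

text \<open>The function may be unbounded far away, so the integral is split. On \<open>[t - 1, t + 1]\<close> the function is
  bounded and rescaling to the standard normal density allows dominated convergence; outside, the
  majorant of \<open>normal_density_le_far\<close> times \<open>\<bar>f\<bar>\<close> is integrable by Cauchy--Schwarz.\<close>

lemma normal_density_approximate_identity: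
  fixes f :: "real \<Rightarrow> complex"
  assumes f: "f \<in> L2" and cont: "continuous_on UNIV f"
  shows "(\<lambda>N. LINT x|lborel. f x * of_real (normal_density t (1 / real (Suc N)) x)) \<longlonglongrightarrow> f t"
proof -
  let ?I = "{t - 1..t + 1}"
  let ?w = "\<lambda>N x. normal_density t (1 / real (Suc N)) x"
  have mf [measurable]: "f \<in> borel_measurable borel" by (rule L2_measurable[OF f])
  obtain C where C: "\<And>x. x \<in> ?I \<Longrightarrow> cmod (f x) \<le> C" and C0: "C \<ge> 0"
  proof -
    have "bounded (f ` ?I)"
      by (intro compact_imp_bounded compact_continuous_image continuous_on_subset[OF cont]) auto
    then obtain C where C: "C > 0" "\<And>y. y \<in> f ` ?I \<Longrightarrow> norm y \<le> C" using bounded_pos by metis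
    show thesis by (rule that[of C]) (use C in auto)
  qed
  have far_dom: "integrable lborel (\<lambda>x. cmod (f x) * cmod (modulated_gaussian 1 0 (x - t)))"
  proof (rule L2_norm_mult_integrable[OF f])
    have "integrable lborel (\<lambda>x. (cmod (modulated_gaussian 1 0 (-t + 1 * x)))\<^sup>2)"
      using lborel_integrable_real_affine[OF L2_square_integrable[OF modulated_gaussian_L2[of 1 0]], of 1 "- t"]
      by simp
    then show "(\<lambda>x. modulated_gaussian 1 0 (x - t)) \<in> L2" by (simp add: L2_def)
  qed
  have far_bd: "cmod (indicator (-?I) x * (f x * of_real (?w N x))) \<le> cmod (f x) * cmod (modulated_gaussian 1 0 (x - t))"
    for N x
  proof (cases "x \<in> ?I")
    case False
    then have "\<bar>x - t\<bar> \<ge> 1" by auto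
    then have "?w N x \<le> exp (- (x - t)\<^sup>2 / 2)"
      by (intro normal_density_le_far(1)) auto
    then show ?thesis
      by (auto simp: norm_mult norm_modulated_gaussian indicator_def intro!: mult_left_mono)
  qed auto
  have far_lim: "(\<lambda>N. indicator (-?I) x * (f x * of_real (?w N x))) \<longlonglongrightarrow> 0" for x
  proof (cases "x \<in> ?I")
    case False
    then have d: "\<bar>x - t\<bar> \<ge> 1" by auto
    have "(\<lambda>N. ?w N x) \<longlonglongrightarrow> 0"
    proof (rule Lim_null_comparison, intro always_eventually allI)
      fix N
      show "norm (?w N x) \<le> real (Suc N) * exp (- (real (Suc N))\<^sup>2 / 2)"
        using normal_density_le_far(2)[OF _ d, of "real (Suc N)"] by simp
      show "(\<lambda>N. real (Suc N) * exp (- (real (Suc N))\<^sup>2 / 2)) \<longlonglongrightarrow> 0" by real_asymp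
    qed
    then have "(\<lambda>N. indicator (-?I) x * (f x * of_real (?w N x))) \<longlonglongrightarrow> indicator (-?I) x * (f x * of_real 0)"
      by (intro tendsto_intros)
    then show ?thesis by simp
  qed auto
  have far: "(\<lambda>N. LINT x|lborel. indicator (-?I) x * (f x * of_real (?w N x))) \<longlonglongrightarrow> (LINT x|(lborel :: real measure). (0::complex))"
    by (rule integral_dominated_convergence[OF _ _ far_dom]) (use far_lim far_bd in auto)
  have far_int: "integrable lborel (\<lambda>x. indicator (-?I) x * (f x * of_real (?w N x)))" for N
    by (rule Bochner_Integration.integrable_bound[OF far_dom]) (use far_bd[of _ N] in auto)
  have near_int: "integrable lborel (\<lambda>x. indicator ?I x * (f x * of_real (?w N x)))" for N
  proof (rule Bochner_Integration.integrable_bound)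
    show "integrable lborel (\<lambda>x. C * ?w N x)" by simp
    show "AE x in lborel. norm (indicator ?I x * (f x * of_real (?w N x))) \<le> norm (C * ?w N x)"
      using C C0 by (intro AE_I2) (auto simp: indicator_def norm_mult abs_mult intro!: mult_right_mono)
  qed measurable
  let ?g = "\<lambda>N y. indicator ?I (t + 1 / real (Suc N) * y) * (f (t + 1 / real (Suc N) * y) * of_real (std_normal_density y)) :: complex"
  have near_eq: "(LINT x|lborel. indicator ?I x * (f x * of_real (?w N x))) = (LINT y|lborel. ?g N y)" for N
  proof -
    have "(LINT x|lborel. indicator ?I x * (f x * of_real (?w N x))) =
       \<bar>1 / real (Suc N)\<bar> *\<^sub>R (LINT y|lborel. indicator ?I (t + 1 / real (Suc N) * y) *
         (f (t + 1 / real (Suc N) * y) * of_real (?w N (t + 1 / real (Suc N) * y))))"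
      by (rule lborel_integral_real_affine) simp
    also have "\<dots> = (LINT y|lborel. \<bar>1 / real (Suc N)\<bar> *\<^sub>R (indicator ?I (t + 1 / real (Suc N) * y) *
         (f (t + 1 / real (Suc N) * y) * of_real (?w N (t + 1 / real (Suc N) * y)))))"
      by (rule integral_scaleR_right[symmetric])
    also have "\<dots> = (LINT y|lborel. ?g N y)"
    proof (intro Bochner_Integration.integral_cong refl)
      fix y
      have "\<bar>1 / real (Suc N)\<bar> * ?w N (t + 1 / real (Suc N) * y) = std_normal_density y"
        by (simp add: normal_density_def power_divide real_sqrt_divide real_sqrt_mult del: of_nat_Suc)
      then show "\<bar>1 / real (Suc N)\<bar> *\<^sub>R (indicator ?I (t + 1 / real (Suc N) * y) *
         (f (t + 1 / real (Suc N) * y) * of_real (?w N (t + 1 / real (Suc N) * y)))) = ?g N y"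
        by (simp only: scaleR_conv_of_real mult.left_commute[of "of_real _"] flip: of_real_mult)
    qed
    finally show ?thesis .
  qed
  have near: "(\<lambda>N. LINT y|lborel. ?g N y) \<longlonglongrightarrow> (LINT y|lborel. f t * of_real (std_normal_density y))"
  proof (rule integral_dominated_convergence)
    show "integrable lborel (\<lambda>y. C * std_normal_density y)" by simp
    show "AE y in lborel. norm (?g N y) \<le> C * std_normal_density y" for N
      using C C0 by (intro AE_I2) (auto simp: indicator_def norm_mult intro!: mult_right_mono)
    show "AE y in lborel. (\<lambda>N. ?g N y) \<longlonglongrightarrow> f t * of_real (std_normal_density y)"
    proof (intro AE_I2)
      fix y
      have z: "(\<lambda>N. t + 1 / real (Suc N) * y) \<longlonglongrightarrow> t" by real_asymp
      have "isCont f t" using cont by (simp add: continuous_on_eq_continuous_at)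
      then have fz: "(\<lambda>N. f (t + 1 / real (Suc N) * y)) \<longlonglongrightarrow> f t" by (rule isCont_tendsto_compose[OF _ z])
      have "eventually (\<lambda>N. t + 1 / real (Suc N) * y \<in> {t - 1<..<t + 1}) sequentially"
        by (rule topological_tendstoD[OF z]) auto
      then have ev: "eventually (\<lambda>N. f (t + 1 / real (Suc N) * y) * of_real (std_normal_density y) = ?g N y) sequentially"
        by eventually_elim auto
      show "(\<lambda>N. ?g N y) \<longlonglongrightarrow> f t * of_real (std_normal_density y)"
        by (rule Lim_transform_eventually[OF tendsto_mult_right[OF fz] ev])
    qed
  qed measurable
  have eq1: "(LINT y|lborel. f t * complex_of_real (std_normal_density y)) = f t"
    by (simp only: integral_mult_right_zero integral_complex_of_real) simp
  have "(\<lambda>N. LINT x|lborel. indicator ?I x * (f x * of_real (?w N x))) \<longlonglongrightarrow> f t"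
    using near by (simp only: near_eq eq1)
  moreover have "(\<lambda>N. LINT x|lborel. indicator (-?I) x * (f x * of_real (?w N x))) \<longlonglongrightarrow> 0"
    using far by (simp only: Bochner_Integration.integral_zero)
  ultimately have "(\<lambda>N. (LINT x|lborel. indicator ?I x * (f x * of_real (?w N x))) +
       (LINT x|lborel. indicator (-?I) x * (f x * of_real (?w N x)))) \<longlonglongrightarrow> f t + 0"
    by (rule tendsto_add)
  moreover have "(LINT x|lborel. indicator ?I x * (f x * of_real (?w N x))) +
       (LINT x|lborel. indicator (-?I) x * (f x * of_real (?w N x))) = (LINT x|lborel. f x * of_real (?w N x))" for N
    unfolding Bochner_Integration.integral_add[OF near_int far_int, symmetric]
    by (intro Bochner_Integration.integral_cong) (auto simp: indicator_def)
  ultimately show ?thesis by (simp only: add_0_right)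
qed

lemma fourier_modulated_gaussian_L2:
  assumes \<sigma>: "\<sigma> > 0"
  shows "fourier (modulated_gaussian \<sigma> t) \<in> L2"
proof -
  have m: "fourier (modulated_gaussian \<sigma> t) \<in> borel_measurable borel"
    unfolding fourier_modulated_gaussian[OF \<sigma>, abs_def] by measurable
  have "(\<lambda>x. (cmod (fourier (modulated_gaussian \<sigma> t) x))\<^sup>2) = (\<lambda>x. (1 / \<sigma>)\<^sup>2 * (cmod (modulated_gaussian (1 / \<sigma>) 0 (- t + 1 * x)))\<^sup>2)"
  proof
    fix x
    have "cmod (fourier (modulated_gaussian \<sigma> t) x) = 1 / \<sigma> * cmod (modulated_gaussian (1 / \<sigma>) 0 (- t + 1 * x))"
      using \<sigma> unfolding fourier_modulated_gaussian[OF \<sigma>] norm_modulated_gaussian norm_of_real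
      by (simp add: normal_density_def real_sqrt_mult abs_mult power_mult_distrib power_divide)
    then show "(cmod (fourier (modulated_gaussian \<sigma> t) x))\<^sup>2 = (1 / \<sigma>)\<^sup>2 * (cmod (modulated_gaussian (1 / \<sigma>) 0 (- t + 1 * x)))\<^sup>2"
      by (simp only: power_mult_distrib)
  qed
  moreover have "integrable lborel (\<lambda>x. (1 / \<sigma>)\<^sup>2 * (cmod (modulated_gaussian (1 / \<sigma>) 0 (- t + 1 * x)))\<^sup>2)"
    using lborel_integrable_real_affine[OF L2_square_integrable[OF modulated_gaussian_L2[of "1 / \<sigma>" 0]], of 1 "- t"] \<sigma>
    by simp
  ultimately show ?thesis using m by (simp add: L2_def)
qed

text \<open>Pair \<open>g\<close> with a modulated Gaussian of frequency \<open>t\<close> and let the Gaussian flatten. The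
  multiplication formula, passed to the \<open>L\<^sup>2\<close> limit, turns this pairing into averages of \<open>f\<close> around \<open>t\<close>,
  which converge to \<open>f t\<close> by continuity.\<close>

lemma fourier_L2_inversion:
  assumes F: "has_fourier_L2 f g" and cont: "continuous_on UNIV f" and g: "integrable lborel g"
  shows "f t = of_real (1 / sqrt (2 * pi)) * (LINT \<omega>|lborel. g \<omega> * exp (\<i> * complex_of_real (t * \<omega>)))"
proof -
  obtain h where h: "\<And>n. integrable lborel (h n)" "L2_converges h f" "L2_converges (\<lambda>n. fourier (h n)) g"
    using F by (auto simp: has_fourier_L2_def)
  have f: "f \<in> L2" using h(2) by (simp add: L2_converges_def)
  have [measurable]: "g \<in> borel_measurable borel" using borel_measurable_integrable[OF g] by simp
  have pair: "(LINT \<omega>|lborel. g \<omega> * modulated_gaussian \<sigma> t \<omega>) = of_real (sqrt (2 * pi)) * (LINT x|lborel. f x * of_real (normal_density t \<sigma> x))"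
    if \<sigma>: "\<sigma> > 0" for \<sigma>
  proof -
    let ?u = "modulated_gaussian \<sigma> t"
    have fu: "fourier ?u \<in> L2" by (rule fourier_modulated_gaussian_L2[OF \<sigma>])
    have "(\<lambda>n. LINT x|lborel. h n x * fourier ?u x) \<longlonglongrightarrow> (LINT x|lborel. f x * fourier ?u x)"
      by (rule L2_converges_pairing[OF h(2) fu])
    moreover have "(\<lambda>n. LINT \<omega>|lborel. fourier (h n) \<omega> * ?u \<omega>) \<longlonglongrightarrow> (LINT \<omega>|lborel. g \<omega> * ?u \<omega>)"
      by (rule L2_converges_pairing[OF h(3) modulated_gaussian_L2[OF \<sigma>]])
    ultimately have "(LINT \<omega>|lborel. g \<omega> * ?u \<omega>) = (LINT x|lborel. f x * fourier ?u x)"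
      unfolding fourier_multiplication_formula[OF h(1) modulated_gaussian_integrable[OF \<sigma>]]
      by (rule LIMSEQ_unique[rotated])
    also have "\<dots> = (LINT x|lborel. of_real (sqrt (2 * pi)) * (f x * of_real (normal_density t \<sigma> x)))"
      by (simp add: fourier_modulated_gaussian[OF \<sigma>] mult_ac)
    also have "\<dots> = of_real (sqrt (2 * pi)) * (LINT x|lborel. f x * of_real (normal_density t \<sigma> x))"
      by (rule integral_mult_right_zero)
    finally show ?thesis .
  qed
  have "(\<lambda>N. LINT \<omega>|lborel. g \<omega> * modulated_gaussian (1 / real (Suc N)) t \<omega>) \<longlonglongrightarrow>
      (LINT \<omega>|lborel. g \<omega> * exp (\<i> * complex_of_real (t * \<omega>)))"
  proof (rule integral_dominated_convergence)
    show "integrable lborel (\<lambda>\<omega>. cmod (g \<omega>))" using g by simp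
    show "AE \<omega> in lborel. norm (g \<omega> * modulated_gaussian (1 / real (Suc N)) t \<omega>) \<le> cmod (g \<omega>)" for N
      by (intro AE_I2) (simp add: norm_mult norm_modulated_gaussian mult_left_le)
    show "AE \<omega> in lborel. (\<lambda>N. g \<omega> * modulated_gaussian (1 / real (Suc N)) t \<omega>)
        \<longlonglongrightarrow> g \<omega> * exp (\<i> * complex_of_real (t * \<omega>))"
    proof (intro AE_I2)
      fix \<omega>
      have "(\<lambda>N. 1 / real (Suc N) * \<omega>) \<longlonglongrightarrow> 0" by real_asymp
      then have "(\<lambda>N. exp (- (1 / real (Suc N) * \<omega>)\<^sup>2 / 2)) \<longlonglongrightarrow> exp (- 0\<^sup>2 / 2)"
        by (intro tendsto_intros) auto
      then have "(\<lambda>N. exp (- (1 / real (Suc N) * \<omega>)\<^sup>2 / 2)) \<longlonglongrightarrow> 1" by simp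
      then have "(\<lambda>N. g \<omega> * (exp (\<i> * complex_of_real (t * \<omega>)) * of_real (exp (- (1 / real (Suc N) * \<omega>)\<^sup>2 / 2))))
        \<longlonglongrightarrow> g \<omega> * (exp (\<i> * complex_of_real (t * \<omega>)) * of_real 1)"
        by (intro tendsto_intros)
      then show "(\<lambda>N. g \<omega> * modulated_gaussian (1 / real (Suc N)) t \<omega>)
        \<longlonglongrightarrow> g \<omega> * exp (\<i> * complex_of_real (t * \<omega>))"
        by (simp only: modulated_gaussian_def of_real_1 mult_1_right)
    qed
    show "(\<lambda>\<omega>. g \<omega> * exp (\<i> * complex_of_real (t * \<omega>))) \<in> borel_measurable lborel"
      by simp
  qed simp
  then have "(\<lambda>N. of_real (sqrt (2 * pi)) * (LINT x|lborel. f x * of_real (normal_density t (1 / real (Suc N)) x)))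
      \<longlonglongrightarrow> (LINT \<omega>|lborel. g \<omega> * exp (\<i> * complex_of_real (t * \<omega>)))"
    by (simp only: pair zero_less_divide_1_iff of_nat_0_less_iff zero_less_Suc)
  moreover have "(\<lambda>N. of_real (sqrt (2 * pi)) * (LINT x|lborel. f x * of_real (normal_density t (1 / real (Suc N)) x)))
      \<longlonglongrightarrow> of_real (sqrt (2 * pi)) * f t"
    by (intro tendsto_mult tendsto_const normal_density_approximate_identity f cont)
  ultimately have "(LINT \<omega>|lborel. g \<omega> * exp (\<i> * complex_of_real (t * \<omega>))) = of_real (sqrt (2 * pi)) * f t"
    by (rule LIMSEQ_unique)
  moreover have "complex_of_real (1 / sqrt (2 * pi)) * (of_real (sqrt (2 * pi)) * f t) = f t"
    by (simp flip: mult.assoc of_real_mult)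
  ultimately show ?thesis by (simp only:)
qed

lemma nn_integral_normal_density:
  assumes "\<sigma> > 0"
  shows "(\<integral>\<^sup>+ x. ennreal (normal_density \<mu> \<sigma> x) \<partial>lborel) = 1"
  using assms by (subst nn_integral_eq_integral) auto

lemma normal_density_swap: "normal_density x \<sigma> y = normal_density y \<sigma> x"
  by (simp add: normal_density_def power2_commute)

text \<open>Young's inequality for convolution with a probability density, from
  \<open>\<bar>h x\<bar> \<bar>h y\<bar> \<le> (\<bar>h x\<bar>\<^sup>2 + \<bar>h y\<bar>\<^sup>2) / 2\<close> and the symmetry of the kernel.\<close>

lemma gaussian_young_inequality:
  assumes h: "h \<in> L2" and \<sigma>: "\<sigma> > 0"
  shows "(\<integral>\<^sup>+ x. \<integral>\<^sup>+ y. ennreal (cmod (h x) * (cmod (h y) * normal_density x \<sigma> y)) \<partial>lborel \<partial>lborel)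
         \<le> ennreal ((L2_norm h)\<^sup>2)"
proof -
  let ?q = "\<lambda>x. ennreal ((cmod (h x))\<^sup>2 / 2)"
  let ?w = "\<lambda>x y. ennreal (normal_density x \<sigma> y)"
  have [measurable]: "h \<in> borel_measurable borel" by (rule L2_measurable[OF h])
  have [measurable]: "(\<lambda>p. normal_density (fst p) \<sigma> (snd p)) \<in> borel_measurable (borel \<Otimes>\<^sub>M borel)"
    "(\<lambda>p. normal_density (snd p) \<sigma> (fst p)) \<in> borel_measurable (borel \<Otimes>\<^sub>M borel)"
    unfolding normal_density_def by measurable
  have int: "(\<integral>\<^sup>+ x. ?q x \<partial>lborel) = ennreal ((L2_norm h)\<^sup>2 / 2)"
    unfolding L2_norm_squared using L2_square_integrable[OF h] by (subst nn_integral_eq_integral) auto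
  have "(\<integral>\<^sup>+ x. \<integral>\<^sup>+ y. ennreal (cmod (h x) * (cmod (h y) * normal_density x \<sigma> y)) \<partial>lborel \<partial>lborel)
      \<le> (\<integral>\<^sup>+ x. \<integral>\<^sup>+ y. ?q x * ?w x y + ?q y * ?w x y \<partial>lborel \<partial>lborel)"
  proof (intro nn_integral_mono)
    fix x y
    have "2 * (cmod (h x) * cmod (h y)) \<le> (cmod (h x))\<^sup>2 + (cmod (h y))\<^sup>2"
      by (rule two_mult_le_sum_squares)
    then have "cmod (h x) * cmod (h y) \<le> (cmod (h x))\<^sup>2 / 2 + (cmod (h y))\<^sup>2 / 2" by simp
    then have "cmod (h x) * cmod (h y) * normal_density x \<sigma> y
        \<le> ((cmod (h x))\<^sup>2 / 2 + (cmod (h y))\<^sup>2 / 2) * normal_density x \<sigma> y"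
      by (intro mult_right_mono) auto
    then have "ennreal (cmod (h x) * (cmod (h y) * normal_density x \<sigma> y)) \<le>
        ennreal ((cmod (h x))\<^sup>2 / 2 * normal_density x \<sigma> y + (cmod (h y))\<^sup>2 / 2 * normal_density x \<sigma> y)"
      by (intro ennreal_leI) (simp add: distrib_right mult.assoc)
    also have "\<dots> = ?q x * ?w x y + ?q y * ?w x y" by (simp flip: ennreal_mult ennreal_plus)
    finally show "ennreal (cmod (h x) * (cmod (h y) * normal_density x \<sigma> y)) \<le> ?q x * ?w x y + ?q y * ?w x y" .
  qed
  also have "\<dots> = (\<integral>\<^sup>+ x. (\<integral>\<^sup>+ y. ?q x * ?w x y \<partial>lborel) + (\<integral>\<^sup>+ y. ?q y * ?w x y \<partial>lborel) \<partial>lborel)"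
    by (intro nn_integral_cong nn_integral_add) measurable
  also have "\<dots> = (\<integral>\<^sup>+ x. \<integral>\<^sup>+ y. ?q x * ?w x y \<partial>lborel \<partial>lborel) + (\<integral>\<^sup>+ x. \<integral>\<^sup>+ y. ?q y * ?w x y \<partial>lborel \<partial>lborel)"
    by (intro nn_integral_add) measurable
  also have "(\<integral>\<^sup>+ x. \<integral>\<^sup>+ y. ?q x * ?w x y \<partial>lborel \<partial>lborel) = (\<integral>\<^sup>+ x. ?q x \<partial>lborel)"
    by (simp add: nn_integral_cmult nn_integral_normal_density[OF \<sigma>])
  also have "(\<integral>\<^sup>+ x. \<integral>\<^sup>+ y. ?q y * ?w x y \<partial>lborel \<partial>lborel) = (\<integral>\<^sup>+ y. \<integral>\<^sup>+ x. ?q y * ?w x y \<partial>lborel \<partial>lborel)"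
    by (rule lborel_pair.Fubini') measurable
  also have "\<dots> = (\<integral>\<^sup>+ y. ?q y \<partial>lborel)"
  proof (intro nn_integral_cong)
    fix y
    have "(\<integral>\<^sup>+ x. ?q y * ?w x y \<partial>lborel) = (\<integral>\<^sup>+ x. ?q y * ?w y x \<partial>lborel)"
      by (simp only: normal_density_swap[of _ \<sigma> y])
    also have "\<dots> = ?q y" by (simp add: nn_integral_cmult nn_integral_normal_density[OF \<sigma>])
    finally show "(\<integral>\<^sup>+ x. ?q y * ?w x y \<partial>lborel) = ?q y" .
  qed
  also have "(\<integral>\<^sup>+ x. ?q x \<partial>lborel) + (\<integral>\<^sup>+ x. ?q x \<partial>lborel) = ennreal ((L2_norm h)\<^sup>2)"
    unfolding int by (simp flip: ennreal_plus)
  finally show ?thesis .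
qed

text \<open>With a Gaussian weight, the multiplication formula applied twice rewrites \<open>\<integral> \<bar>fourier h\<bar>\<^sup>2\<close> as a
  quadratic form of \<open>h\<close> with normal density kernel, which Young's inequality bounds. Then the
  Gaussian weight tends to \<open>1\<close>.\<close>

lemma plancherel_inequality:
  assumes h: "integrable lborel h" "h \<in> L2" and F: "fourier h \<in> L2"
  shows "L2_norm (fourier h) \<le> L2_norm h"
proof (rule power2_le_imp_le)
  have gauss: "(LINT \<omega>|lborel. (cmod (fourier h \<omega>))\<^sup>2 * exp (- (\<sigma> * \<omega>)\<^sup>2 / 2)) \<le> (L2_norm h)\<^sup>2"
    if \<sigma>: "\<sigma> > 0" for \<sigma>
  proof -
    \<comment> \<open>chosen so that \<open>fourier h \<cdot> v\<close> is \<open>\<bar>fourier h\<bar>\<^sup>2\<close> times a Gaussian\<close>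
    define v where "v = (\<lambda>\<omega>. cnj (fourier h \<omega>) * modulated_gaussian \<sigma> 0 \<omega>)"
    have F': "(\<lambda>\<omega>. cnj (fourier h \<omega>)) \<in> L2"
    proof -
      have "cnj \<in> borel_measurable borel"
        by (intro borel_measurable_continuous_onI continuous_intros)
      from measurable_compose[OF L2_measurable[OF F] this] show ?thesis
        using L2_square_integrable[OF F] by (simp add: L2_def)
    qed
    have v: "integrable lborel v"
      unfolding v_def by (rule L2_mult_integrable[OF F' modulated_gaussian_L2[OF \<sigma>]])
    have fv: "cmod (fourier v x) \<le> (LINT y|lborel. cmod (h y) * normal_density x \<sigma> y)" for x
    proof -
      have "fourier v x = cnj (of_real (1 / sqrt (2 * pi)) * (LINT \<omega>|lborel. fourier h \<omega> * modulated_gaussian \<sigma> x \<omega>))"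
      proof -
        have "v \<omega> * exp (- \<i> * complex_of_real \<omega> * complex_of_real x) = cnj (fourier h \<omega> * modulated_gaussian \<sigma> x \<omega>)" for \<omega>
          by (simp add: v_def modulated_gaussian_def exp_cnj mult_ac)
        then have "fourier v x = of_real (1 / sqrt (2 * pi)) * (LINT \<omega>|lborel. cnj (fourier h \<omega> * modulated_gaussian \<sigma> x \<omega>))"
          by (simp only: fourier_def[of v])
        then show ?thesis
          by (simp only: Bochner_Integration.integral_cnj complex_cnj_mult[of "of_real _"] complex_cnj_complex_of_real)
      qed
      also have "(LINT \<omega>|lborel. fourier h \<omega> * modulated_gaussian \<sigma> x \<omega>) =
          (LINT y|lborel. h y * fourier (modulated_gaussian \<sigma> x) y)"
        by (rule fourier_multiplication_formula[OF h(1) modulated_gaussian_integrable[OF \<sigma>]])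
      also have "\<dots> = (LINT y|lborel. of_real (sqrt (2 * pi)) * (h y * of_real (normal_density x \<sigma> y)))"
        by (simp add: fourier_modulated_gaussian[OF \<sigma>] mult_ac)
      also have "\<dots> = of_real (sqrt (2 * pi)) * (LINT y|lborel. h y * of_real (normal_density x \<sigma> y))"
        by (rule integral_mult_right_zero)
      finally have "cmod (fourier v x) = cmod (LINT y|lborel. h y * of_real (normal_density x \<sigma> y))"
        by (simp add: norm_mult norm_divide)
      also have "\<dots> \<le> (LINT y|lborel. cmod (h y * of_real (normal_density x \<sigma> y)))"
        by (rule integral_norm_bound)
      finally show ?thesis by (simp add: norm_mult)
    qed
    have "(LINT \<omega>|lborel. (cmod (fourier h \<omega>))\<^sup>2 * exp (- (\<sigma> * \<omega>)\<^sup>2 / 2)) = Re (LINT \<omega>|lborel. fourier h \<omega> * v \<omega>)"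
    proof -
      have "fourier h \<omega> * v \<omega> = of_real ((cmod (fourier h \<omega>))\<^sup>2 * exp (- (\<sigma> * \<omega>)\<^sup>2 / 2))" for \<omega>
      proof -
        have "fourier h \<omega> * cnj (fourier h \<omega>) = of_real ((cmod (fourier h \<omega>))\<^sup>2)"
          by (rule complex_norm_square[symmetric])
        then show ?thesis
          unfolding v_def mult.assoc[symmetric] by (simp only: of_real_mult) (simp add: modulated_gaussian_def)
      qed
      then show ?thesis by (simp only: integral_complex_of_real Re_complex_of_real)
    qed
    also have "\<dots> = Re (LINT x|lborel. h x * fourier v x)"
      by (simp only: fourier_multiplication_formula[OF h(1) v])
    also have "\<dots> \<le> cmod (LINT x|lborel. h x * fourier v x)" by (rule complex_Re_le_cmod)
    finally have le: "(LINT \<omega>|lborel. (cmod (fourier h \<omega>))\<^sup>2 * exp (- (\<sigma> * \<omega>)\<^sup>2 / 2)) \<le> cmod (LINT x|lborel. h x * fourier v x)" .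
    show ?thesis
    proof (cases "integrable lborel (\<lambda>x. h x * fourier v x)")
      case True
      have "ennreal (cmod (LINT x|lborel. h x * fourier v x)) \<le> (\<integral>\<^sup>+ x. ennreal (cmod (h x * fourier v x)) \<partial>lborel)"
        by (rule integral_norm_bound_ennreal[OF True])
      also have "\<dots> \<le> (\<integral>\<^sup>+ x. \<integral>\<^sup>+ y. ennreal (cmod (h x) * (cmod (h y) * normal_density x \<sigma> y)) \<partial>lborel \<partial>lborel)"
      proof (intro nn_integral_mono)
        fix x
        have int: "integrable lborel (\<lambda>y. cmod (h y) * normal_density x \<sigma> y)"
        proof -
          have "integrable lborel (\<lambda>y. h y * fourier (modulated_gaussian \<sigma> x) y)"
            by (rule L2_mult_integrable[OF h(2) fourier_modulated_gaussian_L2[OF \<sigma>]])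
          then have "integrable lborel (\<lambda>y. (1 / sqrt (2 * pi)) * cmod (h y * fourier (modulated_gaussian \<sigma> x) y))"
            by (intro integrable_mult_right integrable_norm)
          then show ?thesis
            unfolding fourier_modulated_gaussian[OF \<sigma>] by (simp add: norm_mult)
        qed
        have "ennreal (cmod (h x * fourier v x)) \<le> ennreal (LINT y|lborel. cmod (h x) * (cmod (h y) * normal_density x \<sigma> y))"
          using fv[of x] by (intro ennreal_leI) (simp add: norm_mult mult_left_mono)
        also have "\<dots> = (\<integral>\<^sup>+ y. ennreal (cmod (h x) * (cmod (h y) * normal_density x \<sigma> y)) \<partial>lborel)"
          using int by (intro nn_integral_eq_integral[symmetric]) auto
        finally show "ennreal (cmod (h x * fourier v x)) \<le> (\<integral>\<^sup>+ y. ennreal (cmod (h x) * (cmod (h y) * normal_density x \<sigma> y)) \<partial>lborel)" .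
      qed
      also have "\<dots> \<le> ennreal ((L2_norm h)\<^sup>2)" by (rule gaussian_young_inequality[OF h(2) \<sigma>])
      finally show ?thesis using le by (simp add: ennreal_le_iff)
    next
      case False
      then have "(LINT x|lborel. h x * fourier v x) = 0" by (rule not_integrable_integral_eq)
      then show ?thesis using le order_trans[OF _ zero_le_power2[of "L2_norm h"]] by simp
    qed
  qed
  have [measurable]: "fourier h \<in> borel_measurable borel" by (rule L2_measurable[OF F])
  have "(\<lambda>N. LINT \<omega>|lborel. (cmod (fourier h \<omega>))\<^sup>2 * exp (- (1 / real (Suc N) * \<omega>)\<^sup>2 / 2))
      \<longlonglongrightarrow> (LINT \<omega>|lborel. (cmod (fourier h \<omega>))\<^sup>2)"
  proof (rule integral_dominated_convergence)
    show "AE \<omega> in lborel. (\<lambda>N. (cmod (fourier h \<omega>))\<^sup>2 * exp (- (1 / real (Suc N) * \<omega>)\<^sup>2 / 2)) \<longlonglongrightarrow> (cmod (fourier h \<omega>))\<^sup>2"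
    proof (intro AE_I2)
      fix \<omega>
      have "(\<lambda>N. 1 / real (Suc N) * \<omega>) \<longlonglongrightarrow> 0" by real_asymp
      then have "(\<lambda>N. (cmod (fourier h \<omega>))\<^sup>2 * exp (- (1 / real (Suc N) * \<omega>)\<^sup>2 / 2)) \<longlonglongrightarrow> (cmod (fourier h \<omega>))\<^sup>2 * exp (- 0\<^sup>2 / 2)"
        by (intro tendsto_intros) auto
      then show "(\<lambda>N. (cmod (fourier h \<omega>))\<^sup>2 * exp (- (1 / real (Suc N) * \<omega>)\<^sup>2 / 2)) \<longlonglongrightarrow> (cmod (fourier h \<omega>))\<^sup>2"
        by simp
    qed
    show "integrable lborel (\<lambda>\<omega>. (cmod (fourier h \<omega>))\<^sup>2)" by (rule L2_square_integrable[OF F])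
    show "AE \<omega> in lborel. norm ((cmod (fourier h \<omega>))\<^sup>2 * exp (- (1 / real (Suc N) * \<omega>)\<^sup>2 / 2)) \<le> (cmod (fourier h \<omega>))\<^sup>2" for N
      by (intro AE_I2) (simp add: abs_mult mult_left_le)
  qed measurable
  then show "(L2_norm (fourier h))\<^sup>2 \<le> (L2_norm h)\<^sup>2"
    unfolding L2_norm_squared[of "fourier h"]
    by (rule LIMSEQ_le_const2) (intro exI[of _ 0] allI impI gauss, simp)
qed (rule L2_norm_nonneg)

lemma norm_indicator_squared: "(\<lambda>t. (cmod (indicator {a..b} t))\<^sup>2) = indicator {a..b}"
  for a b :: real
  by (auto split: split_indicator)

lemma indicator_interval_L2: "indicator {a..b} \<in> L2"
proof -
  have "integrable lborel (indicator {a..b} :: real \<Rightarrow> real)"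
    by (intro integrable_real_indicator) (auto simp: emeasure_lborel_Icc_eq)
  then show ?thesis by (simp add: L2_def norm_indicator_squared)
qed

lemma L2_norm_indicator_interval: "a \<le> b \<Longrightarrow> L2_norm (indicator {a..b}) = sqrt (b - a)"
  by (simp add: L2_norm_def norm_indicator_squared)

text \<open>A bandlimited function is the inverse transform of an integrable function whose norm it
  dominates. The inequality of norms passes to the limit along the approximating sequence.\<close>

lemma bandlimited_representation:
  assumes "bandlimited \<delta> f"
  obtains g where "g \<in> L2" "integrable lborel g" "\<And>\<omega>. \<bar>\<omega>\<bar> \<ge> \<delta> \<Longrightarrow> g \<omega> = 0" "L2_norm g \<le> L2_norm f"
    "\<And>t. f t = of_real (1 / sqrt (2 * pi)) * (LINT \<omega>|lborel. g \<omega> * exp (\<i> * complex_of_real (t * \<omega>)))"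
proof -
  obtain g where F: "has_fourier_L2 f g" and supp: "\<And>\<omega>. \<bar>\<omega>\<bar> \<ge> \<delta> \<Longrightarrow> g \<omega> = 0" and cont: "continuous_on UNIV f"
    using assms by (auto simp: bandlimited_def)
  obtain h where h: "\<And>n. integrable lborel (h n)" "L2_converges h f" "L2_converges (\<lambda>n. fourier (h n)) g"
    using F by (auto simp: has_fourier_L2_def)
  have g: "g \<in> L2" using h(3) by (simp add: L2_converges_def)
  have "L2_norm g \<le> L2_norm f"
  proof (rule LIMSEQ_le[OF L2_converges_norm[OF h(3)] L2_converges_norm[OF h(2)]])
    have "L2_norm (fourier (h n)) \<le> L2_norm (h n)" for n
      using h by (intro plancherel_inequality) (auto simp: L2_converges_def)
    then show "\<exists>N. \<forall>n\<ge>N. L2_norm (fourier (h n)) \<le> L2_norm (h n)" by blast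
  qed
  moreover have gi: "integrable lborel g"
  proof -
    have "indicator {- \<delta>..\<delta>} \<in> L2" by (rule indicator_interval_L2)
    then have "integrable lborel (\<lambda>t. g t * indicator {- \<delta>..\<delta>} t)"
      by (rule L2_mult_integrable[OF g])
    moreover have "(\<lambda>t. g t * indicator {- \<delta>..\<delta>} t) = g"
    proof
      fix t
      show "g t * indicator {- \<delta>..\<delta>} t = g t"
        using supp[of t] by (cases "\<bar>t\<bar> \<ge> \<delta>") (auto simp: indicator_def)
    qed
    ultimately show ?thesis by simp
  qed
  ultimately show thesis
    using that g supp fourier_L2_inversion[OF F cont gi] by blast
qed

section \<open>Decay at infinity and continuity\<close>

lemma norm_exp_diff_le: "cmod (exp (\<i> * complex_of_real a) - exp (\<i> * complex_of_real b)) \<le> \<bar>a - b\<bar>"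
proof -
  have "cmod (exp (\<i> * complex_of_real a) - exp (\<i> * complex_of_real b)) \<le> 1 * cmod (\<i> * complex_of_real a - \<i> * complex_of_real b)"
  proof (rule field_differentiable_bound[where S = "{z. Re z \<le> 0}"])
    show "convex {z::complex. Re z \<le> 0}" by (rule convex_halfspace_Re_le)
    show "(exp has_field_derivative exp z) (at z within {z. Re z \<le> 0})" for z :: complex
      by (rule DERIV_subset[OF DERIV_exp]) simp
  qed auto
  also have "\<dots> = \<bar>a - b\<bar>"
    by (simp add: norm_mult flip: right_diff_distrib of_real_diff)
  finally show ?thesis .
qed

text \<open>If \<open>\<bar>f t\<bar> \<ge> \<epsilon>\<close> then \<open>\<bar>f\<bar> \<ge> \<epsilon> / 2\<close> on an interval of fixed length around \<open>t\<close>, which contributes a fixed amount to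
  the integral of \<open>\<bar>f\<bar>\<^sup>2\<close>; far out the tails of that integral are smaller.\<close>

lemma L2_lipschitz_tendsto_0:
  fixes f :: "real \<Rightarrow> complex"
  assumes f: "f \<in> L2" and lip: "\<And>s t. cmod (f s - f t) \<le> L * \<bar>s - t\<bar>" and L: "L > 0"
  shows "(f \<longlongrightarrow> 0) at_infinity"
proof (rule tendstoI)
  fix \<epsilon> :: real assume \<epsilon>: "\<epsilon> > 0"
  \<comment> \<open>within this radius \<open>f\<close> changes by at most \<open>\<epsilon> / 2\<close>\<close>
  define r where "r = \<epsilon> / (2 * L)"
  have r: "r > 0" using \<epsilon> L by (simp add: r_def)
  let ?q = "\<lambda>x. (cmod (f x))\<^sup>2"
  have q: "integrable lborel ?q" by (rule L2_square_integrable[OF f])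
  have [measurable]: "f \<in> borel_measurable borel" by (rule L2_measurable[OF f])
  have "(\<lambda>N. LINT x|lborel. indicator {x. \<bar>x\<bar> > real N} x * ?q x) \<longlonglongrightarrow> (LINT x|(lborel::real measure). (0::real))"
  proof (rule integral_dominated_convergence[OF _ _ q])
    show "AE x in lborel. (\<lambda>N. indicator {x. \<bar>x\<bar> > real N} x * ?q x) \<longlonglongrightarrow> 0"
    proof (intro AE_I2 tendsto_eventually)
      fix x :: real
      show "eventually (\<lambda>N. indicator {x. \<bar>x\<bar> > real N} x * ?q x = 0) sequentially"
        using eventually_ge_at_top[of "nat \<lceil>\<bar>x\<bar>\<rceil>"] by eventually_elim (auto simp: indicator_def)
    qed
  qed (auto simp: indicator_def)
  then have tail: "(\<lambda>N. LINT x|lborel. indicator {x. \<bar>x\<bar> > real N} x * ?q x) \<longlonglongrightarrow> 0" by simp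
  have "0 < r * \<epsilon>\<^sup>2 / 4" using r \<epsilon> by simp
  from order_tendstoD(2)[OF tail this] obtain N where
    N: "(LINT x|lborel. indicator {x. \<bar>x\<bar> > real N} x * ?q x) < r * \<epsilon>\<^sup>2 / 4"
    by (auto simp: eventually_sequentially)
  have small: "cmod (f t) < \<epsilon>" if t: "\<bar>t\<bar> > real N + r" for t
  proof (rule ccontr)
    assume "\<not> cmod (f t) < \<epsilon>"
    then have ft: "cmod (f t) \<ge> \<epsilon>" by simp
    have "(\<epsilon> / 2)\<^sup>2 * measure lborel {t - r..t + r} = (LINT x|lborel. (\<epsilon> / 2)\<^sup>2 * indicator {t - r..t + r} x)"
      by simp
    also have "\<dots> \<le> (LINT x|lborel. indicator {x. \<bar>x\<bar> > real N} x * ?q x)"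
    proof (rule integral_mono)
      show "integrable lborel (\<lambda>x. (\<epsilon> / 2)\<^sup>2 * indicator {t - r..t + r} x)"
        by (intro integrable_mult_right integrable_real_indicator) (auto simp: emeasure_lborel_Icc_eq)
      show "integrable lborel (\<lambda>x. indicator {x. \<bar>x\<bar> > real N} x * ?q x)"
        by (rule Bochner_Integration.integrable_bound[OF q]) (auto simp: indicator_def)
      fix x
      show "(\<epsilon> / 2)\<^sup>2 * indicator {t - r..t + r} x \<le> indicator {x. \<bar>x\<bar> > real N} x * ?q x"
      proof (cases "x \<in> {t - r..t + r}")
        case True
        then have xt: "\<bar>t - x\<bar> \<le> r" by auto
        then have "\<bar>x\<bar> > real N" using t by linarith
        have "cmod (f t - f x) \<le> L * r" using lip[of t x] xt L mult_left_mono[OF xt, of L] by linarith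
        also have "\<dots> = \<epsilon> / 2" using L by (simp add: r_def)
        finally have "cmod (f x) \<ge> \<epsilon> / 2" using ft norm_triangle_ineq2[of "f t" "f x"] by linarith
        then have "(\<epsilon> / 2)\<^sup>2 \<le> ?q x" using \<epsilon> by (intro power_mono) auto
        then show ?thesis using True \<open>\<bar>x\<bar> > real N\<close> by simp
      qed auto
    qed
    also have "\<dots> < r * \<epsilon>\<^sup>2 / 4" by (rule N)
    finally show False using r \<epsilon> by (simp add: power2_eq_square)
  qed
  have "eventually (\<lambda>t::real. norm t \<ge> real N + r + 1) at_infinity"
    by (rule eventually_at_infinityI) simp
  then show "eventually (\<lambda>t. dist (f t) 0 < \<epsilon>) at_infinity"
    by eventually_elim (use small in \<open>auto simp: dist_norm\<close>)
qed

text \<open>Bounded frequencies make \<open>f\<close> Lipschitz continuous, with constant at most \<open>\<delta> \<integral> \<bar>g\<bar>\<close>.\<close>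

lemma bandlimited_tendsto_0:
  assumes "bandlimited \<delta> f"
  shows "(f \<longlongrightarrow> 0) at_infinity"
proof -
  obtain g where g: "g \<in> L2" "integrable lborel g" "\<And>\<omega>. \<bar>\<omega>\<bar> \<ge> \<delta> \<Longrightarrow> g \<omega> = 0"
    and rep: "\<And>t. f t = of_real (1 / sqrt (2 * pi)) * (LINT \<omega>|lborel. g \<omega> * exp (\<i> * complex_of_real (t * \<omega>)))"
    using bandlimited_representation[OF assms] by metis
  have \<delta>: "\<delta> > 0" and f: "f \<in> L2" using assms by (auto simp: bandlimited_def)
  define I where "I = (LINT \<omega>|lborel. cmod (g \<omega>))"
  have I: "I \<ge> 0" by (simp add: I_def)
  have mg: "g \<in> borel_measurable borel" by (rule L2_measurable[OF g(1)])
  have ge_int: "integrable lborel (\<lambda>\<omega>. g \<omega> * exp (\<i> * complex_of_real (t * \<omega>)))" for t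
    by (rule Bochner_Integration.integrable_bound[OF g(2)]) (use mg in \<open>auto simp: norm_mult\<close>)
  have "cmod (f s - f t) \<le> (\<delta> * I + 1) * \<bar>s - t\<bar>" for s t
  proof -
    have "f s - f t = of_real (1 / sqrt (2 * pi)) *
        (LINT \<omega>|lborel. g \<omega> * (exp (\<i> * complex_of_real (s * \<omega>)) - exp (\<i> * complex_of_real (t * \<omega>))))"
      unfolding rep[of s] rep[of t]
      using ge_int[of s] ge_int[of t] by (simp add: right_diff_distrib)
    also have "cmod \<dots> \<le> 1 * (LINT \<omega>|lborel. cmod (g \<omega> * (exp (\<i> * complex_of_real (s * \<omega>)) - exp (\<i> * complex_of_real (t * \<omega>)))))"
      unfolding norm_mult[of "of_real _"]
    proof (intro mult_mono integral_norm_bound)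
      have "1 \<le> 2 * pi" using pi_gt3 by linarith
      then have "1 \<le> sqrt (2 * pi)" by simp
      then have "1 / sqrt (2 * pi) \<le> 1" by simp
      then show "cmod (of_real (1 / sqrt (2 * pi))) \<le> 1" by (simp add: norm_divide)
    qed auto
    also have "\<dots> \<le> 1 * (LINT \<omega>|lborel. cmod (g \<omega>) * (\<delta> * \<bar>s - t\<bar>))"
    proof (intro mult_left_mono integral_mono)
      show "integrable lborel (\<lambda>\<omega>. cmod (g \<omega> * (exp (\<i> * complex_of_real (s * \<omega>)) - exp (\<i> * complex_of_real (t * \<omega>)))))"
        using Bochner_Integration.integrable_diff[OF ge_int[of s] ge_int[of t]]
        by (intro integrable_norm) (simp add: right_diff_distrib)
      show "integrable lborel (\<lambda>\<omega>. cmod (g \<omega>) * (\<delta> * \<bar>s - t\<bar>))" using g(2) by simp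
      fix \<omega>
      show "cmod (g \<omega> * (exp (\<i> * complex_of_real (s * \<omega>)) - exp (\<i> * complex_of_real (t * \<omega>)))) \<le> cmod (g \<omega>) * (\<delta> * \<bar>s - t\<bar>)"
      proof (cases "\<bar>\<omega>\<bar> \<ge> \<delta>")
        case True
        then show ?thesis using g(3) by simp
      next
        case False
        have "cmod (exp (\<i> * complex_of_real (s * \<omega>)) - exp (\<i> * complex_of_real (t * \<omega>))) \<le> \<bar>s * \<omega> - t * \<omega>\<bar>"
          by (rule norm_exp_diff_le)
        also have "s * \<omega> - t * \<omega> = \<omega> * (s - t)" by (simp add: algebra_simps)
        also have "\<bar>\<omega> * (s - t)\<bar> = \<bar>\<omega>\<bar> * \<bar>s - t\<bar>" by (rule abs_mult)
        also have "\<dots> \<le> \<delta> * \<bar>s - t\<bar>" using False by (intro mult_right_mono) auto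
        finally show ?thesis unfolding norm_mult by (intro mult_left_mono) auto
      qed
    qed simp
    also have "\<dots> = \<delta> * I * \<bar>s - t\<bar>" by (simp add: I_def mult_ac)
    also have "\<dots> \<le> (\<delta> * I + 1) * \<bar>s - t\<bar>" by (intro mult_right_mono) auto
    finally show ?thesis .
  qed
  moreover have "\<delta> * I + 1 > 0" using I \<delta> by (intro add_nonneg_pos) auto
  ultimately show ?thesis by (rule L2_lipschitz_tendsto_0[OF f])
qed

lemma integer_window_finite:
  fixes t r :: real
  shows "finite {k::int. \<bar>t - of_int k\<bar> \<le> r}"
proof (rule finite_subset)
  show "{k::int. \<bar>t - of_int k\<bar> \<le> r} \<subseteq> {\<lfloor>t - r\<rfloor>..\<lceil>t + r\<rceil>}"
    by (auto simp: abs_le_iff) linarith+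
qed simp

text \<open>The sum over all integers reduces to any finite set containing the lattice points within distance
  \<open>m\<close> of \<open>t\<close>. The freedom in the choice of the set serves to keep it fixed while \<open>t\<close> varies.\<close>

lemma regularized_shannon_eq_sum:
  assumes A: "finite A" "\<And>k. \<bar>t - of_int k\<bar> \<le> real m \<Longrightarrow> k \<in> A"
  shows "regularized_shannon (sinh_window m \<beta>) m f t =
    (\<Sum>k\<in>A. f (of_int k) * of_real (cardinal_sine (t - of_int k) * sinh_window m \<beta> (t - of_int k)))"
proof -
  let ?s = "\<lambda>k::int. f (of_int k) * of_real (cardinal_sine (t - of_int k) * sinh_window m \<beta> (t - of_int k))"
  have "regularized_shannon (sinh_window m \<beta>) m f t = (\<Sum>\<^sub>\<infinity>k::int. ?s k)"
    unfolding regularized_shannon_def by (intro infsum_cong) (auto simp: sinh_window_def)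
  also have "\<dots> = (\<Sum>\<^sub>\<infinity>k\<in>A. ?s k)"
  proof (rule infsum_cong_neutral)
    fix k assume "k \<in> UNIV - A"
    then have "\<not> \<bar>t - of_int k\<bar> \<le> real m" using A(2) by blast
    then have "t - of_int k \<notin> {- real m..real m}" by auto
    then have "sinh_window m \<beta> (t - of_int k) = 0" by (simp only: sinh_window_def if_False)
    then show "?s k = 0" by simp
  qed auto
  also have "\<dots> = (\<Sum>k\<in>A. ?s k)" using A(1) by simp
  finally show ?thesis .
qed

lemma isCont_cardinal_sine: "isCont cardinal_sine t"
proof -
  have "cardinal_sine = (\<lambda>t. sinc (pi * t))" by (rule ext) (simp add: cardinal_sine_def)
  moreover have "continuous_on UNIV (\<lambda>t. sinc (pi * t))"
    by (rule continuous_on_sinc) (intro continuous_intros)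
  ultimately have "continuous_on UNIV cardinal_sine" by (simp only:)
  then show ?thesis by (simp add: continuous_on_eq_continuous_at)
qed

text \<open>Clipping the radicand at zero absorbs the case distinction and makes continuity at \<open>\<plusminus>m\<close> visible.\<close>

lemma sinh_window_eq:
  assumes "m \<ge> 1"
  shows "sinh_window m \<beta> t = 1 / sinh \<beta> * sinh (\<beta> * sqrt (max 0 (1 - t\<^sup>2 / (real m)\<^sup>2)))"
proof -
  have "t \<in> {- real m..real m} \<longleftrightarrow> \<bar>t\<bar> \<le> \<bar>real m\<bar>" by auto
  also have "\<dots> \<longleftrightarrow> t\<^sup>2 \<le> (real m)\<^sup>2" by (rule abs_le_square_iff)
  also have "\<dots> \<longleftrightarrow> 0 \<le> 1 - t\<^sup>2 / (real m)\<^sup>2" using assms by (simp add: divide_le_eq)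
  finally show ?thesis by (auto simp: sinh_window_def max_def)
qed

lemma isCont_sinh_window:
  assumes "m \<ge> 1"
  shows "isCont (sinh_window m \<beta>) t"
  unfolding sinh_window_eq[OF assms, abs_def] by (intro continuous_intros) (use assms in auto)

lemma sinh_window_bounds:
  assumes "m \<ge> 1" "\<beta> > 0"
  shows "\<bar>sinh_window m \<beta> t\<bar> \<le> 1"
proof -
  have "sqrt (max 0 (1 - t\<^sup>2 / (real m)\<^sup>2)) \<le> 1" by simp
  then have "\<beta> * sqrt (max 0 (1 - t\<^sup>2 / (real m)\<^sup>2)) \<le> \<beta> * 1" using assms by (intro mult_left_mono) auto
  then have "sinh (\<beta> * sqrt (max 0 (1 - t\<^sup>2 / (real m)\<^sup>2))) \<le> sinh \<beta>" by simp
  moreover have "0 \<le> sinh (\<beta> * sqrt (max 0 (1 - t\<^sup>2 / (real m)\<^sup>2)))" using assms by simp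
  moreover have "sinh \<beta> > 0" using assms by simp
  ultimately show ?thesis unfolding sinh_window_eq[OF assms(1)] by (simp add: abs_mult)
qed

text \<open>Near a point \<open>t\<^sub>0\<close> one finite index set serves all arguments within distance one.\<close>

lemma continuous_regularized_shannon:
  assumes m: "m \<ge> 1"
  shows "continuous_on UNIV (regularized_shannon (sinh_window m \<beta>) m f)"
  unfolding continuous_on_eq_continuous_at[OF open_UNIV]
proof
  fix t0 :: real
  define A where "A = {k::int. \<bar>t0 - of_int k\<bar> \<le> real m + 1}"
  have A: "finite A" unfolding A_def by (rule integer_window_finite)
  let ?S = "\<lambda>t. \<Sum>k\<in>A. f (of_int k) * of_real (cardinal_sine (t - of_int k) * sinh_window m \<beta> (t - of_int k))"
  have eq: "regularized_shannon (sinh_window m \<beta>) m f t = ?S t" if "t \<in> ball t0 1" for t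
    using that A by (intro regularized_shannon_eq_sum) (auto simp: A_def dist_real_def)
  have shift: "isCont (\<lambda>t. t - of_int k) t0" for k :: int by (intro continuous_intros)
  have cs: "isCont (\<lambda>t. cardinal_sine (t - of_int k) * sinh_window m \<beta> (t - of_int k)) t0" for k :: int
    by (rule continuous_mult[OF isCont_o2[OF shift isCont_cardinal_sine] isCont_o2[OF shift isCont_sinh_window[OF m]]])
  have "isCont ?S t0"
    by (rule continuous_sum) (rule continuous_mult[OF continuous_const continuous_of_real[OF cs]])
  moreover have "eventually (\<lambda>t. regularized_shannon (sinh_window m \<beta>) m f t = ?S t) (nhds t0)"
    using eq by (auto simp: eventually_nhds intro!: exI[of _ "ball t0 1"])
  ultimately show "isCont (regularized_shannon (sinh_window m \<beta>) m f) t0"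
    by (simp add: isCont_cong)
qed

text \<open>Indexing by the offset from \<open>\<lfloor>t\<rfloor>\<close> gives a fixed finite sum in which every term tends to zero.\<close>

lemma regularized_shannon_tendsto_0:
  assumes m: "m \<ge> 1" and \<beta>: "\<beta> > 0" and f: "(f \<longlongrightarrow> 0) at_infinity"
  shows "(regularized_shannon (sinh_window m \<beta>) m f \<longlongrightarrow> 0) at_infinity"
proof -
  let ?J = "{- int m - 1..int m + 1}"
  have eq: "regularized_shannon (sinh_window m \<beta>) m f t =
     (\<Sum>j\<in>?J. f (of_int (\<lfloor>t\<rfloor> + j)) * of_real (cardinal_sine (t - of_int (\<lfloor>t\<rfloor> + j)) * sinh_window m \<beta> (t - of_int (\<lfloor>t\<rfloor> + j))))" for t
  proof -
    have "k \<in> (\<lambda>j. \<lfloor>t\<rfloor> + j) ` ?J" if "\<bar>t - of_int k\<bar> \<le> real m" for k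
    proof
      show "k = \<lfloor>t\<rfloor> + (k - \<lfloor>t\<rfloor>)" by simp
      have "\<bar>of_int (k - \<lfloor>t\<rfloor>)\<bar> \<le> real m + 1" using that floor_correct[of t] unfolding of_int_diff by linarith
      then show "k - \<lfloor>t\<rfloor> \<in> ?J" by auto
    qed
    then have "regularized_shannon (sinh_window m \<beta>) m f t =
      (\<Sum>k\<in>(\<lambda>j. \<lfloor>t\<rfloor> + j) ` ?J. f (of_int k) * of_real (cardinal_sine (t - of_int k) * sinh_window m \<beta> (t - of_int k)))"
      by (intro regularized_shannon_eq_sum) auto
    then show ?thesis by (subst (asm) sum.reindex) (auto simp: inj_on_def)
  qed
  have "((\<lambda>t. \<Sum>j\<in>?J. f (of_int (\<lfloor>t\<rfloor> + j)) * of_real (cardinal_sine (t - of_int (\<lfloor>t\<rfloor> + j)) * sinh_window m \<beta> (t - of_int (\<lfloor>t\<rfloor> + j)))) \<longlongrightarrow> (\<Sum>j\<in>?J. 0)) at_infinity"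
  proof (intro tendsto_sum)
    fix j
    have "filterlim (\<lambda>t::real. real_of_int (\<lfloor>t\<rfloor> + j)) at_infinity at_infinity"
      unfolding filterlim_at_infinity[OF order_refl]
    proof (intro allI impI)
      fix r :: real assume "r > 0"
      have "eventually (\<lambda>t::real. norm t \<ge> r + 1 + \<bar>of_int j\<bar>) at_infinity"
        by (rule eventually_at_infinityI) simp
      then show "eventually (\<lambda>t::real. r \<le> norm (real_of_int (\<lfloor>t\<rfloor> + j))) at_infinity"
      proof eventually_elim
        case (elim t)
        then show ?case using floor_correct[of t] by (simp add: abs_if split: if_splits) linarith+
      qed
    qed
    then have "((\<lambda>t::real. f (of_int (\<lfloor>t\<rfloor> + j))) \<longlongrightarrow> 0) at_infinity" by (rule filterlim_compose[OF f])
    then have lim: "((\<lambda>t::real. cmod (f (of_int (\<lfloor>t\<rfloor> + j)))) \<longlongrightarrow> 0) at_infinity" by (rule tendsto_norm_zero)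
    show "((\<lambda>t. f (of_int (\<lfloor>t\<rfloor> + j)) * of_real (cardinal_sine (t - of_int (\<lfloor>t\<rfloor> + j)) * sinh_window m \<beta> (t - of_int (\<lfloor>t\<rfloor> + j)))) \<longlongrightarrow> 0) at_infinity"
    proof (rule Lim_null_comparison[OF always_eventually lim], rule allI)
      fix t
      have "\<bar>cardinal_sine (t - of_int (\<lfloor>t\<rfloor> + j))\<bar> * \<bar>sinh_window m \<beta> (t - of_int (\<lfloor>t\<rfloor> + j))\<bar> \<le> 1"
        by (intro mult_le_one abs_cardinal_sine_le_1 sinh_window_bounds m \<beta>) auto
      then show "norm (f (of_int (\<lfloor>t\<rfloor> + j)) * of_real (cardinal_sine (t - of_int (\<lfloor>t\<rfloor> + j)) * sinh_window m \<beta> (t - of_int (\<lfloor>t\<rfloor> + j))))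
          \<le> cmod (f (of_int (\<lfloor>t\<rfloor> + j)))"
        unfolding norm_mult norm_of_real abs_mult by (intro mult_left_le) auto
    qed
  qed
  then show ?thesis by (simp only: eq[symmetric] sum.neutral_const)
qed

section \<open>The error estimate\<close>

text \<open>The error of \<open>f\<close> is the integral of \<open>g\<close> against the errors \<open>E\<close> of the exponentials, and \<open>g\<close> lives on
  \<open>[-\<delta>, \<delta>]\<close>, an interval whose indicator has norm \<open>\<surd>(2 \<delta>) \<le> \<surd>(2 \<pi>)\<close>.\<close>

lemma regularized_shannon_error_le:
  fixes m :: nat and \<delta> \<beta> :: real
  assumes m: "m \<ge> 2" and \<beta>: "\<beta> = real m * (pi - \<delta>)" "\<beta> \<ge> pi" and bl: "bandlimited \<delta> f"
  shows "cmod (f t - regularized_shannon (sinh_window m \<beta>) m f t) \<le> 9 * sqrt \<beta> * exp (- \<beta>) * L2_norm f"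
proof -
  obtain g where g: "g \<in> L2" "integrable lborel g" "\<And>\<omega>. \<bar>\<omega>\<bar> \<ge> \<delta> \<Longrightarrow> g \<omega> = 0" "L2_norm g \<le> L2_norm f"
    and rep: "\<And>t. f t = of_real (1 / sqrt (2 * pi)) * (LINT \<omega>|lborel. g \<omega> * exp (\<i> * complex_of_real (t * \<omega>)))"
    using bandlimited_representation[OF bl] by metis
  have \<delta>: "\<delta> > 0" using bl by (auto simp: bandlimited_def)
  have "0 < real m * (pi - \<delta>)" using \<beta> pi_gt_zero by linarith
  then have \<delta>pi: "\<delta> \<le> pi" using m by (simp add: zero_less_mult_iff)
  define c where "c = 1 / sqrt (2 * pi)"
  have c: "c > 0" by (simp add: c_def)
  define A where "A = {k::int. \<bar>t - of_int k\<bar> \<le> real m}"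
  have A: "finite A" "\<And>k. \<bar>t - of_int k\<bar> \<le> real m \<Longrightarrow> k \<in> A"
    unfolding A_def using integer_window_finite by auto
  define \<psi> where "\<psi> k = cardinal_sine (t - of_int k) * sinh_window m \<beta> (t - of_int k)" for k :: int
  define e where "e s \<omega> = exp (\<i> * complex_of_real (s * \<omega>))" for s \<omega> :: real
  define K where "K = 9 * sqrt \<beta> * exp (- \<beta>)"
  have "\<beta> \<ge> 0" using \<beta>(2) pi_gt_zero by linarith
  then have K: "K \<ge> 0" by (simp add: K_def)
  have mg: "g \<in> borel_measurable borel" by (rule L2_measurable[OF g(1)])
  have int: "integrable lborel (\<lambda>\<omega>. g \<omega> * e s \<omega>)" for s
    by (rule Bochner_Integration.integrable_bound[OF g(2)]) (use mg in \<open>auto simp: norm_mult e_def\<close>)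
  define E where "E \<omega> = e t \<omega> - (\<Sum>k\<in>A. e (of_int k) \<omega> * of_real (\<psi> k))" for \<omega>
  have E_le: "cmod (E \<omega>) \<le> K" if "\<bar>\<omega>\<bar> \<le> \<delta>" for \<omega>
    using exponential_localized_sampling_error[where t = t and A = A, OF m that \<beta> A]
    by (simp add: E_def e_def \<psi>_def K_def mult_ac)
  have gE: "(\<lambda>\<omega>. g \<omega> * E \<omega>) = (\<lambda>\<omega>. g \<omega> * e t \<omega> - (\<Sum>k\<in>A. g \<omega> * e (of_int k) \<omega> * of_real (\<psi> k)))"
    by (rule ext) (simp add: E_def right_diff_distrib sum_distrib_left mult.assoc)
  have gE_int: "integrable lborel (\<lambda>\<omega>. g \<omega> * E \<omega>)"
    unfolding gE by (intro Bochner_Integration.integrable_diff Bochner_Integration.integrable_sum integrable_mult_left int)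
  have "f t - regularized_shannon (sinh_window m \<beta>) m f t = f t - (\<Sum>k\<in>A. f (of_int k) * of_real (\<psi> k))"
    by (simp only: regularized_shannon_eq_sum[where t = t and A = A and m = m, OF A] \<psi>_def)
  also have "\<dots> = of_real c * (LINT \<omega>|lborel. g \<omega> * e t \<omega>) - (\<Sum>k\<in>A. of_real c * (LINT \<omega>|lborel. g \<omega> * e (of_int k) \<omega>) * of_real (\<psi> k))"
    unfolding rep[of t] rep[of "of_int _"] by (simp only: c_def e_def)
  also have "\<dots> = of_real c * ((LINT \<omega>|lborel. g \<omega> * e t \<omega>) - (\<Sum>k\<in>A. (LINT \<omega>|lborel. g \<omega> * e (of_int k) \<omega> * of_real (\<psi> k))))"
    unfolding integral_mult_left_zero by (simp add: right_diff_distrib sum_distrib_left mult.assoc)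
  also have "\<dots> = of_real c * (LINT \<omega>|lborel. g \<omega> * E \<omega>)"
  proof -
    have "(LINT \<omega>|lborel. g \<omega> * E \<omega>) = (LINT \<omega>|lborel. g \<omega> * e t \<omega>) -
        (LINT \<omega>|lborel. (\<Sum>k\<in>A. g \<omega> * e (of_int k) \<omega> * of_real (\<psi> k)))"
      unfolding gE
      by (intro Bochner_Integration.integral_diff Bochner_Integration.integrable_sum integrable_mult_left int)
    also have "(LINT \<omega>|lborel. (\<Sum>k\<in>A. g \<omega> * e (of_int k) \<omega> * of_real (\<psi> k))) =
        (\<Sum>k\<in>A. (LINT \<omega>|lborel. g \<omega> * e (of_int k) \<omega> * of_real (\<psi> k)))"
      by (intro Bochner_Integration.integral_sum integrable_mult_left int)
    finally show ?thesis by (simp only:)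
  qed
  finally have "cmod (f t - regularized_shannon (sinh_window m \<beta>) m f t) = c * cmod (LINT \<omega>|lborel. g \<omega> * E \<omega>)"
    using c by (simp add: norm_mult)
  also have "\<dots> \<le> c * (LINT \<omega>|lborel. K * (cmod (g \<omega>) * cmod (indicator {- \<delta>..\<delta>} \<omega>)))"
  proof (rule mult_left_mono)
    have "cmod (LINT \<omega>|lborel. g \<omega> * E \<omega>) \<le> (LINT \<omega>|lborel. cmod (g \<omega> * E \<omega>))" by (rule integral_norm_bound)
    also have "\<dots> \<le> (LINT \<omega>|lborel. K * (cmod (g \<omega>) * cmod (indicator {- \<delta>..\<delta>} \<omega>)))"
    proof (rule integral_mono)
      show "integrable lborel (\<lambda>\<omega>. cmod (g \<omega> * E \<omega>))" using gE_int by (rule integrable_norm)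
      show "integrable lborel (\<lambda>\<omega>. K * (cmod (g \<omega>) * cmod (indicator {- \<delta>..\<delta>} \<omega>)))"
        by (intro integrable_mult_right L2_norm_mult_integrable g(1) indicator_interval_L2)
      fix \<omega>
      show "cmod (g \<omega> * E \<omega>) \<le> K * (cmod (g \<omega>) * cmod (indicator {- \<delta>..\<delta>} \<omega>))"
      proof (cases "\<bar>\<omega>\<bar> \<ge> \<delta>")
        case True
        then show ?thesis using g(3) by simp
      next
        case False
        then have "cmod (g \<omega>) * cmod (E \<omega>) \<le> cmod (g \<omega>) * K" by (intro mult_left_mono E_le) auto
        moreover have "indicator {- \<delta>..\<delta>} \<omega> = (1::complex)" using False by (simp add: abs_less_iff not_le)
        ultimately show ?thesis by (simp add: norm_mult mult.commute)
      qed
    qed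
    finally show "cmod (LINT \<omega>|lborel. g \<omega> * E \<omega>) \<le> (LINT \<omega>|lborel. K * (cmod (g \<omega>) * cmod (indicator {- \<delta>..\<delta>} \<omega>)))" .
  qed (use c in simp)
  also have "\<dots> = c * K * (LINT \<omega>|lborel. cmod (g \<omega>) * cmod (indicator {- \<delta>..\<delta>} \<omega>))" by simp
  also have "\<dots> \<le> c * K * (L2_norm g * L2_norm (indicator {- \<delta>..\<delta>}))"
    using c K by (intro mult_left_mono L2_cauchy_schwarz g(1) indicator_interval_L2) auto
  also have "L2_norm (indicator {- \<delta>..\<delta>}) = sqrt (2 * \<delta>)"
    using L2_norm_indicator_interval[of "- \<delta>" \<delta>] \<delta> by simp
  also have "c * K * (L2_norm g * sqrt (2 * \<delta>)) = (c * sqrt (2 * \<delta>)) * (K * L2_norm g)" by simp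
  also have "\<dots> \<le> 1 * (K * L2_norm f)"
  proof (intro mult_mono mult_left_mono g(4))
    show "c * sqrt (2 * \<delta>) \<le> 1" using \<delta>pi by (simp add: c_def)
  qed (use K L2_norm_nonneg[of g] in auto)
  finally show ?thesis by (simp add: K_def)
qed

theorem theorem4p2:
  fixes m :: nat and f :: "real \<Rightarrow> complex" and \<delta> \<beta> :: real
  assumes "m \<ge> 2"
    and "f \<in> L2" and "continuous_on UNIV f"
    and "0 < \<delta>" and "\<delta> \<le> (real m - 1) / real m * pi"
    and "bandlimited \<delta> f"
    and "\<beta> = real m * (pi - \<delta>)"
  shows "(\<lambda>t. f t - regularized_shannon (sinh_window m \<beta>) m f t) \<in> C0 \<and>
         C0_norm (\<lambda>t. f t - regularized_shannon (sinh_window m \<beta>) m f t)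
           \<le> (4 + 9 * sqrt (real m * (pi - \<delta>))) * exp (- (real m * (pi - \<delta>))) * L2_norm f"
proof
  have m1: "m \<ge> 1" using assms(1) by simp
  \<comment> \<open>the restriction on the bandwidth says exactly that \<open>\<beta> \<ge> \<pi>\<close>\<close>
  have "real m * \<delta> \<le> real m * ((real m - 1) / real m * pi)"
    using assms(5) by (intro mult_left_mono) auto
  also have "\<dots> = real m * pi - pi" using m1 by (simp add: left_diff_distrib)
  finally have \<beta>pi: "\<beta> \<ge> pi" unfolding assms(7) right_diff_distrib by linarith
  then have \<beta>0: "\<beta> > 0" using pi_gt_zero by linarith
  have f0: "(f \<longlongrightarrow> 0) at_infinity" by (rule bandlimited_tendsto_0[OF assms(6)])
  have "((\<lambda>t. f t - regularized_shannon (sinh_window m \<beta>) m f t) \<longlongrightarrow> 0 - 0) at_infinity"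
    by (intro tendsto_diff f0 regularized_shannon_tendsto_0 m1 \<beta>0)
  moreover have "continuous_on UNIV (\<lambda>t. f t - regularized_shannon (sinh_window m \<beta>) m f t)"
    by (intro continuous_on_diff assms(3) continuous_regularized_shannon m1)
  ultimately show "(\<lambda>t. f t - regularized_shannon (sinh_window m \<beta>) m f t) \<in> C0"
    by (simp add: C0_def)
  have "C0_norm (\<lambda>t. f t - regularized_shannon (sinh_window m \<beta>) m f t) \<le> 9 * sqrt \<beta> * exp (- \<beta>) * L2_norm f"
    unfolding C0_norm_def
    by (intro cSUP_least regularized_shannon_error_le[OF assms(1,7) \<beta>pi assms(6)]) simp
  also have "\<dots> \<le> (4 + 9 * sqrt \<beta>) * exp (- \<beta>) * L2_norm f"
    by (intro mult_right_mono L2_norm_nonneg) auto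
  finally show "C0_norm (\<lambda>t. f t - regularized_shannon (sinh_window m \<beta>) m f t)
           \<le> (4 + 9 * sqrt (real m * (pi - \<delta>))) * exp (- (real m * (pi - \<delta>))) * L2_norm f"
    by (simp only: assms(7))
qed

end
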